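(* Let $J$ be a spectrally positive Lévy process with $\mathrm{Var}\,J_1=\sigma^2$, where $0<\sigma<\infty$. Fix $\gamma>1$ and, for $\epsilon>0$, consider the fluid tandem queue with input $J$ and service rates $r_1=\mathbb{E}J_1+\gamma\epsilon$ and $r_2=\mathbb{E}J_1+\epsilon$, with stationary workloads $(Q^{(1)},Q^{(2)})$ (the law of which depends on $\epsilon$). Then for all $s_1,s_2\ge0$, $$\lim_{\epsilon\downarrow0}\mathbb{E}\,e^{-s_1\epsilon Q^{(1)}-s_2\epsilon Q^{(2)}}=\frac{s_2(\gamma-2-s_1\sigma^2)-s_1\gamma+(s_2-s_1)\,\sigma\sqrt{\frac{\gamma^2}{\sigma^2}+2(\gamma-1)s_2}}{(s_2\sigma^2+2)\left((\gamma-1)s_2-\gamma s_1-\frac12 s_1^2\sigma^2\right)},$$ where at points $(s_1,s_2)$ at which the denominator vanishes the right-hand side is understood as its continuous extension.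
   Context: Fluid tandem queue: $J=\{J_t,t\ge 0\}$ is a spectrally positive Lévy process (no negative jumps), $J_0=0$, $\mathbb{E}|J_1|<\infty$. Two servers in series work at constant rates $r_1>r_2>\mathbb{E}J_1$. The input $J$ feeds the first (upstream) queue, whose server empties it at rate $r_1$; its output flows continuously into the second (downstream) queue, which is emptied at rate $r_2$. Formally, for $i=1,2$ let $X^{(i)}_t=J_t-r_it$ and $L^{(i)}_t=-\inf_{0\le s\le t}X^{(i)}_s$. Starting empty, the upstream workload is $Q^{(1)}_t=X^{(1)}_t+L^{(1)}_t$, the total workload is $Q^{(1)}_t+Q^{(2)}_t=X^{(2)}_t+L^{(2)}_t$, and hence the downstream workload is $Q^{(2)}_t=X^{(2)}_t+L^{(2)}_t-Q^{(1)}_t$. The pair $(Q^{(1)},Q^{(2)})$ denotes the steady-state workloads, i.e. a random vector whose law is the limit in distribution of $(Q^{(1)}_t,Q^{(2)}_t)$ as $t\to\infty$. *)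

theory Defs
  imports "HOL-Probability.Probability"
begin

definition cadlag_path :: "(real \<Rightarrow> real) \<Rightarrow> bool" where
  "cadlag_path x \<longleftrightarrow>
     (\<forall>t\<ge>0. (x \<longlongrightarrow> x t) (at_right t)) \<and>
     (\<forall>t>0. \<exists>l. (x \<longlongrightarrow> l) (at_left t))"

text \<open>Only the times \<open>t \<ge> 0\<close> of \<open>J t\<close> are relevant. As usual, \<open>J\<close> is taken to be a version all of whose
  paths start at 0 and are right-continuous with left limits.\<close>

definition levy_process :: "'a measure \<Rightarrow> (real \<Rightarrow> 'a \<Rightarrow> real) \<Rightarrow> bool" where
  "levy_process M J \<longleftrightarrow>
     prob_space M \<and>
     (\<forall>t\<ge>0. J t \<in> borel_measurable M) \<and>
     (\<forall>\<omega>\<in>space M. J 0 \<omega> = 0) \<and>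
     (\<forall>\<omega>\<in>space M. cadlag_path (\<lambda>t. J t \<omega>)) \<and>
     (\<forall>(n::nat) (t :: nat \<Rightarrow> real). 0 \<le> t 0 \<and> (\<forall>i<n. t i \<le> t (Suc i)) \<longrightarrow>
        prob_space.indep_vars M (\<lambda>_. borel) (\<lambda>i \<omega>. J (t (Suc i)) \<omega> - J (t i) \<omega>) {..<n}) \<and>
     (\<forall>s\<ge>0. \<forall>t\<ge>0. distr M borel (\<lambda>\<omega>. J (s + t) \<omega> - J s \<omega>) = distr M borel (J t))"

definition spectrally_positive_levy :: "'a measure \<Rightarrow> (real \<Rightarrow> 'a \<Rightarrow> real) \<Rightarrow> bool" where
  "spectrally_positive_levy M J \<longleftrightarrow>
     levy_process M J \<and>
     (\<forall>\<omega>\<in>space M. \<forall>t>0. \<forall>l. ((\<lambda>u. J u \<omega>) \<longlongrightarrow> l) (at_left t) \<longrightarrow> l \<le> J t \<omega>)"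

definition net_input :: "(real \<Rightarrow> 'a \<Rightarrow> real) \<Rightarrow> real \<Rightarrow> real \<Rightarrow> 'a \<Rightarrow> real" where
  "net_input J r t \<omega> = J t \<omega> - r * t"

definition regulator :: "(real \<Rightarrow> 'a \<Rightarrow> real) \<Rightarrow> real \<Rightarrow> real \<Rightarrow> 'a \<Rightarrow> real" where
  "regulator J r t \<omega> = - (INF s\<in>{0..t}. net_input J r s \<omega>)"

definition upstream :: "(real \<Rightarrow> 'a \<Rightarrow> real) \<Rightarrow> real \<Rightarrow> real \<Rightarrow> 'a \<Rightarrow> real" where
  "upstream J r1 t \<omega> = net_input J r1 t \<omega> + regulator J r1 t \<omega>"

definition downstream :: "(real \<Rightarrow> 'a \<Rightarrow> real) \<Rightarrow> real \<Rightarrow> real \<Rightarrow> real \<Rightarrow> 'a \<Rightarrow> real" where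
  "downstream J r1 r2 t \<omega> = net_input J r2 t \<omega> + regulator J r2 t \<omega> - upstream J r1 t \<omega>"

definition workload_law ::
  "'a measure \<Rightarrow> (real \<Rightarrow> 'a \<Rightarrow> real) \<Rightarrow> real \<Rightarrow> real \<Rightarrow> real \<Rightarrow> (real \<times> real) measure" where
  "workload_law M J r1 r2 t = distr M borel (\<lambda>\<omega>. (upstream J r1 t \<omega>, downstream J r1 r2 t \<omega>))"

text \<open>Weak convergence as time tends to infinity; the library's \<open>weak_conv_m\<close> covers only sequences of
  laws on the real line.\<close>

definition limit_law :: "(real \<Rightarrow> 'b :: topological_space measure) \<Rightarrow> 'b measure \<Rightarrow> bool" where
  "limit_law \<mu> \<nu> \<longleftrightarrow>
     prob_space \<nu> \<and> sets \<nu> = sets borel \<and>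
     (\<forall>f :: 'b \<Rightarrow> real. continuous_on UNIV f \<and> bounded (range f) \<longrightarrow>
        ((\<lambda>t. \<integral>x. f x \<partial>\<mu> t) \<longlongrightarrow> (\<integral>x. f x \<partial>\<nu>)) at_top)"

definition steady_state_law ::
  "'a measure \<Rightarrow> (real \<Rightarrow> 'a \<Rightarrow> real) \<Rightarrow> real \<Rightarrow> real \<Rightarrow> (real \<times> real) measure" where
  "steady_state_law M J r1 r2 = (THE \<nu>. limit_law (workload_law M J r1 r2) \<nu>)"

text \<open>The quotient \<open>N / D\<close> on \<open>S\<close>, extended by continuity from \<open>S \<inter> {D \<noteq> 0}\<close> to the zeros of \<open>D\<close>.\<close>

definition quotient_ext ::
  "'b :: t2_space set \<Rightarrow> ('b \<Rightarrow> real) \<Rightarrow> ('b \<Rightarrow> real) \<Rightarrow> 'b \<Rightarrow> real" where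
  "quotient_ext S N D p =
     (if D p \<noteq> 0 then N p / D p
      else Lim (at p within {q \<in> S. D q \<noteq> 0}) (\<lambda>q. N q / D q))"

end

theory Submission
  imports Defs
begin

text \<open>
  Let \<open>m = E (J 1)\<close>. By time reversal, the pair of the upstream and the total workload at time \<open>t\<close>, starting empty, is
  distributed like the pair of running suprema over \<open>[0, t]\<close> of \<open>J s - r1 * s\<close> and \<open>J s - r2 * s\<close>
  (\<open>workload_reversal\<close>). The latter increase to the suprema \<open>S1\<close> and \<open>S2\<close> over all times, so the steady-state law is the law of
  \<open>(S1, S2 - S1)\<close>, provided these suprema are finite (\<open>steady_state_law_eq\<close>). Finiteness, and even integrability, follows from
  second moments by Kingman's argument (\<open>kingman_bound\<close>), combined with Doob's inequality.

  The Laplace transform is not computed for fixed \<open>\<epsilon>\<close>. Conditioning on the first unit of time gives a Lindley recursion: up to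
  a contribution of the first unit of time itself, each of the two suprema is the positive part of the displacement at
  time 1 plus the supremum of the process restarted there, and the restarted pair is independent of the displacement and has
  the same law (\<open>lindley\<close>, \<open>shifted_sup_product\<close>). Write \<open>R1\<close> and \<open>R2\<close> for what the reflections add; then \<open>E R1 = \<gamma> * \<epsilon>\<close> and
  \<open>E R2 = \<epsilon>\<close>. Let \<open>A\<close> be the transform of the contents scaled by \<open>\<epsilon>\<close>. Expanding the exponential across one step to second
  order and taking expectations, \<open>A\<close> cancels to leading order and at order \<open>\<epsilon>\<^sup>2\<close> there remains the functional equation
  \<open>A(s1, s2) * (\<gamma> * s1 + s1\<^sup>2 * \<sigma>\<^sup>2 / 2 - (\<gamma> - 1) * s2) = (s1 - s2) * h(s2) + s2\<close> in the limit, with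
  \<open>h(s2) = E (R1 * exp (- s2 * \<epsilon> * S2)) / \<epsilon>\<close> (\<open>balance\<close>). The error terms vanish under a second moment assumption alone because
  \<open>R1\<close> and \<open>R2\<close> have vanishing means and a common square integrable majorant (\<open>slack_envelope_tendsto\<close>).

  The unknown \<open>h\<close> is found by the kernel method: where the bracket vanishes, the left-hand side vanishes, since \<open>A\<close> is bounded
  by 1, and \<open>h(s2)\<close> can be read off (\<open>idle_transform_tendsto\<close>). Then the equation determines \<open>A\<close> off the zeros of the bracket,
  and monotonicity of \<open>A\<close> in \<open>s1\<close> settles the zeros (\<open>scaled_transform_tendsto\<close>). Cancelling the common factor of numerator and
  denominator shows that the result is the stated quotient with its continuous extension (\<open>quotient_ext_eq\<close>).
\<close>

section \<open>Suprema of cadlag paths along grids\<close>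

text \<open>Everything measurable or distributional about a supremum over an interval of times is obtained from maxima
  over equidistant grids, because these involve finitely many increments only.\<close>

definition path_max :: "(real \<Rightarrow> real) \<Rightarrow> real \<Rightarrow> nat \<Rightarrow> real" where
  "path_max x \<delta> N = Max ((\<lambda>k. x (real k * \<delta>)) ` {..N})"

lemma path_max_ge: "k \<le> N \<Longrightarrow> x (real k * \<delta>) \<le> path_max x \<delta> N"
  unfolding path_max_def by (intro Max_ge) auto

lemma path_max_le: "(\<And>k. k \<le> N \<Longrightarrow> x (real k * \<delta>) \<le> B) \<Longrightarrow> path_max x \<delta> N \<le> B"
  unfolding path_max_def by (subst Max_le_iff) auto

lemma path_max_nonneg: "x 0 = 0 \<Longrightarrow> 0 \<le> path_max x \<delta> N"
  using path_max_ge[of 0 N x \<delta>] by simp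

lemma path_max_mono: "(\<And>k. k \<le> N \<Longrightarrow> x (real k * \<delta>) \<le> y (real k * \<delta>)) \<Longrightarrow> path_max x \<delta> N \<le> path_max y \<delta> N"
  by (rule path_max_le) (meson order_trans path_max_ge)

text \<open>One-sided limits bound a path on both sides of every point; the Bolzano principle patches the local
  bounds together. Boundedness is what gives the infimum in the definition of the regulator its intended meaning.\<close>

lemma cadlag_bounded:
  assumes "cadlag_path x"
  shows "\<exists>B. \<forall>s\<in>{0..t}. \<bar>x s\<bar> \<le> B"
proof (cases "0 \<le> t")
  case True
  define P where "P a b \<longleftrightarrow> (\<exists>B. \<forall>s\<in>{a..b} \<inter> {0..}. \<bar>x s\<bar> \<le> B)" for a b
  have "P 0 t"
    using True
  proof (induction rule: Bolzano)
    case (trans a b c)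
    then obtain B1 B2 where "\<forall>s\<in>{a..b} \<inter> {0..}. \<bar>x s\<bar> \<le> B1" "\<forall>s\<in>{b..c} \<inter> {0..}. \<bar>x s\<bar> \<le> B2"
      unfolding P_def by blast
    then have "\<forall>s\<in>{a..c} \<inter> {0..}. \<bar>x s\<bar> \<le> max B1 B2"
      by (auto simp: le_max_iff_disj)
    then show ?case unfolding P_def by blast
  next
    case (local s)
    have right: "\<exists>d>0. \<forall>u\<in>{s<..<s+d}. \<bar>x u\<bar> \<le> \<bar>x s\<bar> + 1"
    proof -
      have "(x \<longlongrightarrow> x s) (at_right s)" using assms local by (auto simp: cadlag_path_def)
      then have "\<forall>\<^sub>F u in at_right s. dist (x u) (x s) < 1" by (rule tendstoD) simp
      then obtain b where "b > s" "\<And>u. u > s \<Longrightarrow> u < b \<Longrightarrow> dist (x u) (x s) < 1"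
        unfolding eventually_at_right_field by blast
      then show ?thesis
        by (intro exI[of _ "b - s"]) (fastforce simp: dist_real_def)
    qed
    have left: "\<exists>d>0. \<exists>B. \<forall>u\<in>{s-d<..<s} \<inter> {0..}. \<bar>x u\<bar> \<le> B"
    proof (cases "s > 0")
      case True
      then obtain l where "(x \<longlongrightarrow> l) (at_left s)" using assms by (auto simp: cadlag_path_def)
      then have "\<forall>\<^sub>F u in at_left s. dist (x u) l < 1" by (rule tendstoD) simp
      then obtain b where b: "b < s" "\<And>u. u > b \<Longrightarrow> u < s \<Longrightarrow> dist (x u) l < 1"
        unfolding eventually_at_left_field by blast
      have "\<bar>x u\<bar> \<le> \<bar>l\<bar> + 1" if "u \<in> {s-(s-b)<..<s}" for u
        using b(2)[of u] that by (simp add: dist_real_def)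
      then show ?thesis using b(1)
        by (intro exI[of _ "s - b"] conjI exI[of _ "\<bar>l\<bar> + 1"]) auto
    next
      case False
      then have "{s-1<..<s} \<inter> {0..} = {}" by auto
      then show ?thesis by (metis empty_iff zero_less_one)
    qed
    from right left obtain d1 d2 B where d: "d1 > 0" "\<forall>u\<in>{s<..<s+d1}. \<bar>x u\<bar> \<le> \<bar>x s\<bar> + 1"
      "d2 > 0" "\<forall>u\<in>{s-d2<..<s} \<inter> {0..}. \<bar>x u\<bar> \<le> B" by blast
    have "P a b" if "a \<le> s" "s \<le> b" "b - a < min d1 d2" for a b
      unfolding P_def
    proof (intro exI[of _ "max B (\<bar>x s\<bar> + 1)"] ballI)
      fix u assume u: "u \<in> {a..b} \<inter> {0..}"
      consider "u < s" | "u = s" | "u > s" by linarith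
      then show "\<bar>x u\<bar> \<le> max B (\<bar>x s\<bar> + 1)"
      proof cases
        case 1 then have "u \<in> {s-d2<..<s} \<inter> {0..}" using u that by auto
        then show ?thesis using d(4) by (simp add: le_max_iff_disj)
      next
        case 3 then have "u \<in> {s<..<s+d1}" using u that by auto
        then show ?thesis using d(2) by (simp add: le_max_iff_disj)
      qed simp
    qed
    then show ?case using d by (intro exI[of _ "min d1 d2"]) auto
  qed
  then show ?thesis unfolding P_def by force
qed auto

lemma cadlag_affine:
  assumes "cadlag_path x"
  shows "cadlag_path (\<lambda>s. a * x s + b * s + c)"
  unfolding cadlag_path_def
proof (intro conjI allI impI)
  fix t :: real assume "0 \<le> t"
  then have "(x \<longlongrightarrow> x t) (at_right t)" using assms by (simp add: cadlag_path_def)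
  then show "((\<lambda>s. a * x s + b * s + c) \<longlongrightarrow> a * x t + b * t + c) (at_right t)"
    by (intro tendsto_intros)
next
  fix t :: real assume "0 < t"
  then obtain l where "(x \<longlongrightarrow> l) (at_left t)" using assms by (auto simp: cadlag_path_def)
  then have "((\<lambda>s. a * x s + b * s + c) \<longlongrightarrow> a * l + b * t + c) (at_left t)"
    by (intro tendsto_intros)
  then show "\<exists>l. ((\<lambda>s. a * x s + b * s + c) \<longlongrightarrow> l) (at_left t)" by blast
qed

lemma cadlag_abs:
  assumes "cadlag_path x"
  shows "cadlag_path (\<lambda>s. \<bar>x s\<bar>)"
  using assms unfolding cadlag_path_def
  by (intro conjI allI impI) (blast intro: tendsto_rabs)+

lemma cadlag_bdd_above: "cadlag_path x \<Longrightarrow> bdd_above (x ` {0..t})"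
proof -
  assume "cadlag_path x"
  then obtain B where "\<forall>s\<in>{0..t}. \<bar>x s\<bar> \<le> B" using cadlag_bounded by blast
  then show ?thesis by (intro bdd_aboveI[of _ B]) fastforce
qed

text \<open>By right-continuity a strict lower bound at \<open>s\<close> persists on some interval to the right of \<open>s\<close>, and such an interval
  contains a point of every sufficiently fine grid.\<close>

lemma right_cont_grid:
  fixes x :: "real \<Rightarrow> real"
  assumes lim: "(x \<longlongrightarrow> x s) (at_right s)" and "0 \<le> s" "0 < t" "a < x s"
  shows "\<forall>\<^sub>F n in sequentially. \<exists>k::nat. s < real k * (t / 2^n) \<and> real k * (t / 2^n) \<le> s + t / 2^n
           \<and> a < x (real k * (t / 2^n))"
proof -
  have "\<forall>\<^sub>F u in at_right s. a < x u" using lim \<open>a < x s\<close> by (rule order_tendstoD)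
  then obtain b where b: "b > s" "\<And>u. u > s \<Longrightarrow> u < b \<Longrightarrow> a < x u"
    unfolding eventually_at_right_field by blast
  have "(\<lambda>n. t / 2^n) \<longlonglongrightarrow> 0"
    using LIMSEQ_divide_realpow_zero[of 2 t] by simp
  then have "\<forall>\<^sub>F n in sequentially. t / 2^n < b - s" using b(1) by (intro order_tendstoD) auto
  then show ?thesis
  proof eventually_elim
    case (elim n)
    \<comment> \<open>the first grid point strictly to the right of \<open>s\<close>\<close>
    define k where "k = nat \<lfloor>s / (t / 2^n)\<rfloor> + 1"
    have d: "t / 2^n > 0" using assms by simp
    have "real k = of_int \<lfloor>s / (t / 2^n)\<rfloor> + 1" using assms by (simp add: k_def)
    then have "s / (t / 2^n) < real k" "real k \<le> s / (t / 2^n) + 1" by linarith+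
    then have "s < real k * (t / 2^n)" "(real k - 1) * (t / 2^n) \<le> s"
      using pos_divide_less_eq[OF d, of s "real k"] pos_le_divide_eq[OF d, of "real k - 1" s] by linarith+
    then have "s < real k * (t / 2^n)" "real k * (t / 2^n) \<le> s + t / 2^n"
      by (simp_all add: left_diff_distrib diff_divide_distrib)
    then show ?case using b(2) elim by (intro exI[of _ k]) auto
  qed
qed

text \<open>Grids of mesh \<open>t / 2^n\<close> contain the endpoint \<open>t\<close>, the only point of the interval that has no neighbours to its
  right in the interval.\<close>

lemma path_max_tendsto_SUP:
  assumes x: "cadlag_path x" and t: "0 < t"
  shows "(\<lambda>n. path_max x (t / 2^n) (2^n)) \<longlonglongrightarrow> (SUP s\<in>{0..t}. x s)"
proof (rule order_tendstoI)
  note bdd = cadlag_bdd_above[OF x, of t]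
  have le: "path_max x (t / 2^n) (2^n) \<le> (SUP s\<in>{0..t}. x s)" for n
  proof (rule path_max_le)
    fix k :: nat assume "k \<le> 2^n"
    then have "real k \<le> 2^n" by (metis of_nat_le_iff of_nat_numeral of_nat_power)
    then have "real k * (t / 2^n) \<in> {0..t}" using t by (auto simp: field_simps)
    then show "x (real k * (t / 2^n)) \<le> (SUP s\<in>{0..t}. x s)" by (rule cSUP_upper[OF _ bdd])
  qed
  fix a assume "(SUP s\<in>{0..t}. x s) < a"
  then show "\<forall>\<^sub>F n in sequentially. path_max x (t / 2^n) (2^n) < a"
    by (intro always_eventually allI le_less_trans[OF le])
next
  note bdd = cadlag_bdd_above[OF x, of t]
  fix a assume "a < (SUP s\<in>{0..t}. x s)"
  then obtain s where s: "s \<in> {0..t}" "a < x s" using less_cSUP_iff[OF _ bdd] t by auto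
  show "\<forall>\<^sub>F n in sequentially. a < path_max x (t / 2^n) (2^n)"
  proof (cases "s = t")
    case True
    have "x t \<le> path_max x (t / 2^n) (2^n)" for n
      using path_max_ge[of "2^n" "2^n" x "t / 2^n"] by simp
    then show ?thesis using s True by (intro always_eventually allI) (metis less_le_trans)
  next
    case False
    then have st: "0 \<le> s" "s < t" using s by auto
    have "(x \<longlongrightarrow> x s) (at_right s)" using x st by (auto simp: cadlag_path_def)
    note ev = right_cont_grid[OF this st(1) t s(2)]
    have "(\<lambda>n. t / 2^n) \<longlonglongrightarrow> 0"
      using LIMSEQ_divide_realpow_zero[of 2 t] by simp
    then have "\<forall>\<^sub>F n in sequentially. t / 2^n < t - s" using st(2) by (intro order_tendstoD) auto
    with ev show ?thesis
    proof eventually_elim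
      case (elim n)
      then obtain k where k: "real k * (t / 2^n) \<le> s + t / 2^n" "a < x (real k * (t / 2^n))" by blast
      have "real k * (t / 2^n) \<le> t" using k(1) elim by linarith
      then have "real k \<le> 2^n" using t by (simp add: field_simps)
      then have "k \<le> 2^n" by (metis of_nat_le_iff of_nat_numeral of_nat_power)
      then show ?case using path_max_ge[of k "2^n" x "t / 2^n"] k(2) by linarith
    qed
  qed
qed

text \<open>This form of the reflected process prepares the time reversal: the increments \<open>X t - X s\<close> of the path up to time
  \<open>t\<close> are the values of the path run backwards from \<open>t\<close>.\<close>

lemma upstream_eq_SUP:
  assumes x: "cadlag_path (\<lambda>t. J t \<omega>)" and t: "0 \<le> t"
  shows "net_input J r t \<omega> + regulator J r t \<omega> = (SUP s\<in>{0..t}. net_input J r t \<omega> - net_input J r s \<omega>)"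
proof -
  have "cadlag_path (\<lambda>s. (-1) * J s \<omega> + r * s + 0)" by (rule cadlag_affine[OF x])
  from cadlag_bdd_above[OF this] have b: "bdd_above ((\<lambda>s. - net_input J r s \<omega>) ` {0..t})"
    by (simp add: net_input_def)
  have "(SUP s\<in>{0..t}. net_input J r t \<omega> - net_input J r s \<omega>)
      = net_input J r t \<omega> + (SUP s\<in>{0..t}. - net_input J r s \<omega>)" (is "?L = ?c + ?R")
  proof (rule antisym)
    show "?L \<le> ?c + ?R"
      using t by (intro cSUP_least) (auto simp: diff_conv_add_uminus intro!: cSUP_upper2[OF b] simp del: add_uminus_conv_diff)
    have "cadlag_path (\<lambda>s. (-1) * J s \<omega> + r * s + ?c)" by (rule cadlag_affine[OF x])
    from cadlag_bdd_above[OF this]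
    have b': "bdd_above ((\<lambda>s. ?c - net_input J r s \<omega>) ` {0..t})"
      by (simp add: net_input_def algebra_simps)
    have "- net_input J r s \<omega> \<le> ?L - ?c" if "s \<in> {0..t}" for s
      using cSUP_upper[OF that b'] by linarith
    then have "?R \<le> ?L - ?c" using t by (intro cSUP_least) auto
    then show "?c + ?R \<le> ?L" by simp
  qed
  also have "(SUP s\<in>{0..t}. - net_input J r s \<omega>) = - (INF s\<in>{0..t}. net_input J r s \<omega>)"
    by (simp add: Inf_real_def image_image)
  finally show ?thesis by (simp add: regulator_def)
qed

section \<open>Maxima of partial sums of the increments\<close>

text \<open>The list of steps \<open>w\<close> is an explicit argument, so that the same functional can be applied to the increments of a
  path in their order, in reversed order and from a later time on.\<close>

definition walk_max :: "real \<Rightarrow> nat \<Rightarrow> (nat \<Rightarrow> real) \<Rightarrow> real" where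
  "walk_max r N w = Max ((\<lambda>k. (\<Sum>i<k. w i) - r * real k) ` {..N})"

definition increment :: "(real \<Rightarrow> 'a \<Rightarrow> real) \<Rightarrow> real \<Rightarrow> nat \<Rightarrow> 'a \<Rightarrow> real" where
  "increment J \<delta> i \<omega> = J (real (Suc i) * \<delta>) \<omega> - J (real i * \<delta>) \<omega>"

lemma walk_max_cong: "(\<And>i. i < N \<Longrightarrow> v i = w i) \<Longrightarrow> walk_max r N v = walk_max r N w"
  unfolding walk_max_def
  by (intro arg_cong[where f=Max] image_cong refl arg_cong2[where f="(-)"] sum.cong) auto

lemma walk_max_ge: "k \<le> N \<Longrightarrow> (\<Sum>i<k. w i) - r * real k \<le> walk_max r N w"
  unfolding walk_max_def by (intro Max_ge) auto

lemma walk_max_le: "(\<And>k. k \<le> N \<Longrightarrow> (\<Sum>i<k. w i) - r * real k \<le> B) \<Longrightarrow> walk_max r N w \<le> B"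
  unfolding walk_max_def by (subst Max_le_iff) auto

lemma walk_max_nonneg: "0 \<le> walk_max r N w"
  using walk_max_ge[of 0 N w r] by simp

lemma walk_max_eq_path_max:
  assumes "Y 0 = 0" and "\<And>k. k \<le> N \<Longrightarrow> x (real k * \<delta>) = Y (real k * \<delta>) - r * (real k * \<delta>)"
  shows "path_max x \<delta> N = walk_max (r * \<delta>) N (\<lambda>i. Y (real (Suc i) * \<delta>) - Y (real i * \<delta>))"
  unfolding path_max_def walk_max_def
proof (intro arg_cong[where f=Max] image_cong refl)
  fix k assume "k \<in> {..N}"
  then show "x (real k * \<delta>) = (\<Sum>i<k. Y (real (Suc i) * \<delta>) - Y (real i * \<delta>)) - r * \<delta> * real k"
    using assms sum_lessThan_telescope[of "\<lambda>i. Y (real i * \<delta>)" k] by (simp add: algebra_simps)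
qed

lemma measurable_walk_max [measurable]:
  "walk_max r N \<in> borel_measurable (Pi\<^sub>M {..<N} (\<lambda>_. borel))"
proof -
  have "(\<lambda>w. (\<Sum>i<k. w i) - r * real k) \<in> borel_measurable (Pi\<^sub>M {..<N} (\<lambda>_. borel))" if "k \<le> N" for k
    using that by (intro borel_measurable_diff borel_measurable_sum borel_measurable_const measurable_component_singleton) auto
  then show ?thesis
    unfolding walk_max_def by (intro borel_measurable_Max) auto
qed

text \<open>Reading the grid backwards turns the largest increment up to the final time into a maximum of partial sums of the
  reversed step sequence.\<close>

lemma path_max_reverse:
  assumes "Y 0 = 0"
  shows "path_max (\<lambda>s. (Y (real N * \<delta>) - r * (real N * \<delta>)) - (Y s - r * s)) \<delta> N
     = walk_max (r * \<delta>) N (\<lambda>i. Y (real (Suc (N - Suc i)) * \<delta>) - Y (real (N - Suc i) * \<delta>))"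
proof -
  have step: "(\<Sum>i<k. Y (real (Suc (N - Suc i)) * \<delta>) - Y (real (N - Suc i) * \<delta>))
      = Y (real N * \<delta>) - Y (real (N - k) * \<delta>)" if "k \<le> N" for k
    using that by (induction k) (auto simp: Suc_diff_Suc)
  have "(\<lambda>k. (Y (real N * \<delta>) - r * (real N * \<delta>)) - (Y (real k * \<delta>) - r * (real k * \<delta>))) ` {..N}
      = (\<lambda>k. (Y (real N * \<delta>) - r * (real N * \<delta>)) - (Y (real (N - k) * \<delta>) - r * (real (N - k) * \<delta>))) ` {..N}"
    (is "?f ` _ = ?g ` _")
  proof -
    have "k \<in> (\<lambda>k. N - k) ` {..N}" if "k \<le> N" for k
      using that by (intro image_eqI[of _ _ "N - k"]) auto
    then have "{..N} = (\<lambda>k. N - k) ` {..N}" by auto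
    then have "?f ` {..N} = ?f ` ((\<lambda>k. N - k) ` {..N})" by simp
    then show ?thesis by (simp add: image_image)
  qed
  also have "\<dots> = (\<lambda>k. (\<Sum>i<k. Y (real (Suc (N - Suc i)) * \<delta>) - Y (real (N - Suc i) * \<delta>)) - r * \<delta> * real k) ` {..N}"
  proof (intro image_cong refl)
    fix k assume "k \<in> {..N}"
    then have k: "k \<le> N" by simp
    have "r * (real (N - k) * \<delta>) = r * (real N * \<delta>) - r * \<delta> * real k"
      using k by (simp add: of_nat_diff algebra_simps)
    then show "?g k = (\<Sum>i<k. Y (real (Suc (N - Suc i)) * \<delta>) - Y (real (N - Suc i) * \<delta>)) - r * \<delta> * real k"
      unfolding step[OF k] by linarith
  qed
  finally show ?thesis unfolding path_max_def walk_max_def by simp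
qed

lemma
  assumes "levy_process M J"
  shows levy_prob: "prob_space M"
    and levy_meas: "0 \<le> t \<Longrightarrow> J t \<in> borel_measurable M"
    and levy_0: "\<omega> \<in> space M \<Longrightarrow> J 0 \<omega> = 0"
    and levy_cadlag: "\<omega> \<in> space M \<Longrightarrow> cadlag_path (\<lambda>t. J t \<omega>)"
    and levy_stat: "0 \<le> s \<Longrightarrow> 0 \<le> t \<Longrightarrow> distr M borel (\<lambda>\<omega>. J (s + t) \<omega> - J s \<omega>) = distr M borel (J t)"
  using assms unfolding levy_process_def by blast+

lemma increment_meas:
  assumes "levy_process M J" "0 \<le> \<delta>"
  shows "increment J \<delta> i \<in> borel_measurable M"
proof -
  have [measurable]: "J (real (Suc i) * \<delta>) \<in> borel_measurable M" "J (real i * \<delta>) \<in> borel_measurable M"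
    using assms by (auto intro!: levy_meas)
  show ?thesis unfolding increment_def[abs_def] by measurable
qed

lemma increment_distr:
  assumes "levy_process M J" "0 \<le> \<delta>"
  shows "distr M borel (increment J \<delta> i) = distr M borel (J \<delta>)"
  using levy_stat[OF assms(1), of "real i * \<delta>" \<delta>] assms(2)
  by (simp add: increment_def[abs_def] algebra_simps)

lemma increment_indep:
  assumes "levy_process M J" "0 \<le> \<delta>"
  shows "prob_space.indep_vars M (\<lambda>_. borel) (increment J \<delta>) {..<n}"
proof -
  have "\<forall>(n::nat) (t :: nat \<Rightarrow> real). 0 \<le> t 0 \<and> (\<forall>i<n. t i \<le> t (Suc i)) \<longrightarrow>
        prob_space.indep_vars M (\<lambda>_. borel) (\<lambda>i \<omega>. J (t (Suc i)) \<omega> - J (t i) \<omega>) {..<n}"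
    using assms(1) unfolding levy_process_def by blast
  from this[rule_format, of "\<lambda>i. real i * \<delta>" n]
  show ?thesis using assms(2) by (simp add: increment_def[abs_def] mult_right_mono)
qed

text \<open>Increments over grid cells are independent and identically distributed; hence selecting distinct cells in any
  order yields the same product law. Reversal and shift of time are the two selections used below.\<close>

lemma increment_vector_distr:
  fixes p :: "nat \<Rightarrow> nat"
  assumes L: "levy_process M J" "0 \<le> \<delta>" and inj: "inj_on p {..<n}" and n: "0 < n"
  shows "distr M (Pi\<^sub>M {..<n} (\<lambda>_. borel)) (\<lambda>\<omega>. \<lambda>i\<in>{..<n}. increment J \<delta> (p i) \<omega>)
       = Pi\<^sub>M {..<n} (\<lambda>_. distr M borel (J \<delta>))"
proof -
  interpret prob_space M by (rule levy_prob[OF L(1)])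
  define m where "m = Suc (Max (p ` {..<n}))"
  have sub: "p ` {..<n} \<subseteq> {..<m}" unfolding m_def by (auto simp: less_Suc_eq_le)
  have ind: "indep_vars (\<lambda>_. borel) (increment J \<delta>) {..<m}" by (rule increment_indep[OF L])
  have "indep_vars (\<lambda>j. Pi\<^sub>M {p j} (\<lambda>_. borel)) (\<lambda>j \<omega>. restrict (\<lambda>i. increment J \<delta> i \<omega>) {p j}) {..<n}"
    using sub inj by (intro indep_vars_restrict[OF ind]) (auto simp: disjoint_family_on_def inj_on_def)
  then have "indep_vars (\<lambda>_. borel) (\<lambda>j \<omega>. (restrict (\<lambda>i. increment J \<delta> i \<omega>) {p j}) (p j)) {..<n}"
    by (rule indep_vars_compose2) (rule measurable_component_singleton, simp)
  then have "indep_vars (\<lambda>_. borel) (\<lambda>j. increment J \<delta> (p j)) {..<n}" by simp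
  then have "distr M (Pi\<^sub>M {..<n} (\<lambda>_. borel)) (\<lambda>\<omega>. \<lambda>i\<in>{..<n}. increment J \<delta> (p i) \<omega>)
       = (\<Pi>\<^sub>M i\<in>{..<n}. distr M borel (increment J \<delta> (p i)))"
    using n increment_meas[OF L]
    by (subst (asm) indep_vars_iff_distr_eq_PiM') (auto simp: lessThan_empty_iff)
  then show ?thesis by (simp add: increment_distr[OF L])
qed

lemma increment_functional_integral:
  fixes p :: "nat \<Rightarrow> nat"
  assumes L: "levy_process M J" "0 \<le> \<delta>" and inj: "inj_on p {..<n}"
    and H: "H \<in> borel_measurable (Pi\<^sub>M {..<n} (\<lambda>_. borel))"
  shows "(\<integral>\<omega>. H (\<lambda>i\<in>{..<n}. increment J \<delta> (p i) \<omega>) \<partial>M)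
       = (\<integral>\<omega>. (H (\<lambda>i\<in>{..<n}. increment J \<delta> i \<omega>)::real) \<partial>M)"
proof (cases "n = 0")
  case False
  have m: "(\<lambda>\<omega>. \<lambda>i\<in>{..<n}. increment J \<delta> (q i) \<omega>) \<in> M \<rightarrow>\<^sub>M Pi\<^sub>M {..<n} (\<lambda>_. borel)" for q
    by (intro measurable_restrict increment_meas[OF L])
  have "(\<integral>\<omega>. H (\<lambda>i\<in>{..<n}. increment J \<delta> (q i) \<omega>) \<partial>M)
      = integral\<^sup>L (Pi\<^sub>M {..<n} (\<lambda>_. distr M borel (J \<delta>))) H" if "inj_on q {..<n}" for q
    using integral_distr[OF m[of q] H] False by (simp add: increment_vector_distr[OF L that])
  from this[OF inj] this[of "\<lambda>i. i"] show ?thesis by simp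
qed (simp add: restrict_def)

text \<open>The first block carries the path up to some time and the second block the path after it.\<close>

lemma increment_blocks_indep:
  assumes L: "levy_process M J" "0 \<le> \<delta>"
    and F: "F \<in> borel_measurable (Pi\<^sub>M {..<a} (\<lambda>_. borel))"
    and H: "H \<in> borel_measurable (Pi\<^sub>M {..<n} (\<lambda>_. borel))"
  shows "prob_space.indep_var M borel (\<lambda>\<omega>. F (\<lambda>i\<in>{..<a}. increment J \<delta> i \<omega>))
                         borel (\<lambda>\<omega>. H (\<lambda>i\<in>{..<n}. increment J \<delta> (a + i) \<omega>))"
proof -
  interpret prob_space M by (rule levy_prob[OF L(1)])
  have ind: "indep_vars (\<lambda>_. borel) (increment J \<delta>) {..<a + n}" by (rule increment_indep[OF L])
  have iv: "indep_var (Pi\<^sub>M {..<a} (\<lambda>_. borel)) (\<lambda>\<omega>. restrict (\<lambda>i. increment J \<delta> i \<omega>) {..<a})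
      (Pi\<^sub>M {a..<a+n} (\<lambda>_. borel)) (\<lambda>\<omega>. restrict (\<lambda>i. increment J \<delta> i \<omega>) {a..<a+n})"
    by (rule indep_var_restrict[OF ind]) auto
  have sh: "(\<lambda>w. \<lambda>i\<in>{..<n}. w (a + i)) \<in> Pi\<^sub>M {a..<a+n} (\<lambda>_. borel) \<rightarrow>\<^sub>M Pi\<^sub>M {..<n} (\<lambda>_. borel :: real measure)"
    by (intro measurable_restrict measurable_component_singleton) auto
  from indep_var_compose[OF iv F measurable_comp[OF sh H]]
  have "indep_var borel (F \<circ> (\<lambda>\<omega>. restrict (\<lambda>i. increment J \<delta> i \<omega>) {..<a}))
      borel ((H \<circ> (\<lambda>w. \<lambda>i\<in>{..<n}. w (a + i))) \<circ> (\<lambda>\<omega>. restrict (\<lambda>i. increment J \<delta> i \<omega>) {a..<a+n}))" .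
  moreover have "(\<lambda>i\<in>{..<n}. (restrict (\<lambda>i. increment J \<delta> i \<omega>) {a..<a+n}) (a + i))
       = (\<lambda>i\<in>{..<n}. increment J \<delta> (a + i) \<omega>)" for \<omega>
    by (auto simp: restrict_def fun_eq_iff)
  ultimately show ?thesis by (simp add: comp_def)
qed

lemma sum_increment:
  assumes "levy_process M J" "\<omega> \<in> space M"
  shows "(\<Sum>i<k. increment J \<delta> i \<omega>) = J (real k * \<delta>) \<omega>"
  using sum_lessThan_telescope[of "\<lambda>i. J (real i * \<delta>) \<omega>" k] levy_0[OF assms]
  by (simp add: increment_def)

lemma net_input_path_max:
  assumes L: "levy_process M J" and w: "\<omega> \<in> space M"
  shows "path_max (\<lambda>s. net_input J r s \<omega>) \<delta> N = walk_max (r * \<delta>) N (\<lambda>i\<in>{..<N}. increment J \<delta> i \<omega>)"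
proof -
  have "path_max (\<lambda>s. net_input J r s \<omega>) \<delta> N
      = walk_max (r * \<delta>) N (\<lambda>i. J (real (Suc i) * \<delta>) \<omega> - J (real i * \<delta>) \<omega>)"
    using walk_max_eq_path_max[of "\<lambda>s. J s \<omega>" N "\<lambda>s. net_input J r s \<omega>" \<delta> r] levy_0[OF L w]
    by (simp add: net_input_def)
  also have "\<dots> = walk_max (r * \<delta>) N (\<lambda>i\<in>{..<N}. increment J \<delta> i \<omega>)"
    by (rule walk_max_cong) (simp add: increment_def)
  finally show ?thesis .
qed

lemma net_input_path_max_reverse:
  assumes L: "levy_process M J" and w: "\<omega> \<in> space M" and t: "t = real N * \<delta>"
  shows "path_max (\<lambda>s. net_input J r t \<omega> - net_input J r s \<omega>) \<delta> N
       = walk_max (r * \<delta>) N (\<lambda>i\<in>{..<N}. increment J \<delta> (N - Suc i) \<omega>)"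
proof -
  have "path_max (\<lambda>s. net_input J r t \<omega> - net_input J r s \<omega>) \<delta> N
     = walk_max (r * \<delta>) N (\<lambda>i. J (real (Suc (N - Suc i)) * \<delta>) \<omega> - J (real (N - Suc i) * \<delta>) \<omega>)"
    using path_max_reverse[of "\<lambda>s. J s \<omega>" N \<delta> r] levy_0[OF L w] unfolding t by (simp add: net_input_def)
  also have "\<dots> = walk_max (r * \<delta>) N (\<lambda>i\<in>{..<N}. increment J \<delta> (N - Suc i) \<omega>)"
    by (rule walk_max_cong) (simp add: increment_def)
  finally show ?thesis .
qed

lemma increment_vector_meas:
  fixes p :: "nat \<Rightarrow> nat"
  assumes "levy_process M J" "0 \<le> \<delta>"
  shows "(\<lambda>\<omega>. \<lambda>i\<in>{..<N}. increment J \<delta> (p i) \<omega>) \<in> M \<rightarrow>\<^sub>M Pi\<^sub>M {..<N} (\<lambda>_. borel)"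
  by (intro measurable_restrict increment_meas[OF assms])

lemma walk_max_increment_meas:
  fixes p :: "nat \<Rightarrow> nat"
  assumes "levy_process M J" "0 \<le> \<delta>"
  shows "(\<lambda>\<omega>. walk_max r N (\<lambda>i\<in>{..<N}. increment J \<delta> (p i) \<omega>)) \<in> borel_measurable M"
  by (rule measurable_compose[OF increment_vector_meas[OF assms] measurable_walk_max])

lemma cadlag_net_input:
  assumes "levy_process M J" "\<omega> \<in> space M"
  shows "cadlag_path (\<lambda>s. net_input J r s \<omega>)" "cadlag_path (\<lambda>s. net_input J r t \<omega> - net_input J r s \<omega>)"
  using cadlag_affine[OF levy_cadlag[OF assms], of 1 "-r" 0]
    cadlag_affine[OF levy_cadlag[OF assms], of "-1" r "net_input J r t \<omega>"]
  by (simp_all add: net_input_def algebra_simps)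

lemma SUP_net_input_limit:
  assumes "levy_process M J" "\<omega> \<in> space M" "0 < t"
  shows "(\<lambda>n. walk_max (r * (t/2^n)) (2^n) (\<lambda>i\<in>{..<2^n}. increment J (t/2^n) i \<omega>))
           \<longlonglongrightarrow> (SUP s\<in>{0..t}. net_input J r s \<omega>)"
  using path_max_tendsto_SUP[OF cadlag_net_input(1)[OF assms(1,2)] assms(3)]
  by (simp add: net_input_path_max[OF assms(1,2)])

lemma workload_limit:
  assumes "levy_process M J" "\<omega> \<in> space M" "0 < t"
  shows "(\<lambda>n. walk_max (r * (t/2^n)) (2^n) (\<lambda>i\<in>{..<2^n}. increment J (t/2^n) (2^n - Suc i) \<omega>))
           \<longlonglongrightarrow> net_input J r t \<omega> + regulator J r t \<omega>"
proof -
  have "path_max (\<lambda>s. net_input J r t \<omega> - net_input J r s \<omega>) (t/2^n) (2^n)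
      = walk_max (r * (t/2^n)) (2^n) (\<lambda>i\<in>{..<2^n}. increment J (t/2^n) (2^n - Suc i) \<omega>)" for n
    by (rule net_input_path_max_reverse[OF assms(1,2)]) simp
  then show ?thesis
    using path_max_tendsto_SUP[OF cadlag_net_input(2)[OF assms(1,2), of r t] assms(3)]
      upstream_eq_SUP[where J=J and \<omega>=\<omega> and r=r, OF levy_cadlag[OF assms(1,2)], of t] assms(3) by simp
qed

lemma SUP_net_input_meas:
  assumes "levy_process M J" "0 < t"
  shows "(\<lambda>\<omega>. SUP s\<in>{0..t}. net_input J r s \<omega>) \<in> borel_measurable M"
  using assms by (intro borel_measurable_LIMSEQ_real[OF SUP_net_input_limit] walk_max_increment_meas) auto

lemma workload_meas:
  assumes "levy_process M J" "0 < t"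
  shows "(\<lambda>\<omega>. net_input J r t \<omega> + regulator J r t \<omega>) \<in> borel_measurable M"
  using assms by (intro borel_measurable_LIMSEQ_real[OF workload_limit] walk_max_increment_meas[where p = "\<lambda>i. 2^_ - Suc i"]) auto

lemma upstream_downstream_meas:
  assumes "levy_process M J" "0 < t"
  shows "(\<lambda>\<omega>. (upstream J r1 t \<omega>, downstream J r1 r2 t \<omega>)) \<in> borel_measurable M"
proof -
  have [measurable]: "(\<lambda>\<omega>. upstream J r1 t \<omega>) \<in> borel_measurable M"
    using workload_meas[OF assms] by (simp add: upstream_def)
  have [measurable]: "(\<lambda>\<omega>. net_input J r2 t \<omega> + regulator J r2 t \<omega>) \<in> borel_measurable M"
    by (rule workload_meas[OF assms])
  show ?thesis unfolding downstream_def by measurable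
qed

section \<open>Time reversal of the workloads\<close>

abbreviation grid_walk :: "(real \<Rightarrow> 'a \<Rightarrow> real) \<Rightarrow> real \<Rightarrow> real \<Rightarrow> (nat \<Rightarrow> nat) \<Rightarrow> nat \<Rightarrow> 'a \<Rightarrow> real" where
  "grid_walk J t r p n \<omega> \<equiv> walk_max (r * (t/2^n)) (2^n) (\<lambda>i\<in>{..<2^n}. increment J (t/2^n) (p i) \<omega>)"

text \<open>For a bounded continuous observable the passage from the grids to continuous time is dominated convergence; the map \<open>p n\<close>
  records in which order the increments are read.\<close>

lemma bounded_continuous_walk_limit:
  fixes f :: "real \<times> real \<Rightarrow> real" and p :: "nat \<Rightarrow> nat \<Rightarrow> nat"
  assumes L: "levy_process M J" and t: "0 < t"
    and f: "continuous_on UNIV f" "bounded (range f)"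
    and [measurable]: "A1 \<in> borel_measurable M" "A2 \<in> borel_measurable M"
    and lim1: "\<And>\<omega>. \<omega> \<in> space M \<Longrightarrow> (\<lambda>n. grid_walk J t r1 (p n) n \<omega>) \<longlonglongrightarrow> A1 \<omega>"
    and lim2: "\<And>\<omega>. \<omega> \<in> space M \<Longrightarrow> (\<lambda>n. grid_walk J t r2 (p n) n \<omega>) \<longlonglongrightarrow> A2 \<omega>"
  shows "(\<lambda>n. \<integral>\<omega>. f (grid_walk J t r1 (p n) n \<omega>,
                      grid_walk J t r2 (p n) n \<omega>) \<partial>M)
      \<longlonglongrightarrow> (\<integral>\<omega>. f (A1 \<omega>, A2 \<omega>) \<partial>M)"
proof -
  interpret prob_space M by (rule levy_prob[OF L])
  obtain B where B: "\<And>x. \<bar>f x\<bar> \<le> B" using f(2) by (auto simp: bounded_iff)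
  have fm[measurable]: "f \<in> borel_measurable borel" by (rule borel_measurable_continuous_onI[OF f(1)])
  have [measurable]: "(\<lambda>\<omega>. walk_max r (2^n) (\<lambda>i\<in>{..<2^n}. increment J (t/2^n) (p n i) \<omega>)) \<in> borel_measurable M" for r n
    using t by (intro walk_max_increment_meas[OF L]) simp
  show ?thesis
  proof (rule integral_dominated_convergence[where w="\<lambda>_. B"])
    show "AE \<omega> in M. (\<lambda>n. f (grid_walk J t r1 (p n) n \<omega>,
                      grid_walk J t r2 (p n) n \<omega>))
        \<longlonglongrightarrow> f (A1 \<omega>, A2 \<omega>)"
      using lim1 lim2 by (intro AE_I2 continuous_on_tendsto_compose[OF f(1)] tendsto_Pair) auto
  qed (use B in auto)
qed

text \<open>On every grid both workloads are one and the same functional of the reversed sequence of increments, whose joint law is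
  that of the original sequence. So the pair of workloads at time \<open>t\<close> is distributed like a pair of running suprema, and these,
  unlike the workloads, converge pathwise as \<open>t\<close> grows.\<close>

lemma workload_reversal:
  fixes f :: "real \<times> real \<Rightarrow> real"
  assumes L: "levy_process M J" and t: "0 < t"
    and f: "continuous_on UNIV f" "bounded (range f)"
  shows "(\<integral>\<omega>. f (upstream J r1 t \<omega>, downstream J r1 r2 t \<omega>) \<partial>M)
       = (\<integral>\<omega>. f (SUP s\<in>{0..t}. net_input J r1 s \<omega>,
                  (SUP s\<in>{0..t}. net_input J r2 s \<omega>) - (SUP s\<in>{0..t}. net_input J r1 s \<omega>)) \<partial>M)"
proof -
  interpret prob_space M by (rule levy_prob[OF L])
  \<comment> \<open>the total content, unlike the downstream one, is a supremum of increments\<close>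
  define g where "g = (\<lambda>(a, b). f (a, b - a))"
  have g: "continuous_on UNIV g" "bounded (range g)"
  proof -
    have "continuous_on UNIV (f \<circ> (\<lambda>p::real\<times>real. (fst p, snd p - fst p)))"
      by (intro continuous_on_compose continuous_intros continuous_on_subset[OF f(1)]) auto
    then show "continuous_on UNIV g" by (simp add: g_def comp_def case_prod_unfold)
    show "bounded (range g)" using f(2) by (rule bounded_subset) (auto simp: g_def)
  qed
  define V where "V p n r \<omega> = walk_max (r * (t/2^n)) (2^n) (\<lambda>i\<in>{..<2^n}. increment J (t/2^n) (p i) \<omega>)"
    for p :: "nat \<Rightarrow> nat" and n r \<omega>
  have A: "(\<lambda>n. \<integral>\<omega>. g (V (\<lambda>i. 2^n - Suc i) n r1 \<omega>, V (\<lambda>i. 2^n - Suc i) n r2 \<omega>) \<partial>M)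
    \<longlonglongrightarrow> (\<integral>\<omega>. g (net_input J r1 t \<omega> + regulator J r1 t \<omega>, net_input J r2 t \<omega> + regulator J r2 t \<omega>) \<partial>M)"
    unfolding V_def
    by (rule bounded_continuous_walk_limit[OF L t g workload_meas[OF L t] workload_meas[OF L t]])
       (rule workload_limit[OF L _ t], simp)+
  have B: "(\<lambda>n. \<integral>\<omega>. g (V (\<lambda>i. i) n r1 \<omega>, V (\<lambda>i. i) n r2 \<omega>) \<partial>M)
    \<longlonglongrightarrow> (\<integral>\<omega>. g (SUP s\<in>{0..t}. net_input J r1 s \<omega>, SUP s\<in>{0..t}. net_input J r2 s \<omega>) \<partial>M)"
    unfolding V_def
    by (rule bounded_continuous_walk_limit[OF L t g SUP_net_input_meas[OF L t] SUP_net_input_meas[OF L t]])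
       (rule SUP_net_input_limit[OF L _ t], simp)+
  have [measurable]: "g \<in> borel_measurable borel" by (rule borel_measurable_continuous_onI[OF g(1)])
  have "(\<integral>\<omega>. g (V (\<lambda>i. 2^n - Suc i) n r1 \<omega>, V (\<lambda>i. 2^n - Suc i) n r2 \<omega>) \<partial>M)
      = (\<integral>\<omega>. g (V (\<lambda>i. i) n r1 \<omega>, V (\<lambda>i. i) n r2 \<omega>) \<partial>M)" for n
    unfolding V_def
  proof (rule increment_functional_integral[OF L, where H="\<lambda>w. g (walk_max (r1 * (t/2^n)) (2^n) w, walk_max (r2 * (t/2^n)) (2^n) w)"])
    show "0 \<le> t / 2^n" using t by simp
    show "inj_on (\<lambda>i. 2^n - Suc i) {..<2^n::nat}" by (rule inj_onI) auto
    show "(\<lambda>w. g (walk_max (r1 * (t/2^n)) (2^n) w, walk_max (r2 * (t/2^n)) (2^n) w))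
        \<in> borel_measurable (Pi\<^sub>M {..<2^n} (\<lambda>_. borel))" by measurable
  qed
  with A B have "(\<integral>\<omega>. g (net_input J r1 t \<omega> + regulator J r1 t \<omega>, net_input J r2 t \<omega> + regulator J r2 t \<omega>) \<partial>M)
     = (\<integral>\<omega>. g (SUP s\<in>{0..t}. net_input J r1 s \<omega>, SUP s\<in>{0..t}. net_input J r2 s \<omega>) \<partial>M)"
    using LIMSEQ_unique by simp
  then show ?thesis by (simp add: g_def upstream_def downstream_def)
qed

section \<open>The supremum over all times\<close>

text \<open>Mesh and horizon are refined at the same time, which makes the sequence increasing.\<close>

definition dyadic_max :: "(real \<Rightarrow> real) \<Rightarrow> nat \<Rightarrow> real" where
  "dyadic_max x n = path_max x (1 / 2^n) (n * 2^n)"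

text \<open>The detour through \<open>ennreal\<close> makes this a measurable functional also on the null set of paths that are unbounded
  above, where it takes the value 0.\<close>

definition all_time_sup :: "(real \<Rightarrow> real) \<Rightarrow> real" where
  "all_time_sup x = enn2real (SUP n. ennreal (dyadic_max x n))"

lemma path_max_refine:
  assumes "m \<le> n" "N * 2^(n - m) \<le> N'"
  shows "path_max x (1 / 2^m) N \<le> path_max x (1 / 2^n) N'"
proof (rule path_max_le)
  fix k assume "k \<le> N"
  then have k: "k * 2^(n-m) \<le> N'" using assms(2) by (meson le_trans mult_le_mono1)
  have "real k * (1 / 2^m) = real (k * 2^(n-m)) * (1 / 2^n)"
    using assms(1) by (simp add: field_simps flip: power_add)
  then show "x (real k * (1 / 2^m)) \<le> path_max x (1 / 2^n) N'" using path_max_ge[OF k, of x "1/2^n"] by simp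
qed

lemma dyadic_max_incseq: "incseq (dyadic_max x)"
proof (rule incseq_SucI)
  fix n show "dyadic_max x n \<le> dyadic_max x (Suc n)"
    unfolding dyadic_max_def by (rule path_max_refine) auto
qed

lemma all_time_sup_tendsto:
  assumes "x 0 = 0" "bdd_above (range (dyadic_max x))"
  shows "dyadic_max x \<longlonglongrightarrow> all_time_sup x"
proof -
  have nn: "0 \<le> dyadic_max x n" for n unfolding dyadic_max_def by (rule path_max_nonneg[of x]) fact
  obtain l where l: "dyadic_max x \<longlonglongrightarrow> l"
    using LIMSEQ_incseq_SUP[OF assms(2) dyadic_max_incseq] by blast
  have "0 \<le> l" by (rule LIMSEQ_le_const[OF l]) (use nn in auto)
  have "(\<lambda>n. ennreal (dyadic_max x n)) \<longlonglongrightarrow> ennreal l" using l by (rule tendsto_ennrealI)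
  moreover have "incseq (\<lambda>n. ennreal (dyadic_max x n))"
    using dyadic_max_incseq[of x] by (auto simp: incseq_def intro: ennreal_leI)
  ultimately have "(SUP n. ennreal (dyadic_max x n)) = ennreal l"
    using LIMSEQ_SUP LIMSEQ_unique by blast
  then show ?thesis using l \<open>0 \<le> l\<close> by (simp add: all_time_sup_def)
qed

lemma dyadic_max_le_all_time_sup:
  assumes "x 0 = 0" "bdd_above (range (dyadic_max x))"
  shows "dyadic_max x n \<le> all_time_sup x"
  using incseq_le[OF dyadic_max_incseq all_time_sup_tendsto[OF assms]] .

lemma all_time_sup_upper:
  assumes "x 0 = 0" "bdd_above (range (dyadic_max x))" "cadlag_path x" "0 \<le> s"
  shows "x s \<le> all_time_sup x"
proof (rule ccontr)
  assume "\<not> ?thesis"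
  then have "all_time_sup x < x s" by simp
  moreover have "(x \<longlongrightarrow> x s) (at_right s)" using assms by (auto simp: cadlag_path_def)
  ultimately have "\<forall>\<^sub>F n in sequentially. \<exists>k::nat. s < real k * (1 / 2^n) \<and> real k * (1 / 2^n) \<le> s + 1 / 2^n
           \<and> all_time_sup x < x (real k * (1 / 2^n))" using \<open>0 \<le> s\<close> by (intro right_cont_grid) auto
  moreover have "\<forall>\<^sub>F n in sequentially. s + 1 \<le> real n"
    by (metis (no_types) eventually_sequentially nat_ceiling_le_eq)
  ultimately have "\<forall>\<^sub>F n in sequentially. False"
  proof eventually_elim
    case (elim n)
    then obtain k :: nat where k: "real k * (1 / 2^n) \<le> s + 1 / 2^n" "all_time_sup x < x (real k * (1 / 2^n))" by blast
    have "1 / 2^n \<le> (1::real)" by simp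
    then have "real k * (1 / 2^n) \<le> real n" using k(1) elim(2) by linarith
    then have "real k \<le> real (n * 2^n)" by (simp add: field_simps)
    then have "k \<le> n * 2^n" by (simp only: of_nat_le_iff)
    then have "x (real k * (1 / 2^n)) \<le> dyadic_max x n" unfolding dyadic_max_def by (rule path_max_ge)
    then show False using dyadic_max_le_all_time_sup[OF assms(1,2), of n] k(2) by linarith
  qed
  then show False by simp
qed

lemma SUP_tendsto_all_time_sup:
  assumes "x 0 = 0" "bdd_above (range (dyadic_max x))" "cadlag_path x"
  shows "((\<lambda>t. SUP s\<in>{0..t}. x s) \<longlongrightarrow> all_time_sup x) at_top"
proof (rule order_tendstoI)
  fix a assume "a < all_time_sup x"
  then obtain n where n: "a < dyadic_max x n"
    using order_tendstoD(1)[OF all_time_sup_tendsto[OF assms(1,2)]] by (auto simp: eventually_sequentially)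
  show "\<forall>\<^sub>F t in at_top. a < (SUP s\<in>{0..t}. x s)"
    using eventually_ge_at_top[of "real n"]
  proof eventually_elim
    case (elim t)
    have "dyadic_max x n \<le> (SUP s\<in>{0..t}. x s)"
      unfolding dyadic_max_def
    proof (intro path_max_le cSUP_upper cadlag_bdd_above[OF assms(3)])
      fix k assume "k \<le> n * 2^n"
      then have "real k \<le> real (n * 2^n)" by (simp only: of_nat_le_iff)
      then have "real k * (1 / 2^n) \<le> real n" by (simp add: field_simps)
      then show "real k * (1 / 2^n) \<in> {0..t}" using elim by auto
    qed
    then show ?case using n by simp
  qed
next
  fix a assume a: "all_time_sup x < a"
  show "\<forall>\<^sub>F t in at_top. (SUP s\<in>{0..t}. x s) < a"
  proof (rule eventually_mono[OF eventually_ge_at_top[of "0::real"]])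
    fix t :: real assume t: "0 \<le> t"
    have "(SUP s\<in>{0..t}. x s) \<le> all_time_sup x"
      using t all_time_sup_upper[OF assms] by (intro cSUP_least) auto
    then show "(SUP s\<in>{0..t}. x s) < a" using a by simp
  qed
qed

text \<open>The recursion for the supremum adds one unit of time to the horizon; the limit does not notice this, because the longer
  horizon is caught between two successive members of the increasing sequence.\<close>

lemma path_max_Suc_horizon_tendsto:
  assumes "x 0 = 0" "bdd_above (range (dyadic_max x))"
  shows "(\<lambda>n. path_max x (1 / 2^n) (Suc n * 2^n)) \<longlonglongrightarrow> all_time_sup x"
proof (rule tendsto_sandwich)
  show "\<forall>\<^sub>F n in sequentially. dyadic_max x n \<le> path_max x (1 / 2^n) (Suc n * 2^n)"
    unfolding dyadic_max_def by (intro always_eventually allI path_max_refine) auto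
  show "\<forall>\<^sub>F n in sequentially. path_max x (1 / 2^n) (Suc n * 2^n) \<le> dyadic_max x (Suc n)"
    unfolding dyadic_max_def by (intro always_eventually allI path_max_refine) auto
  show "dyadic_max x \<longlonglongrightarrow> all_time_sup x" by (rule all_time_sup_tendsto[OF assms])
  then show "(\<lambda>n. dyadic_max x (Suc n)) \<longlonglongrightarrow> all_time_sup x" by (rule LIMSEQ_Suc)
qed

section \<open>Second moments of maxima\<close>

context prob_space
begin

lemma integrable_mult_square:
  fixes X Y :: "'a \<Rightarrow> real"
  assumes [measurable]: "X \<in> borel_measurable M" "Y \<in> borel_measurable M"
    and "integrable M (\<lambda>\<omega>. (X \<omega>)\<^sup>2)" "integrable M (\<lambda>\<omega>. (Y \<omega>)\<^sup>2)"
  shows "integrable M (\<lambda>\<omega>. X \<omega> * Y \<omega>)"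
proof (rule Bochner_Integration.integrable_bound)
  show "integrable M (\<lambda>\<omega>. (X \<omega>)\<^sup>2 + (Y \<omega>)\<^sup>2)" using assms by simp
  have "\<bar>x * y\<bar> \<le> x\<^sup>2 + y\<^sup>2" for x y :: real
  proof -
    have "2 * \<bar>x\<bar> * \<bar>y\<bar> \<le> x\<^sup>2 + y\<^sup>2" using sum_squares_bound[of "\<bar>x\<bar>" "\<bar>y\<bar>"] by simp
    moreover have "0 \<le> \<bar>x\<bar> * \<bar>y\<bar>" by simp
    ultimately show ?thesis unfolding abs_mult by linarith
  qed
  then show "AE \<omega> in M. norm (X \<omega> * Y \<omega>) \<le> norm ((X \<omega>)\<^sup>2 + (Y \<omega>)\<^sup>2)" by simp
qed measurable

lemma integrable_square_add:
  fixes X Y :: "'a \<Rightarrow> real"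
  assumes "X \<in> borel_measurable M" "Y \<in> borel_measurable M"
    and "integrable M (\<lambda>\<omega>. (X \<omega>)\<^sup>2)" "integrable M (\<lambda>\<omega>. (Y \<omega>)\<^sup>2)"
  shows "integrable M (\<lambda>\<omega>. (X \<omega> + Y \<omega>)\<^sup>2)"
  using assms integrable_mult_square[OF assms] by (simp add: power2_sum mult.assoc)

lemma integrable_square_sum:
  fixes X :: "'i \<Rightarrow> 'a \<Rightarrow> real"
  assumes "\<And>i. i \<in> I \<Longrightarrow> X i \<in> borel_measurable M" "\<And>i. i \<in> I \<Longrightarrow> integrable M (\<lambda>\<omega>. (X i \<omega>)\<^sup>2)"
  shows "integrable M (\<lambda>\<omega>. (\<Sum>i\<in>I. X i \<omega>)\<^sup>2)"
  using assms
proof (induction I rule: infinite_finite_induct)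
  case (insert i I)
  then have "integrable M (\<lambda>\<omega>. (X i \<omega> + (\<Sum>i\<in>I. X i \<omega>))\<^sup>2)"
    by (intro integrable_square_add) auto
  then show ?case using insert by simp
qed simp_all

lemma monotone_limit_integrable:
  fixes f :: "nat \<Rightarrow> 'a \<Rightarrow> real"
  assumes int: "\<And>n. integrable M (f n)" and inc: "\<And>\<omega>. incseq (\<lambda>n. f n \<omega>)"
    and C: "\<And>n. expectation (f n) \<le> C"
    and lim: "AE \<omega> in M. (\<lambda>n. f n \<omega>) \<longlonglongrightarrow> g \<omega>" and g: "g \<in> borel_measurable M"
  shows "integrable M g" "(\<lambda>n. expectation (f n)) \<longlonglongrightarrow> expectation g"
proof -
  have bdd: "bdd_above (range (\<lambda>n. expectation (f n)))"
    by (rule bdd_aboveI[of _ C]) (use C in auto)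
  have "incseq (\<lambda>n. expectation (f n))"
    using inc int by (auto simp: incseq_def intro!: integral_mono)
  then obtain x where x: "(\<lambda>n. expectation (f n)) \<longlonglongrightarrow> x"
    using LIMSEQ_incseq_SUP[OF bdd] by blast
  have "AE \<omega> in M. mono (\<lambda>n. f n \<omega>)" using inc by simp
  note * = integrable_monotone_convergence[OF int this lim x g] integral_monotone_convergence[OF int this lim x g]
  show "integrable M g" "(\<lambda>n. expectation (f n)) \<longlonglongrightarrow> expectation g" using * x by simp_all
qed

text \<open>This replaces a law of large numbers: an increasing sequence of nonnegative functions with bounded expectations has a
  supremum with finite expectation, which is therefore finite almost everywhere.\<close>

lemma AE_bdd_above_of_expectation:
  fixes f :: "nat \<Rightarrow> 'a \<Rightarrow> real"
  assumes int: "\<And>n. integrable M (f n)" and inc: "\<And>\<omega>. incseq (\<lambda>n. f n \<omega>)"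
    and C: "\<And>n. expectation (f n) \<le> C" and nn: "\<And>n \<omega>. \<omega> \<in> space M \<Longrightarrow> 0 \<le> f n \<omega>"
  shows "AE \<omega> in M. bdd_above (range (\<lambda>n. f n \<omega>))"
proof -
  have [measurable]: "f n \<in> borel_measurable M" for n using int by auto
  have "(\<integral>\<^sup>+ \<omega>. (SUP n. ennreal (f n \<omega>)) \<partial>M) = (SUP n. \<integral>\<^sup>+ \<omega>. ennreal (f n \<omega>) \<partial>M)"
    using inc by (intro nn_integral_monotone_convergence_SUP) (auto simp: incseq_def le_fun_def intro!: ennreal_leI)
  also have "\<dots> \<le> ennreal C"
  proof (intro SUP_least)
    fix n show "(\<integral>\<^sup>+ \<omega>. ennreal (f n \<omega>) \<partial>M) \<le> ennreal C"
      using nn_integral_eq_integral[OF int[of n] AE_I2[OF nn]] C[of n] by (simp add: ennreal_leI)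
  qed
  finally have "(\<integral>\<^sup>+ \<omega>. (SUP n. ennreal (f n \<omega>)) \<partial>M) \<noteq> \<infinity>"
    using ennreal_less_top[of C] by (auto simp: top_unique)
  then have "AE \<omega> in M. (SUP n. ennreal (f n \<omega>)) \<noteq> \<infinity>"
    by (intro nn_integral_PInf_AE) auto
  then show ?thesis
    using AE_space
  proof eventually_elim
    case (elim \<omega>)
    have "ennreal (f n \<omega>) \<le> (SUP n. ennreal (f n \<omega>))" for n by (rule SUP_upper) simp
    then have "f n \<omega> \<le> enn2real (SUP n. ennreal (f n \<omega>))" for n
      using elim nn[of \<omega> n] by (metis enn2real_ennreal enn2real_mono infinity_ennreal_def top.not_eq_extremum)
    then show ?case by (intro bdd_aboveI) auto
  qed
qed

text \<open>By Fubini, \<open>X + y\<close> is square integrable for almost every value \<open>y\<close> of \<open>Y\<close>; one such \<open>y\<close> is enough.\<close>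

lemma indep_sum_square_integrable:
  fixes X Y :: "'a \<Rightarrow> real"
  assumes ind: "indep_var borel X borel Y" and int: "integrable M (\<lambda>\<omega>. (X \<omega> + Y \<omega>)\<^sup>2)"
  shows "integrable M (\<lambda>\<omega>. (X \<omega>)\<^sup>2)"
proof -
  have [measurable]: "X \<in> borel_measurable M" "Y \<in> borel_measurable M"
    using ind by (auto dest: indep_var_rv1 indep_var_rv2)
  interpret DX: prob_space "distr M borel X" by (rule prob_space_distr) simp
  interpret DY: prob_space "distr M borel Y" by (rule prob_space_distr) simp
  interpret P: pair_sigma_finite "distr M borel X" "distr M borel Y" ..
  have eq: "distr M borel X \<Otimes>\<^sub>M distr M borel Y = distr M (borel \<Otimes>\<^sub>M borel) (\<lambda>\<omega>. (X \<omega>, Y \<omega>))"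
    using ind unfolding indep_var_distribution_eq by simp
  have "integrable (distr M (borel \<Otimes>\<^sub>M borel) (\<lambda>\<omega>. (X \<omega>, Y \<omega>))) (\<lambda>(x, y). (x + y)\<^sup>2)"
    using int by (subst integrable_distr_eq) auto
  then have "integrable (distr M borel X \<Otimes>\<^sub>M distr M borel Y) (\<lambda>(x, y). (x + y)\<^sup>2)" by (simp add: eq)
  from P.AE_integrable_snd[OF this]
  have "AE y in distr M borel Y. integrable (distr M borel X) (\<lambda>x. (x + y)\<^sup>2)" .
  then obtain y where y: "integrable (distr M borel X) (\<lambda>x. (x + y)\<^sup>2)"
    using eventually_happens'[OF DY.ae_filter_bot] by blast
  have "integrable M (\<lambda>\<omega>. (X \<omega> + y)\<^sup>2)"
    using y by (subst (asm) integrable_distr_eq) auto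
  from integrable_square_add[OF _ _ this, of "\<lambda>_. - y"] show ?thesis by simp
qed

end

lemma walk_max_Suc:
  "walk_max r (Suc k) w = max (walk_max r k w) ((\<Sum>i<Suc k. w i) - r * real (Suc k))"
proof -
  have "walk_max r (Suc k) w = Max (insert ((\<Sum>i<Suc k. w i) - r * real (Suc k)) ((\<lambda>k. (\<Sum>i<k. w i) - r * real k) ` {..k}))"
    unfolding walk_max_def by (simp only: atMost_Suc image_insert)
  also have "\<dots> = max ((\<Sum>i<Suc k. w i) - r * real (Suc k)) (walk_max r k w)"
    unfolding walk_max_def by (rule Max_insert) auto
  finally show ?thesis by (simp only: max.commute)
qed

text \<open>A deterministic form of Doob's inequality. By induction: either the maximum does not change in a step, or the walk is
  itself the new maximum, and then the claim is \<open>(a - s)\<^sup>2 \<ge> 0\<close>.\<close>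

lemma doob_pathwise:
  "(\<Sum>i<k. walk_max 0 i w * w i) \<le> walk_max 0 k w * (\<Sum>i<k. w i) - (walk_max 0 k w)\<^sup>2 / 2"
proof (induction k)
  case 0
  show ?case by (simp add: walk_max_def)
next
  case (Suc k)
  define a s where "a = walk_max 0 k w" and "s = (\<Sum>i<Suc k. w i)"
  have "(\<Sum>i<Suc k. walk_max 0 i w * w i) \<le> a * s - a\<^sup>2 / 2"
    using Suc by (simp add: a_def s_def algebra_simps)
  also have "\<dots> \<le> max a s * s - (max a s)\<^sup>2 / 2"
    using zero_le_power2[of "a - s"] by (cases "s \<le> a") (auto simp: power2_eq_square algebra_simps)
  finally show ?case by (simp add: walk_max_Suc a_def s_def)
qed

lemma walk_max_abs_le: "\<bar>walk_max r N w\<bar> \<le> (\<Sum>i<N. \<bar>w i\<bar>) + \<bar>r\<bar> * real N"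
proof -
  have "(\<Sum>i<k. w i) - r * real k \<le> (\<Sum>i<N. \<bar>w i\<bar>) + \<bar>r\<bar> * real N" if "k \<le> N" for k
  proof -
    have "(\<Sum>i<k. w i) \<le> (\<Sum>i<k. \<bar>w i\<bar>)" by (intro sum_mono) auto
    also have "\<dots> \<le> (\<Sum>i<N. \<bar>w i\<bar>)" using that by (intro sum_mono2) auto
    finally have "(\<Sum>i<k. w i) \<le> (\<Sum>i<N. \<bar>w i\<bar>)" .
    moreover have "- (r * real k) \<le> \<bar>r\<bar> * real k" by (metis abs_ge_minus_self abs_mult abs_of_nat)
    moreover have "\<bar>r\<bar> * real k \<le> \<bar>r\<bar> * real N" using that by (intro mult_left_mono) auto
    ultimately show ?thesis by linarith
  qed
  then have "walk_max r N w \<le> (\<Sum>i<N. \<bar>w i\<bar>) + \<bar>r\<bar> * real N" by (rule walk_max_le)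
  then show ?thesis using walk_max_nonneg[of r N w] by simp
qed

context prob_space
begin

lemma walk_max_square_integrable:
  fixes X :: "nat \<Rightarrow> 'a \<Rightarrow> real"
  assumes "\<And>i. i < N \<Longrightarrow> X i \<in> borel_measurable M" "\<And>i. i < N \<Longrightarrow> integrable M (\<lambda>\<omega>. (X i \<omega>)\<^sup>2)"
  shows "(\<lambda>\<omega>. walk_max r N (\<lambda>i. X i \<omega>)) \<in> borel_measurable M"
    and "integrable M (\<lambda>\<omega>. (walk_max r N (\<lambda>i. X i \<omega>))\<^sup>2)"
proof -
  have "(\<lambda>\<omega>. walk_max r N (\<lambda>i\<in>{..<N}. X i \<omega>)) \<in> borel_measurable M"
    using assms by (intro measurable_compose[OF _ measurable_walk_max] measurable_restrict) auto
  moreover have "walk_max r N (\<lambda>i\<in>{..<N}. X i \<omega>) = walk_max r N (\<lambda>i. X i \<omega>)" for \<omega>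
    by (rule walk_max_cong) simp
  ultimately show meas[measurable]: "(\<lambda>\<omega>. walk_max r N (\<lambda>i. X i \<omega>)) \<in> borel_measurable M" by simp
  have "integrable M (\<lambda>\<omega>. ((\<Sum>i<N. \<bar>X i \<omega>\<bar>) + \<bar>r\<bar> * real N)\<^sup>2)"
    using assms by (intro integrable_square_add integrable_square_sum) auto
  then show "integrable M (\<lambda>\<omega>. (walk_max r N (\<lambda>i. X i \<omega>))\<^sup>2)"
  proof (rule Bochner_Integration.integrable_bound)
    show "AE \<omega> in M. norm ((walk_max r N (\<lambda>i. X i \<omega>))\<^sup>2) \<le> norm (((\<Sum>i<N. \<bar>X i \<omega>\<bar>) + \<bar>r\<bar> * real N)\<^sup>2)"
    proof (intro AE_I2)
      fix \<omega>
      have "\<bar>walk_max r N (\<lambda>i. X i \<omega>)\<bar>\<^sup>2 \<le> ((\<Sum>i<N. \<bar>X i \<omega>\<bar>) + \<bar>r\<bar> * real N)\<^sup>2"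
        by (intro power_mono walk_max_abs_le) simp
      then show "norm ((walk_max r N (\<lambda>i. X i \<omega>))\<^sup>2) \<le> norm (((\<Sum>i<N. \<bar>X i \<omega>\<bar>) + \<bar>r\<bar> * real N)\<^sup>2)"
        by simp
    qed
  qed measurable
qed

text \<open>Each running maximum is independent of the next centred step, so the left-hand side of the pathwise inequality has
  expectation zero. The mixed product on its right-hand side is absorbed by completing a square.\<close>

lemma doob_L2:
  fixes X :: "nat \<Rightarrow> 'a \<Rightarrow> real"
  assumes ind: "indep_vars (\<lambda>_. borel) X {..<N}"
    and sq: "\<And>i. i < N \<Longrightarrow> integrable M (\<lambda>\<omega>. (X i \<omega>)\<^sup>2)"
    and zero: "\<And>i. i < N \<Longrightarrow> expectation (X i) = 0"
  shows "expectation (\<lambda>\<omega>. (walk_max 0 N (\<lambda>i. X i \<omega>))\<^sup>2) \<le> 4 * expectation (\<lambda>\<omega>. (\<Sum>i<N. X i \<omega>)\<^sup>2)"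
proof -
  have meas: "X i \<in> borel_measurable M" if "i < N" for i
    using ind that by (auto simp: indep_vars_def)
  define A where "A k \<omega> = walk_max 0 k (\<lambda>i. X i \<omega>)" for k \<omega>
  define S where "S \<omega> = (\<Sum>i<N. X i \<omega>)" for \<omega>
  have A: "A k \<in> borel_measurable M" "integrable M (\<lambda>\<omega>. (A k \<omega>)\<^sup>2)" if "k \<le> N" for k
    unfolding A_def[abs_def] using that meas sq by (auto intro!: walk_max_square_integrable)
  have S: "S \<in> borel_measurable M" "integrable M (\<lambda>\<omega>. (S \<omega>)\<^sup>2)"
    unfolding S_def[abs_def] using meas sq by (auto intro!: integrable_square_sum)
  have AX: "integrable M (\<lambda>\<omega>. A i \<omega> * X i \<omega>)" "expectation (\<lambda>\<omega>. A i \<omega> * X i \<omega>) = 0" if i: "i < N" for i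
  proof -
    have iv: "indep_var (Pi\<^sub>M {..<i} (\<lambda>_. borel)) (\<lambda>\<omega>. restrict (\<lambda>i. X i \<omega>) {..<i})
      (Pi\<^sub>M {i} (\<lambda>_. borel)) (\<lambda>\<omega>. restrict (\<lambda>i. X i \<omega>) {i})"
      using i by (intro indep_var_restrict[OF ind]) auto
    have "indep_var borel (walk_max 0 i \<circ> (\<lambda>\<omega>. restrict (\<lambda>i. X i \<omega>) {..<i}))
        borel ((\<lambda>w. w i) \<circ> (\<lambda>\<omega>. restrict (\<lambda>i. X i \<omega>) {i}))"
      by (rule indep_var_compose[OF iv measurable_walk_max]) (rule measurable_component_singleton, simp)
    moreover have "walk_max 0 i (restrict (\<lambda>i. X i \<omega>) {..<i}) = A i \<omega>" for \<omega>
      unfolding A_def by (rule walk_max_cong) simp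
    ultimately have iv': "indep_var borel (A i) borel (X i)" by (simp add: comp_def)
    have iA: "integrable M (A i)" 
      by (rule square_integrable_imp_integrable[OF A[OF less_imp_le[OF i]]])
    have iX: "integrable M (X i)" 
      by (rule square_integrable_imp_integrable[OF meas[OF i] sq[OF i]])
    show "integrable M (\<lambda>\<omega>. A i \<omega> * X i \<omega>)" by (rule indep_var_integrable[OF iv' iA iX])
    show "expectation (\<lambda>\<omega>. A i \<omega> * X i \<omega>) = 0"
      using indep_var_lebesgue_integral[OF iv' iA iX] zero[OF i] by simp
  qed
  have "expectation (\<lambda>\<omega>. \<Sum>i<N. A i \<omega> * X i \<omega>) = 0"
    using AX by (subst Bochner_Integration.integral_sum) auto
  moreover have "expectation (\<lambda>\<omega>. \<Sum>i<N. A i \<omega> * X i \<omega>) \<le> expectation (\<lambda>\<omega>. (S \<omega>)\<^sup>2 - (A N \<omega>)\<^sup>2 / 4)"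
  proof (rule integral_mono)
    show "integrable M (\<lambda>\<omega>. \<Sum>i<N. A i \<omega> * X i \<omega>)" using AX by auto
    show "integrable M (\<lambda>\<omega>. (S \<omega>)\<^sup>2 - (A N \<omega>)\<^sup>2 / 4)" using S A by auto
    fix \<omega>
    have "(\<Sum>i<N. A i \<omega> * X i \<omega>) \<le> A N \<omega> * S \<omega> - (A N \<omega>)\<^sup>2 / 2"
      unfolding A_def S_def by (rule doob_pathwise)
    also have "\<dots> \<le> (S \<omega>)\<^sup>2 - (A N \<omega>)\<^sup>2 / 4"
      using zero_le_power2[of "A N \<omega> / 2 - S \<omega>"] by (simp add: power2_eq_square algebra_simps)
    finally show "(\<Sum>i<N. A i \<omega> * X i \<omega>) \<le> (S \<omega>)\<^sup>2 - (A N \<omega>)\<^sup>2 / 4" .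
  qed
  ultimately show ?thesis using S A by (simp add: A_def S_def)
qed

end

section \<open>Square integrable Levy processes\<close>

locale square_integrable_levy =
  fixes M :: "'a measure" and J :: "real \<Rightarrow> 'a \<Rightarrow> real"
  assumes levy: "levy_process M J"
    and square_integrable: "integrable M (\<lambda>\<omega>. (J 1 \<omega>)\<^sup>2)"
begin

sublocale prob_space M by (rule levy_prob[OF levy])

definition mean :: real where "mean = expectation (J 1)"

text \<open>A single square integrable random variable that dominates the centred process during the first unit of time; all errors
  below are measured against it.\<close>

definition unit_fluctuation :: "'a \<Rightarrow> real" where
  "unit_fluctuation \<omega> = (SUP s\<in>{0..1}. \<bar>net_input J mean s \<omega>\<bar>)"

text \<open>By time reversal this is the stationary content of a single queue served at rate \<open>r\<close>.\<close>

definition workload_sup :: "real \<Rightarrow> 'a \<Rightarrow> real" where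
  "workload_sup r \<omega> = all_time_sup (\<lambda>s. net_input J r s \<omega>)"

text \<open>The input process restarted at time 1, which is independent of the past and has the same law as the original one.\<close>

definition shifted_input :: "real \<Rightarrow> 'a \<Rightarrow> real \<Rightarrow> real" where
  "shifted_input r \<omega> s = net_input J r (1 + s) \<omega> - net_input J r 1 \<omega>"

definition shifted_sup :: "real \<Rightarrow> 'a \<Rightarrow> real" where
  "shifted_sup r \<omega> = all_time_sup (shifted_input r \<omega>)"

lemma J_meas [measurable]: "J 1 \<in> borel_measurable M"
  by (rule levy_meas[OF levy]) simp

lemma J_integrable: "integrable M (J 1)"
  by (rule square_integrable_imp_integrable[OF J_meas square_integrable])

lemma inc_meas [measurable]: "increment J (1 / 2^n) i \<in> borel_measurable M"
  by (rule increment_meas[OF levy]) simp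

lemma J_1_eq_sum:
  assumes "\<omega> \<in> space M"
  shows "J 1 \<omega> = (\<Sum>i<2^n. increment J (1 / 2^n) i \<omega>)"
  using sum_increment[OF levy assms, of "1/2^n" "2^n"] by simp

text \<open>Only the second moment of \<open>J 1\<close> is given. It splits into the first increment of the grid and an independent
  remainder, and all increments have the same law.\<close>

lemma inc_square_integrable: "integrable M (\<lambda>\<omega>. (increment J (1 / 2^n) i \<omega>)\<^sup>2)"
proof -
  have d: "(0::real) \<le> 1 / 2^n" by simp
  have "indep_var borel (\<lambda>\<omega>. (\<lambda>w. w 0) (\<lambda>i\<in>{..<1::nat}. increment J (1/2^n) i \<omega>))
      borel (\<lambda>\<omega>. (\<lambda>w. \<Sum>i<2^n - 1. w i) (\<lambda>i\<in>{..<2^n - 1}. increment J (1/2^n) (1 + i) \<omega>))"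
    by (rule increment_blocks_indep[OF levy d]; intro borel_measurable_sum measurable_component_singleton; simp)
  then have ind: "indep_var borel (increment J (1/2^n) 0) borel (\<lambda>\<omega>. \<Sum>i<2^n - 1. increment J (1/2^n) (Suc i) \<omega>)"
    by simp
  have "J 1 \<omega> = increment J (1/2^n) 0 \<omega> + (\<Sum>i<2^n - 1. increment J (1/2^n) (Suc i) \<omega>)" if "\<omega> \<in> space M" for \<omega>
  proof -
    have "(2::nat)^n = Suc (2^n - 1)" by simp
    then show ?thesis using J_1_eq_sum[OF that, of n] sum.lessThan_Suc_shift[of "\<lambda>i. increment J (1/2^n) i \<omega>" "2^n - 1"] by simp
  qed
  then have "integrable M (\<lambda>\<omega>. (increment J (1/2^n) 0 \<omega> + (\<Sum>i<2^n - 1. increment J (1/2^n) (Suc i) \<omega>))\<^sup>2)"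
    using square_integrable by (subst Bochner_Integration.integrable_cong[OF refl, where g="\<lambda>\<omega>. (J 1 \<omega>)\<^sup>2"]) auto
  from indep_sum_square_integrable[OF ind this]
  have "integrable (distr M borel (increment J (1/2^n) 0)) (\<lambda>x. x\<^sup>2)"
    by (subst integrable_distr_eq) auto
  then have "integrable (distr M borel (increment J (1/2^n) i)) (\<lambda>x. x\<^sup>2)"
    by (simp add: increment_distr[OF levy d])
  then show ?thesis by (subst (asm) integrable_distr_eq) auto
qed

lemma inc_integrable: "integrable M (increment J (1 / 2^n) i)"
  by (rule square_integrable_imp_integrable[OF inc_meas inc_square_integrable])

lemma inc_expectation: "expectation (increment J (1 / 2^n) i) = mean / 2^n"
proof -
  have d: "(0::real) \<le> 1 / 2^n" by simp
  have eq: "expectation (increment J (1/2^n) j) = expectation (increment J (1/2^n) i)" for j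
  proof -
    have "integral\<^sup>L (distr M borel (increment J (1/2^n) k)) (\<lambda>x. x) = expectation (increment J (1/2^n) k)" for k
      by (subst integral_distr) auto
    note E = this
    have "integral\<^sup>L (distr M borel (increment J (1/2^n) j)) (\<lambda>x. x)
        = integral\<^sup>L (distr M borel (increment J (1/2^n) i)) (\<lambda>x. x)"
      by (simp only: increment_distr[OF levy d])
    then show ?thesis by (simp only: E)
  qed
  have "mean = expectation (\<lambda>\<omega>. \<Sum>j<2^n. increment J (1/2^n) j \<omega>)"
    unfolding mean_def by (intro Bochner_Integration.integral_cong J_1_eq_sum) auto
  also have "\<dots> = (\<Sum>j<(2::nat)^n. expectation (increment J (1/2^n) i))"
    by (subst Bochner_Integration.integral_sum[OF inc_integrable]) (rule sum.cong[OF refl eq])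
  also have "\<dots> = 2^n * expectation (increment J (1/2^n) i)" by simp
  finally show ?thesis by simp
qed

abbreviation second_moment :: real where
  "second_moment \<equiv> expectation (\<lambda>\<omega>. (J 1 \<omega> - mean)\<^sup>2)"

definition grid_fluctuation :: "nat \<Rightarrow> 'a \<Rightarrow> real" where
  "grid_fluctuation n \<omega> = path_max (\<lambda>s. \<bar>net_input J mean s \<omega>\<bar>) (1 / 2^n) (2^n)"

lemma net_input_0: "\<omega> \<in> space M \<Longrightarrow> net_input J r 0 \<omega> = 0"
  using levy_0[OF levy] by (simp add: net_input_def)

lemma net_input_meas: "0 \<le> s \<Longrightarrow> (\<lambda>\<omega>. net_input J r s \<omega>) \<in> borel_measurable M"
  unfolding net_input_def using levy_meas[OF levy] by auto

lemma grid_fluctuation_meas [measurable]: "grid_fluctuation n \<in> borel_measurable M"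
proof -
  have "(\<lambda>\<omega>. \<bar>net_input J mean (real k * (1/2^n)) \<omega>\<bar>) \<in> borel_measurable M" for k
    by (intro borel_measurable_abs net_input_meas) simp
  then show ?thesis unfolding grid_fluctuation_def[abs_def] path_max_def by (intro borel_measurable_Max) auto
qed

text \<open>Doob's inequality for the centred increments and for their negatives controls the maximum of the absolute value. The bound is
  the same for all meshes.\<close>

lemma grid_fluctuation_square:
  shows "integrable M (\<lambda>\<omega>. (grid_fluctuation n \<omega>)\<^sup>2)"
    and "expectation (\<lambda>\<omega>. (grid_fluctuation n \<omega>)\<^sup>2) \<le> 8 * second_moment"
proof -
  define X where "X c i \<omega> = c * (increment J (1/2^n) i \<omega> - mean / 2^n)" for c :: real and i \<omega>
  have ind: "indep_vars (\<lambda>_. borel) (X c) {..<2^n}" for c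
    unfolding X_def[abs_def] by (rule indep_vars_compose2[OF increment_indep[OF levy]]) auto
  have Xm: "X c i \<in> borel_measurable M" for c i unfolding X_def[abs_def] by measurable
  have Xsq: "integrable M (\<lambda>\<omega>. (X c i \<omega>)\<^sup>2)" for c i
    using integrable_square_add[OF inc_meas _ inc_square_integrable, of "\<lambda>_. - mean / 2^n" n i]
    unfolding X_def[abs_def] power_mult_distrib by (intro integrable_mult_right) (simp add: algebra_simps)
  have X0: "expectation (X c i) = 0" for c i
    unfolding X_def[abs_def] using inc_integrable[of n i] inc_expectation[of n i] by (simp add: prob_space)
  have sumX: "(\<Sum>i<k. X c i \<omega>) = c * net_input J mean (real k * (1/2^n)) \<omega>" if "\<omega> \<in> space M" for c k \<omega>
    using sum_increment[OF levy that, of "1/2^n" k]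
    by (simp add: X_def net_input_def sum_subtractf flip: sum_distrib_left)
  define W where "W c \<omega> = walk_max 0 (2^n) (\<lambda>i. X c i \<omega>)" for c \<omega>
  have W: "(\<lambda>\<omega>. (W c \<omega>)) \<in> borel_measurable M" "integrable M (\<lambda>\<omega>. (W c \<omega>)\<^sup>2)" for c
    unfolding W_def by (auto intro!: walk_max_square_integrable Xm Xsq)
  have EW: "expectation (\<lambda>\<omega>. (W c \<omega>)\<^sup>2) \<le> 4 * second_moment" if "c\<^sup>2 = 1" for c
  proof -
    have "expectation (\<lambda>\<omega>. (\<Sum>i<2^n. X c i \<omega>)\<^sup>2) = second_moment"
      using that by (intro Bochner_Integration.integral_cong refl) (simp add: sumX power_mult_distrib net_input_def)
    then show ?thesis using doob_L2[OF ind Xsq X0, of c] unfolding W_def by simp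
  qed
  have le: "(grid_fluctuation n \<omega>)\<^sup>2 \<le> (W 1 \<omega>)\<^sup>2 + (W (-1) \<omega>)\<^sup>2" if "\<omega> \<in> space M" for \<omega>
  proof -
    have "\<bar>net_input J mean (real k * (1/2^n)) \<omega>\<bar> \<le> max (W 1 \<omega>) (W (-1) \<omega>)" if "k \<le> 2^n" for k
      using walk_max_ge[OF that, of "\<lambda>i. X 1 i \<omega>" 0] walk_max_ge[OF that, of "\<lambda>i. X (-1) i \<omega>" 0]
        sumX[OF \<open>\<omega> \<in> space M\<close>] unfolding W_def by (auto simp: abs_if le_max_iff_disj)
    then have "grid_fluctuation n \<omega> \<le> max (W 1 \<omega>) (W (-1) \<omega>)"
      unfolding grid_fluctuation_def by (rule path_max_le)
    moreover have "0 \<le> grid_fluctuation n \<omega>"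
      unfolding grid_fluctuation_def by (rule path_max_nonneg) (simp add: net_input_0[OF that])
    ultimately have "(grid_fluctuation n \<omega>)\<^sup>2 \<le> (max (W 1 \<omega>) (W (-1) \<omega>))\<^sup>2" by (intro power_mono)
    also have "\<dots> \<le> (W 1 \<omega>)\<^sup>2 + (W (-1) \<omega>)\<^sup>2" by (auto simp: max_def)
    finally show ?thesis .
  qed
  show int: "integrable M (\<lambda>\<omega>. (grid_fluctuation n \<omega>)\<^sup>2)"
    by (rule Bochner_Integration.integrable_bound[OF Bochner_Integration.integrable_add[OF W(2)[of 1] W(2)[of "-1"]]])
       (use le in auto)
  have "expectation (\<lambda>\<omega>. (grid_fluctuation n \<omega>)\<^sup>2) \<le> expectation (\<lambda>\<omega>. (W 1 \<omega>)\<^sup>2 + (W (-1) \<omega>)\<^sup>2)"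
    using int W le by (intro integral_mono) auto
  also have "\<dots> \<le> 8 * second_moment" using EW[of 1] EW[of "-1"] W by simp
  finally show "expectation (\<lambda>\<omega>. (grid_fluctuation n \<omega>)\<^sup>2) \<le> 8 * second_moment" .
qed

lemma cadlag_abs_net_input: "\<omega> \<in> space M \<Longrightarrow> cadlag_path (\<lambda>s. \<bar>net_input J r s \<omega>\<bar>)"
  by (intro cadlag_abs cadlag_net_input[OF levy])

lemma grid_fluctuation_tendsto:
  "\<omega> \<in> space M \<Longrightarrow> (\<lambda>n. grid_fluctuation n \<omega>) \<longlonglongrightarrow> unit_fluctuation \<omega>"
  unfolding grid_fluctuation_def unit_fluctuation_def
  by (rule path_max_tendsto_SUP[OF cadlag_abs_net_input]) auto

lemma unit_fluctuation_meas [measurable]: "unit_fluctuation \<in> borel_measurable M"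
  by (rule borel_measurable_LIMSEQ_real[OF grid_fluctuation_tendsto grid_fluctuation_meas])

lemma unit_fluctuation_ge:
  assumes "\<omega> \<in> space M" "0 \<le> s" "s \<le> 1"
  shows "\<bar>net_input J mean s \<omega>\<bar> \<le> unit_fluctuation \<omega>"
  unfolding unit_fluctuation_def
  using assms by (intro cSUP_upper cadlag_bdd_above cadlag_abs_net_input) auto

lemma unit_fluctuation_square_integrable: "integrable M (\<lambda>\<omega>. (unit_fluctuation \<omega>)\<^sup>2)"
proof (rule monotone_limit_integrable(1))
  show "integrable M (\<lambda>\<omega>. (grid_fluctuation n \<omega>)\<^sup>2)" for n by (rule grid_fluctuation_square)
  show "expectation (\<lambda>\<omega>. (grid_fluctuation n \<omega>)\<^sup>2) \<le> 8 * second_moment" for n by (rule grid_fluctuation_square)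
  show "incseq (\<lambda>n. (grid_fluctuation n \<omega>)\<^sup>2)" for \<omega>
  proof (rule incseq_SucI, rule power_mono)
    fix n
    show "grid_fluctuation n \<omega> \<le> grid_fluctuation (Suc n) \<omega>"
      unfolding grid_fluctuation_def by (rule path_max_refine) auto
    show "0 \<le> grid_fluctuation n \<omega>"
      unfolding grid_fluctuation_def by (rule order_trans[OF _ path_max_ge[of 0]]) auto
  qed
  show "AE \<omega> in M. (\<lambda>n. (grid_fluctuation n \<omega>)\<^sup>2) \<longlonglongrightarrow> (unit_fluctuation \<omega>)\<^sup>2"
    by (intro AE_I2 tendsto_power grid_fluctuation_tendsto)
qed measurable

end

section \<open>One unit of time: the Lindley recursion\<close>

text \<open>The maximum is attained in the first \<open>a\<close> steps or by the walk restarted after them.\<close>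

lemma path_max_split:
  "path_max x \<delta> (a + N) = max (path_max x \<delta> a) (x (real a * \<delta>) + path_max (\<lambda>s. x (real a * \<delta> + s) - x (real a * \<delta>)) \<delta> N)"
  (is "_ = max _ (?c + path_max ?y \<delta> N)")
proof (rule antisym)
  show "path_max x \<delta> (a + N) \<le> max (path_max x \<delta> a) (?c + path_max ?y \<delta> N)"
  proof (rule path_max_le)
    fix k assume k: "k \<le> a + N"
    show "x (real k * \<delta>) \<le> max (path_max x \<delta> a) (?c + path_max ?y \<delta> N)"
    proof (cases "k \<le> a")
      case True
      then show ?thesis using path_max_ge[OF True, of x \<delta>] by (simp add: le_max_iff_disj)
    next
      case False
      then obtain j where j: "k = a + j" by (metis le_add_diff_inverse nat_le_linear)
      then have "?y (real j * \<delta>) \<le> path_max ?y \<delta> N" using k by (intro path_max_ge) simp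
      then show ?thesis using j by (simp add: le_max_iff_disj algebra_simps)
    qed
  qed
  have "path_max x \<delta> a \<le> path_max x \<delta> (a + N)"
    by (intro path_max_le path_max_ge) simp
  moreover have "path_max ?y \<delta> N \<le> path_max x \<delta> (a + N) - ?c"
  proof (rule path_max_le)
    fix k assume "k \<le> N"
    then have "x (real (a + k) * \<delta>) \<le> path_max x \<delta> (a + N)" by (intro path_max_ge) simp
    then show "?y (real k * \<delta>) \<le> path_max x \<delta> (a + N) - ?c" by (simp add: algebra_simps)
  qed
  ultimately show "max (path_max x \<delta> a) (?c + path_max ?y \<delta> N) \<le> path_max x \<delta> (a + N)" by simp
qed

lemma borel_measurable_fst: "(fst :: real \<times> real \<Rightarrow> real) \<in> borel_measurable borel"
  by (intro borel_measurable_continuous_onI continuous_intros)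

context square_integrable_levy
begin

definition horizon_sup :: "real \<Rightarrow> nat \<Rightarrow> nat \<Rightarrow> 'a \<Rightarrow> real" where
  "horizon_sup r n N \<omega> = path_max (\<lambda>s. net_input J r s \<omega>) (1 / 2^n) (N * 2^n)"

definition shifted_horizon_sup :: "real \<Rightarrow> nat \<Rightarrow> nat \<Rightarrow> 'a \<Rightarrow> real" where
  "shifted_horizon_sup r n N \<omega> = path_max (shifted_input r \<omega>) (1 / 2^n) (N * 2^n)"

lemma horizon_sup_walk:
  "\<omega> \<in> space M \<Longrightarrow> horizon_sup r n N \<omega>
     = walk_max (r * (1/2^n)) (N * 2^n) (\<lambda>i\<in>{..<N * 2^n}. increment J (1/2^n) i \<omega>)"
  unfolding horizon_sup_def by (rule net_input_path_max[OF levy])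

lemma shifted_horizon_sup_walk:
  "shifted_horizon_sup r n N \<omega>
     = walk_max (r * (1/2^n)) (N * 2^n) (\<lambda>i\<in>{..<N * 2^n}. increment J (1/2^n) (2^n + i) \<omega>)"
proof -
  define Y where "Y s = J (1 + s) \<omega> - J 1 \<omega>" for s
  have "shifted_horizon_sup r n N \<omega>
      = walk_max (r * (1/2^n)) (N * 2^n) (\<lambda>i. Y (real (Suc i) * (1/2^n)) - Y (real i * (1/2^n)))"
    unfolding shifted_horizon_sup_def
    by (rule walk_max_eq_path_max) (simp_all add: Y_def shifted_input_def net_input_def algebra_simps)
  also have "\<dots> = walk_max (r * (1/2^n)) (N * 2^n) (\<lambda>i\<in>{..<N * 2^n}. increment J (1/2^n) (2^n + i) \<omega>)"
  proof (rule walk_max_cong)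
    fix i assume "i < N * 2^n"
    have "1 + real (Suc i) * (1/2^n) = real (Suc (2^n + i)) * (1/2^n)" "1 + real i * (1/2^n) = real (2^n + i) * (1/2^n)"
      by (simp_all add: field_simps)
    then show "Y (real (Suc i) * (1/2^n)) - Y (real i * (1/2^n)) = (\<lambda>i\<in>{..<N * 2^n}. increment J (1/2^n) (2^n + i) \<omega>) i"
      using \<open>i < N * 2^n\<close> unfolding Y_def increment_def by simp
  qed
  finally show ?thesis .
qed

lemma horizon_sup_meas [measurable]: "horizon_sup r n N \<in> borel_measurable M"
proof -
  have "(\<lambda>\<omega>. walk_max (r * (1/2^n)) (N * 2^n) (\<lambda>i\<in>{..<N * 2^n}. increment J (1/2^n) i \<omega>)) \<in> borel_measurable M"
    by (rule walk_max_increment_meas[OF levy]) simp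
  then show ?thesis by (subst measurable_cong[OF horizon_sup_walk]) auto
qed

lemma shifted_horizon_sup_meas [measurable]: "shifted_horizon_sup r n N \<in> borel_measurable M"
  unfolding shifted_horizon_sup_walk[abs_def] by (rule walk_max_increment_meas[OF levy]) simp

lemma horizon_sup_nonneg: "\<omega> \<in> space M \<Longrightarrow> 0 \<le> horizon_sup r n N \<omega>"
  by (simp add: horizon_sup_walk walk_max_nonneg)

lemma shifted_horizon_sup_nonneg: "0 \<le> shifted_horizon_sup r n N \<omega>"
  by (simp add: shifted_horizon_sup_walk walk_max_nonneg)

lemma shifted_horizon_sup_integral:
  fixes H :: "real \<times> real \<Rightarrow> real"
  assumes [measurable]: "H \<in> borel_measurable borel"
  shows "expectation (\<lambda>\<omega>. H (shifted_horizon_sup r1 n N \<omega>, shifted_horizon_sup r2 n N \<omega>))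
       = expectation (\<lambda>\<omega>. H (horizon_sup r1 n N \<omega>, horizon_sup r2 n N \<omega>))"
proof -
  define G where "G w = H (walk_max (r1 * (1/2^n)) (N * 2^n) w, walk_max (r2 * (1/2^n)) (N * 2^n) w)" for w
  have "expectation (\<lambda>\<omega>. G (\<lambda>i\<in>{..<N * 2^n}. increment J (1/2^n) (2^n + i) \<omega>))
      = expectation (\<lambda>\<omega>. G (\<lambda>i\<in>{..<N * 2^n}. increment J (1/2^n) i \<omega>))"
  proof (rule increment_functional_integral[OF levy])
    show "G \<in> borel_measurable (Pi\<^sub>M {..<N * 2^n} (\<lambda>_. borel))" unfolding G_def by measurable
  qed (auto simp: inj_on_def)
  also have "\<dots> = expectation (\<lambda>\<omega>. H (horizon_sup r1 n N \<omega>, horizon_sup r2 n N \<omega>))"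
    by (intro Bochner_Integration.integral_cong refl) (simp add: G_def horizon_sup_walk)
  finally show ?thesis by (simp add: G_def shifted_horizon_sup_walk)
qed

text \<open>The value \<open>J 1\<close> is a function of the first \<open>2^n\<close> increments of the grid and the restarted suprema are functions of the
  later ones.\<close>

lemma shifted_horizon_sup_product:
  fixes H :: "real \<times> real \<Rightarrow> real" and g :: "real \<Rightarrow> real"
  assumes g[measurable]: "g \<in> borel_measurable borel" and ig: "integrable M (\<lambda>\<omega>. g (J 1 \<omega>))"
    and [measurable]: "H \<in> borel_measurable borel"
    and iH: "integrable M (\<lambda>\<omega>. H (shifted_horizon_sup r1 n N \<omega>, shifted_horizon_sup r2 n N \<omega>))"
  shows "integrable M (\<lambda>\<omega>. g (J 1 \<omega>) * H (shifted_horizon_sup r1 n N \<omega>, shifted_horizon_sup r2 n N \<omega>))"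
    and "expectation (\<lambda>\<omega>. g (J 1 \<omega>) * H (shifted_horizon_sup r1 n N \<omega>, shifted_horizon_sup r2 n N \<omega>))
       = expectation (\<lambda>\<omega>. g (J 1 \<omega>)) * expectation (\<lambda>\<omega>. H (horizon_sup r1 n N \<omega>, horizon_sup r2 n N \<omega>))"
proof -
  define F where "F w = g (\<Sum>i<2^n. w i)" for w :: "nat \<Rightarrow> real"
  define G where "G w = H (walk_max (r1 * (1/2^n)) (N * 2^n) w, walk_max (r2 * (1/2^n)) (N * 2^n) w)" for w
  have Fm: "F \<in> borel_measurable (Pi\<^sub>M {..<2^n} (\<lambda>_. borel))"
    unfolding F_def by (intro measurable_compose[OF _ g] borel_measurable_sum measurable_component_singleton) auto
  have Gm: "G \<in> borel_measurable (Pi\<^sub>M {..<N * 2^n} (\<lambda>_. borel))" unfolding G_def by measurable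
  have Fe: "F (\<lambda>i\<in>{..<2^n}. increment J (1/2^n) i \<omega>) = g (J 1 \<omega>)" if "\<omega> \<in> space M" for \<omega>
    by (simp add: F_def J_1_eq_sum[OF that, of n])
  have Ge: "G (\<lambda>i\<in>{..<N * 2^n}. increment J (1/2^n) (2^n + i) \<omega>)
      = H (shifted_horizon_sup r1 n N \<omega>, shifted_horizon_sup r2 n N \<omega>)" for \<omega>
    by (simp add: G_def shifted_horizon_sup_walk)
  have iv: "indep_var borel (\<lambda>\<omega>. F (\<lambda>i\<in>{..<2^n}. increment J (1/2^n) i \<omega>))
      borel (\<lambda>\<omega>. H (shifted_horizon_sup r1 n N \<omega>, shifted_horizon_sup r2 n N \<omega>))"
    using increment_blocks_indep[OF levy _ Fm Gm, of "1/2^n"] by (simp add: Ge)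
  have iF: "integrable M (\<lambda>\<omega>. F (\<lambda>i\<in>{..<2^n}. increment J (1/2^n) i \<omega>))"
    using ig by (subst Bochner_Integration.integrable_cong[OF refl Fe]) auto
  have eF: "expectation (\<lambda>\<omega>. F (\<lambda>i\<in>{..<2^n}. increment J (1/2^n) i \<omega>)) = expectation (\<lambda>\<omega>. g (J 1 \<omega>))"
    by (intro Bochner_Integration.integral_cong refl Fe)
  show "integrable M (\<lambda>\<omega>. g (J 1 \<omega>) * H (shifted_horizon_sup r1 n N \<omega>, shifted_horizon_sup r2 n N \<omega>))"
    using indep_var_integrable[OF iv iF iH] Fe by (subst Bochner_Integration.integrable_cong[OF refl]) auto
  have "expectation (\<lambda>\<omega>. g (J 1 \<omega>) * H (shifted_horizon_sup r1 n N \<omega>, shifted_horizon_sup r2 n N \<omega>))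
      = expectation (\<lambda>\<omega>. F (\<lambda>i\<in>{..<2^n}. increment J (1/2^n) i \<omega>) * H (shifted_horizon_sup r1 n N \<omega>, shifted_horizon_sup r2 n N \<omega>))"
    by (intro Bochner_Integration.integral_cong refl) (simp add: Fe)
  also have "\<dots> = expectation (\<lambda>\<omega>. g (J 1 \<omega>)) * expectation (\<lambda>\<omega>. H (shifted_horizon_sup r1 n N \<omega>, shifted_horizon_sup r2 n N \<omega>))"
    using indep_var_lebesgue_integral[OF iv iF iH] by (simp only: eF)
  finally show "expectation (\<lambda>\<omega>. g (J 1 \<omega>) * H (shifted_horizon_sup r1 n N \<omega>, shifted_horizon_sup r2 n N \<omega>))
       = expectation (\<lambda>\<omega>. g (J 1 \<omega>)) * expectation (\<lambda>\<omega>. H (horizon_sup r1 n N \<omega>, horizon_sup r2 n N \<omega>))"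
    by (simp only: shifted_horizon_sup_integral[OF assms(3)])
qed

lemma horizon_split:
  "horizon_sup r n (Suc N) \<omega> = max (horizon_sup r n 1 \<omega>) (net_input J r 1 \<omega> + shifted_horizon_sup r n N \<omega>)"
  using path_max_split[of "\<lambda>s. net_input J r s \<omega>" "1/2^n" "2^n" "N * 2^n"]
  by (simp add: horizon_sup_def shifted_horizon_sup_def shifted_input_def[abs_def])

lemma net_input_shift: "net_input J (mean + c) s \<omega> = net_input J mean s \<omega> - c * s"
  by (simp add: net_input_def algebra_simps)

lemma horizon_sup_unit_le:
  assumes "\<omega> \<in> space M" "0 \<le> c"
  shows "horizon_sup (mean + c) n 1 \<omega> \<le> grid_fluctuation n \<omega>"
  unfolding horizon_sup_def grid_fluctuation_def
proof (simp, rule path_max_mono)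
  fix k :: nat
  have "0 \<le> c * (real k * (1 / 2^n))" using assms by simp
  then show "net_input J (mean + c) (real k * (1 / 2^n)) \<omega> \<le> \<bar>net_input J mean (real k * (1 / 2^n)) \<omega>\<bar>"
    unfolding net_input_shift by linarith
qed

lemma horizon_sup_square_integrable: "integrable M (\<lambda>\<omega>. (horizon_sup r n N \<omega>)\<^sup>2)"
proof -
  have "integrable M (\<lambda>\<omega>. (walk_max (r * (1/2^n)) (N * 2^n) (\<lambda>i. increment J (1/2^n) i \<omega>))\<^sup>2)"
    by (rule walk_max_square_integrable) (auto simp: inc_square_integrable)
  moreover have "horizon_sup r n N \<omega> = walk_max (r * (1/2^n)) (N * 2^n) (\<lambda>i. increment J (1/2^n) i \<omega>)" if "\<omega> \<in> space M" for \<omega>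
    unfolding horizon_sup_walk[OF that] by (rule walk_max_cong) simp
  ultimately show ?thesis by (subst Bochner_Integration.integrable_cong[OF refl]) auto
qed

lemma shifted_horizon_sup_square_integrable: "integrable M (\<lambda>\<omega>. (shifted_horizon_sup r n N \<omega>)\<^sup>2)"
proof -
  have "integrable M (\<lambda>\<omega>. (walk_max (r * (1/2^n)) (N * 2^n) (\<lambda>i. increment J (1/2^n) (2^n + i) \<omega>))\<^sup>2)"
    by (rule walk_max_square_integrable) (auto simp: inc_square_integrable)
  moreover have "shifted_horizon_sup r n N \<omega> = walk_max (r * (1/2^n)) (N * 2^n) (\<lambda>i. increment J (1/2^n) (2^n + i) \<omega>)" for \<omega>
    unfolding shifted_horizon_sup_walk by (rule walk_max_cong) simp
  ultimately show ?thesis by simp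
qed

lemma horizon_sup_integrable: "integrable M (horizon_sup r n N)"
  by (rule square_integrable_imp_integrable[OF horizon_sup_meas horizon_sup_square_integrable])

lemma shifted_horizon_sup_integrable: "integrable M (shifted_horizon_sup r n N)"
  by (rule square_integrable_imp_integrable[OF shifted_horizon_sup_meas shifted_horizon_sup_square_integrable])

lemma horizon_sup_mono: "N \<le> N' \<Longrightarrow> horizon_sup r n N \<omega> \<le> horizon_sup r n N' \<omega>"
  unfolding horizon_sup_def by (intro path_max_refine) auto

lemma expectation_centered: "integrable M (\<lambda>\<omega>. J 1 \<omega> - mean)" "expectation (\<lambda>\<omega>. J 1 \<omega> - mean) = 0"
    "integrable M (\<lambda>\<omega>. (J 1 \<omega> - mean)\<^sup>2)"
  using J_integrable integrable_square_add[OF J_meas _ square_integrable, of "\<lambda>_. - mean"]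
  by (simp_all add: mean_def prob_space)

text \<open>Kingman's argument. With \<open>T\<close> for the maximum over \<open>N\<close> units of time, squaring the recursion bounds the second moment of the
  maximum over \<open>N + 1\<close> units by \<open>E T\<^sup>2 + C - 2 * c * E T\<close>. It is at least \<open>E T\<^sup>2\<close>, so the second moments cancel. The resulting
  bound depends neither on the mesh nor on the horizon.\<close>

lemma kingman_bound:
  assumes c: "0 < c"
  shows "expectation (horizon_sup (mean + c) n N) \<le> (9 * second_moment + c\<^sup>2) / (2 * c)"
proof -
  define T T' where "T = horizon_sup (mean + c) n" and "T' = shifted_horizon_sup (mean + c) n N"
  have iT: "integrable M (T k)" "integrable M (\<lambda>\<omega>. (T k \<omega>)\<^sup>2)" for k
    unfolding T_def by (rule horizon_sup_integrable horizon_sup_square_integrable)+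
  have iT': "integrable M T'" "integrable M (\<lambda>\<omega>. (T' \<omega>)\<^sup>2)"
    unfolding T'_def by (rule shifted_horizon_sup_integrable shifted_horizon_sup_square_integrable)+
  have eT': "expectation T' = expectation (T N)" "expectation (\<lambda>\<omega>. (T' \<omega>)\<^sup>2) = expectation (\<lambda>\<omega>. (T N \<omega>)\<^sup>2)"
    using shifted_horizon_sup_integral[OF borel_measurable_fst, of "mean + c" n N "mean + c"]
      shifted_horizon_sup_integral[OF borel_measurable_power[OF borel_measurable_fst, of 2], of "mean + c" n N "mean + c"]
    by (simp_all add: T_def T'_def)
  \<comment> \<open>the mixed term has expectation zero by independence\<close>
  define Y where "Y \<omega> = (J 1 \<omega> - mean) * (T' \<omega> - c)" for \<omega>
  have Y: "integrable M Y" "expectation Y = 0"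
  proof -
    have iH: "integrable M (\<lambda>\<omega>. (\<lambda>p. fst p - c) (shifted_horizon_sup (mean + c) n N \<omega>, shifted_horizon_sup (mean + c) n N \<omega>))"
      using iT' by (simp add: T'_def)
    have "(\<lambda>p::real\<times>real. fst p - c) \<in> borel_measurable borel" "(\<lambda>x. x - mean) \<in> borel_measurable borel"
      by (intro borel_measurable_diff borel_measurable_fst borel_measurable_const measurable_ident_sets refl)+
    from shifted_horizon_sup_product[OF this(2) expectation_centered(1) this(1) iH]
    show "integrable M Y" "expectation Y = 0" by (simp_all add: Y_def[abs_def] T'_def expectation_centered)
  qed
  have "expectation (\<lambda>\<omega>. (T N \<omega>)\<^sup>2) \<le> expectation (\<lambda>\<omega>. (T (Suc N) \<omega>)\<^sup>2)"
    using iT horizon_sup_mono[of N "Suc N"]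
    by (intro integral_mono) (auto simp: T_def intro!: power_mono horizon_sup_nonneg)
  also have "\<dots> \<le> expectation (\<lambda>\<omega>. (grid_fluctuation n \<omega>)\<^sup>2 + ((J 1 \<omega> - mean)\<^sup>2 + (T' \<omega>)\<^sup>2 - 2 * c * T' \<omega> + c\<^sup>2 + 2 * Y \<omega>))"
  proof (rule integral_mono)
    show "integrable M (\<lambda>\<omega>. (T (Suc N) \<omega>)\<^sup>2)" by (rule iT)
    show "integrable M (\<lambda>\<omega>. (grid_fluctuation n \<omega>)\<^sup>2 + ((J 1 \<omega> - mean)\<^sup>2 + (T' \<omega>)\<^sup>2 - 2 * c * T' \<omega> + c\<^sup>2 + 2 * Y \<omega>))"
      using iT' Y grid_fluctuation_square(1) expectation_centered by auto
    fix \<omega> assume w: "\<omega> \<in> space M"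
    have u: "0 \<le> horizon_sup (mean + c) n 1 \<omega>" "horizon_sup (mean + c) n 1 \<omega> \<le> grid_fluctuation n \<omega>"
      using horizon_sup_nonneg[OF w] horizon_sup_unit_le[OF w less_imp_le[OF c]] by blast+
    have "(T (Suc N) \<omega>)\<^sup>2 = (max (horizon_sup (mean + c) n 1 \<omega>) (J 1 \<omega> - mean - c + T' \<omega>))\<^sup>2"
      unfolding T_def T'_def horizon_split by (simp add: net_input_def algebra_simps)
    also have "\<dots> \<le> (horizon_sup (mean + c) n 1 \<omega>)\<^sup>2 + (J 1 \<omega> - mean - c + T' \<omega>)\<^sup>2"
      by (auto simp: max_def)
    also have "\<dots> \<le> (grid_fluctuation n \<omega>)\<^sup>2 + (J 1 \<omega> - mean - c + T' \<omega>)\<^sup>2"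
      using u by (intro add_right_mono power_mono)
    also have "\<dots> = (grid_fluctuation n \<omega>)\<^sup>2 + ((J 1 \<omega> - mean)\<^sup>2 + (T' \<omega>)\<^sup>2 - 2 * c * T' \<omega> + c\<^sup>2 + 2 * Y \<omega>)"
      by (simp add: Y_def power2_eq_square algebra_simps)
    finally show "(T (Suc N) \<omega>)\<^sup>2 \<le> \<dots>" .
  qed
  also have "\<dots> = expectation (\<lambda>\<omega>. (grid_fluctuation n \<omega>)\<^sup>2) + second_moment + expectation (\<lambda>\<omega>. (T N \<omega>)\<^sup>2)
      - 2 * c * expectation (T N) + c\<^sup>2"
    using iT' Y grid_fluctuation_square(1)[of n] expectation_centered by (simp add: eT' prob_space)
  finally have "2 * c * expectation (T N) \<le> 9 * second_moment + c\<^sup>2"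
    using grid_fluctuation_square(2)[of n] by linarith
  then show ?thesis using c by (simp add: T_def field_simps)
qed

lemma dyadic_max_horizon:
  "dyadic_max (\<lambda>s. net_input J r s \<omega>) n = horizon_sup r n n \<omega>"
  "dyadic_max (shifted_input r \<omega>) n = shifted_horizon_sup r n n \<omega>"
  by (simp_all add: dyadic_max_def horizon_sup_def shifted_horizon_sup_def)

lemma shifted_expectation: "expectation (shifted_horizon_sup r n N) = expectation (horizon_sup r n N)"
  using shifted_horizon_sup_integral[OF borel_measurable_fst, of r n N r] by simp

lemma AE_bdd:
  assumes c: "0 < c"
  shows "AE \<omega> in M. bdd_above (range (dyadic_max (\<lambda>s. net_input J (mean + c) s \<omega>)))"
    and "AE \<omega> in M. bdd_above (range (dyadic_max (shifted_input (mean + c) \<omega>)))"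
proof -
  show "AE \<omega> in M. bdd_above (range (dyadic_max (\<lambda>s. net_input J (mean + c) s \<omega>)))"
    unfolding dyadic_max_horizon
    using kingman_bound[OF c] dyadic_max_incseq[of "\<lambda>s. net_input J (mean + c) s _"]
    by (intro AE_bdd_above_of_expectation[where C="(9 * second_moment + c\<^sup>2) / (2 * c)"] horizon_sup_integrable)
      (auto simp: horizon_sup_nonneg dyadic_max_horizon[abs_def])
  show "AE \<omega> in M. bdd_above (range (dyadic_max (shifted_input (mean + c) \<omega>)))"
    unfolding dyadic_max_horizon
    using kingman_bound[OF c] dyadic_max_incseq[of "shifted_input (mean + c) _"]
    by (intro AE_bdd_above_of_expectation[where C="(9 * second_moment + c\<^sup>2) / (2 * c)"] shifted_horizon_sup_integrable)
      (auto simp: shifted_horizon_sup_nonneg shifted_expectation dyadic_max_horizon[abs_def])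
qed

lemma AE_limits:
  assumes c: "0 < c"
  shows "AE \<omega> in M. (\<lambda>n. horizon_sup (mean + c) n n \<omega>) \<longlonglongrightarrow> workload_sup (mean + c) \<omega>"
    and "AE \<omega> in M. (\<lambda>n. shifted_horizon_sup (mean + c) n n \<omega>) \<longlonglongrightarrow> shifted_sup (mean + c) \<omega>"
    and "AE \<omega> in M. (\<lambda>n. horizon_sup (mean + c) n (Suc n) \<omega>) \<longlonglongrightarrow> workload_sup (mean + c) \<omega>"
proof -
  show "AE \<omega> in M. (\<lambda>n. horizon_sup (mean + c) n n \<omega>) \<longlonglongrightarrow> workload_sup (mean + c) \<omega>"
    using AE_bdd(1)[OF c] AE_space
  proof eventually_elim
    case (elim \<omega>)
    show ?case
      using all_time_sup_tendsto[OF net_input_0[OF elim(2)] elim(1)]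
      by (simp add: workload_sup_def dyadic_max_horizon[abs_def])
  qed
  show "AE \<omega> in M. (\<lambda>n. shifted_horizon_sup (mean + c) n n \<omega>) \<longlonglongrightarrow> shifted_sup (mean + c) \<omega>"
    using AE_bdd(2)[OF c]
  proof eventually_elim
    case (elim \<omega>)
    have "shifted_input (mean + c) \<omega> 0 = 0" by (simp add: shifted_input_def)
    from all_time_sup_tendsto[OF this elim] show ?case
      by (simp add: shifted_sup_def dyadic_max_horizon[abs_def])
  qed
  show "AE \<omega> in M. (\<lambda>n. horizon_sup (mean + c) n (Suc n) \<omega>) \<longlonglongrightarrow> workload_sup (mean + c) \<omega>"
    using AE_bdd(1)[OF c] AE_space
  proof eventually_elim
    case (elim \<omega>)
    show ?case
      using path_max_Suc_horizon_tendsto[OF net_input_0[OF elim(2)] elim(1)]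
      by (simp only: workload_sup_def horizon_sup_def)
  qed
qed

lemma workload_sup_meas [measurable]: "workload_sup r \<in> borel_measurable M"
  unfolding workload_sup_def[abs_def] all_time_sup_def dyadic_max_horizon by measurable

lemma shifted_sup_meas [measurable]: "shifted_sup r \<in> borel_measurable M"
  unfolding shifted_sup_def[abs_def] all_time_sup_def dyadic_max_horizon by measurable

lemma workload_sup_nonneg: "0 \<le> workload_sup r \<omega>" "0 \<le> shifted_sup r \<omega>"
  by (simp_all add: workload_sup_def shifted_sup_def all_time_sup_def)

text \<open>The equality of the two expectations is inherited from the equality in law on every grid.\<close>

lemma workload_sup_integrable:
  assumes c: "0 < c"
  shows "integrable M (workload_sup (mean + c))" "integrable M (shifted_sup (mean + c))"
    and "expectation (shifted_sup (mean + c)) = expectation (workload_sup (mean + c))"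
proof -
  have inc: "incseq (\<lambda>n. horizon_sup (mean + c) n n \<omega>)" "incseq (\<lambda>n. shifted_horizon_sup (mean + c) n n \<omega>)" for \<omega>
    using dyadic_max_incseq[of "\<lambda>s. net_input J (mean + c) s \<omega>"] dyadic_max_incseq[of "shifted_input (mean + c) \<omega>"]
    by (simp_all add: dyadic_max_horizon[abs_def])
  note A = monotone_limit_integrable[OF horizon_sup_integrable inc(1) kingman_bound[OF c] AE_limits(1)[OF c] workload_sup_meas]
  have le: "expectation (shifted_horizon_sup (mean + c) n n) \<le> (9 * second_moment + c\<^sup>2) / (2 * c)" for n
    using kingman_bound[OF c] by (simp add: shifted_expectation)
  note B = monotone_limit_integrable[OF shifted_horizon_sup_integrable inc(2) le AE_limits(2)[OF c] shifted_sup_meas]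
  show "integrable M (workload_sup (mean + c))" "integrable M (shifted_sup (mean + c))"
    using A(1) B(1) by auto
  show "expectation (shifted_sup (mean + c)) = expectation (workload_sup (mean + c))"
    using A(2) B(2) unfolding shifted_expectation by (rule LIMSEQ_unique[rotated])
qed

text \<open>The supremum is approached either during the first unit of time, and then it is at most \<open>unit_fluctuation\<close>, or afterwards, and
  then it is the displacement at time 1 plus the restarted supremum.\<close>

lemma lindley:
  assumes c: "0 < c"
  shows "AE \<omega> in M. J 1 \<omega> - mean - c + shifted_sup (mean + c) \<omega> \<le> workload_sup (mean + c) \<omega>
     \<and> workload_sup (mean + c) \<omega> \<le> max (unit_fluctuation \<omega>) (J 1 \<omega> - mean - c + shifted_sup (mean + c) \<omega>)"
  using AE_limits(2,3)[OF c] AE_space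
proof eventually_elim
  case (elim \<omega>)
  have split: "horizon_sup (mean + c) n (Suc n) \<omega>
      = max (horizon_sup (mean + c) n 1 \<omega>) (J 1 \<omega> - mean - c + shifted_horizon_sup (mean + c) n n \<omega>)" for n
    unfolding horizon_split by (simp add: net_input_def algebra_simps)
  have lim: "(\<lambda>n. J 1 \<omega> - mean - c + shifted_horizon_sup (mean + c) n n \<omega>) \<longlonglongrightarrow> J 1 \<omega> - mean - c + shifted_sup (mean + c) \<omega>"
    using elim by (intro tendsto_intros)
  show ?case
  proof
    show "J 1 \<omega> - mean - c + shifted_sup (mean + c) \<omega> \<le> workload_sup (mean + c) \<omega>"
      by (rule LIMSEQ_le[OF lim elim(2)]) (auto simp: split)
    show "workload_sup (mean + c) \<omega> \<le> max (unit_fluctuation \<omega>) (J 1 \<omega> - mean - c + shifted_sup (mean + c) \<omega>)"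
    proof (rule LIMSEQ_le[OF elim(2) tendsto_max[OF grid_fluctuation_tendsto[OF elim(3)] lim]])
      show "\<exists>N. \<forall>n\<ge>N. horizon_sup (mean + c) n (Suc n) \<omega>
          \<le> max (grid_fluctuation n \<omega>) (J 1 \<omega> - mean - c + shifted_horizon_sup (mean + c) n n \<omega>)"
        using horizon_sup_unit_le[OF elim(3), of c] c unfolding split
        by (intro exI[of _ 0] allI impI max.mono) auto
    qed
  qed
qed

text \<open>For the two service rates of the tandem: the upstream content is at most the total content.\<close>

lemma AE_antimono:
  assumes c: "0 < c2" "c2 \<le> c1"
  shows "AE \<omega> in M. workload_sup (mean + c1) \<omega> \<le> workload_sup (mean + c2) \<omega>"
    and "AE \<omega> in M. shifted_sup (mean + c1) \<omega> \<le> shifted_sup (mean + c2) \<omega>"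
proof -
  have c1: "0 < c1" using c by simp
  have le: "c2 * x \<le> c1 * x" if "0 \<le> x" for x using c that by (intro mult_right_mono)
  show "AE \<omega> in M. workload_sup (mean + c1) \<omega> \<le> workload_sup (mean + c2) \<omega>"
    using AE_limits(1)[OF c1] AE_limits(1)[OF c(1)]
  proof eventually_elim
    case (elim \<omega>)
    then show ?case
    proof (rule LIMSEQ_le)
      show "\<exists>N. \<forall>n\<ge>N. horizon_sup (mean + c1) n n \<omega> \<le> horizon_sup (mean + c2) n n \<omega>"
        unfolding horizon_sup_def net_input_shift by (intro exI[of _ 0] allI impI path_max_mono diff_left_mono le) simp
    qed
  qed
  show "AE \<omega> in M. shifted_sup (mean + c1) \<omega> \<le> shifted_sup (mean + c2) \<omega>"
    using AE_limits(2)[OF c1] AE_limits(2)[OF c(1)]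
  proof eventually_elim
    case (elim \<omega>)
    then show ?case
    proof (rule LIMSEQ_le)
      have "shifted_input (mean + c1) \<omega> s \<le> shifted_input (mean + c2) \<omega> s" if "0 \<le> s" for s
        using le[OF that] unfolding shifted_input_def net_input_shift by (simp add: algebra_simps)
      then show "\<exists>N. \<forall>n\<ge>N. shifted_horizon_sup (mean + c1) n n \<omega> \<le> shifted_horizon_sup (mean + c2) n n \<omega>"
        unfolding shifted_horizon_sup_def by (intro exI allI impI path_max_mono) simp
    qed
  qed
qed

text \<open>Independence of the first step and equality in law of the original and the restarted pair of suprema, in a single identity.
  The factor \<open>g\<close> may be unbounded: it is used for the first and second moments of the step.\<close>

lemma shifted_sup_product:
  fixes h :: "real \<times> real \<Rightarrow> real" and g :: "real \<Rightarrow> real"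
  assumes c: "0 < c1" "0 < c2"
    and g[measurable]: "g \<in> borel_measurable borel" and ig: "integrable M (\<lambda>\<omega>. g (J 1 \<omega>))"
    and h: "continuous_on UNIV h" "bounded (range h)"
  shows "expectation (\<lambda>\<omega>. g (J 1 \<omega>) * h (shifted_sup (mean + c1) \<omega>, shifted_sup (mean + c2) \<omega>))
       = expectation (\<lambda>\<omega>. g (J 1 \<omega>)) * expectation (\<lambda>\<omega>. h (workload_sup (mean + c1) \<omega>, workload_sup (mean + c2) \<omega>))"
proof -
  obtain B where B: "\<And>x. \<bar>h x\<bar> \<le> B" using h(2) by (auto simp: bounded_iff)
  have hm[measurable]: "h \<in> borel_measurable borel" by (rule borel_measurable_continuous_onI[OF h(1)])
  have ih: "integrable M (\<lambda>\<omega>. h (shifted_horizon_sup r1 n n \<omega>, shifted_horizon_sup r2 n n \<omega>))" for r1 r2 n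
    by (rule integrable_const_bound[of _ B]) (use B in auto)
  have lim1: "(\<lambda>n. expectation (\<lambda>\<omega>. h (horizon_sup (mean + c1) n n \<omega>, horizon_sup (mean + c2) n n \<omega>)))
     \<longlonglongrightarrow> expectation (\<lambda>\<omega>. h (workload_sup (mean + c1) \<omega>, workload_sup (mean + c2) \<omega>))"
  proof (rule integral_dominated_convergence[where w="\<lambda>_. B"])
    show "AE \<omega> in M. (\<lambda>n. h (horizon_sup (mean + c1) n n \<omega>, horizon_sup (mean + c2) n n \<omega>))
        \<longlonglongrightarrow> h (workload_sup (mean + c1) \<omega>, workload_sup (mean + c2) \<omega>)"
      using AE_limits(1)[OF c(1)] AE_limits(1)[OF c(2)]
      by eventually_elim (intro continuous_on_tendsto_compose[OF h(1)] tendsto_Pair, auto)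
  qed (use B in auto)
  have lim2: "(\<lambda>n. expectation (\<lambda>\<omega>. g (J 1 \<omega>) * h (shifted_horizon_sup (mean + c1) n n \<omega>, shifted_horizon_sup (mean + c2) n n \<omega>)))
     \<longlonglongrightarrow> expectation (\<lambda>\<omega>. g (J 1 \<omega>) * h (shifted_sup (mean + c1) \<omega>, shifted_sup (mean + c2) \<omega>))"
  proof (rule integral_dominated_convergence[where w="\<lambda>\<omega>. \<bar>g (J 1 \<omega>)\<bar> * B"])
    show "AE \<omega> in M. (\<lambda>n. g (J 1 \<omega>) * h (shifted_horizon_sup (mean + c1) n n \<omega>, shifted_horizon_sup (mean + c2) n n \<omega>))
        \<longlonglongrightarrow> g (J 1 \<omega>) * h (shifted_sup (mean + c1) \<omega>, shifted_sup (mean + c2) \<omega>)"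
      using AE_limits(2)[OF c(1)] AE_limits(2)[OF c(2)]
      by eventually_elim (intro tendsto_mult_left continuous_on_tendsto_compose[OF h(1)] tendsto_Pair, auto)
    show "integrable M (\<lambda>\<omega>. \<bar>g (J 1 \<omega>)\<bar> * B)" using ig by auto
    show "AE \<omega> in M. norm (g (J 1 \<omega>) * h (shifted_horizon_sup (mean + c1) n n \<omega>, shifted_horizon_sup (mean + c2) n n \<omega>))
        \<le> \<bar>g (J 1 \<omega>)\<bar> * B" for n
      using B by (auto simp: abs_mult intro!: mult_left_mono)
  qed auto
  have "(\<lambda>n. expectation (\<lambda>\<omega>. g (J 1 \<omega>) * h (shifted_horizon_sup (mean + c1) n n \<omega>, shifted_horizon_sup (mean + c2) n n \<omega>)))
     \<longlonglongrightarrow> expectation (\<lambda>\<omega>. g (J 1 \<omega>)) * expectation (\<lambda>\<omega>. h (workload_sup (mean + c1) \<omega>, workload_sup (mean + c2) \<omega>))"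
    unfolding shifted_horizon_sup_product(2)[OF g ig hm ih] by (intro tendsto_intros lim1)
  from LIMSEQ_unique[OF lim2 this] show ?thesis .
qed

end

section \<open>Expansion of the transform over one step\<close>

text \<open>Taylor expansions of second and third order, both within \<open>[0, \<infinity>)\<close>, where all derivatives are bounded by 1. The
  minimum makes the error \<open>o(h\<^sup>2)\<close> in expectation under a mere second moment assumption.\<close>

lemma exp_neg_taylor2:
  fixes a b :: real
  assumes "0 \<le> a" "0 \<le> b"
  shows "\<bar>exp (-b) - exp (-a) * (1 - (b - a) + (b - a)\<^sup>2 / 2)\<bar> \<le> (b - a)\<^sup>2 * min 1 \<bar>b - a\<bar>"
proof (cases "a = b")
  case False
  define D where "D m x = (-1)^m * exp (-x)" for m :: nat and x :: real
  have D: "\<forall>m t. m < n \<and> 0 \<le> t \<and> t \<le> max a b \<longrightarrow> DERIV (D m) t :> D (Suc m) t" for n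
    unfolding D_def by (auto intro!: derivative_eq_intros)
  have tay: "\<exists>t\<ge>0. exp (-b) = (\<Sum>m<n. D m a / fact m * (b - a)^m) + D n t / fact n * (b - a)^n" if "0 < n" for n
  proof -
    have "\<exists>t. (if b < a then b < t \<and> t < a else a < t \<and> t < b) \<and>
        exp (-b) = (\<Sum>m<n. D m a / fact m * (b - a)^m) + D n t / fact n * (b - a)^n"
      using assms False by (intro Taylor[OF that _ D]) (auto simp: D_def)
    then show ?thesis using assms by (auto split: if_splits intro: less_imp_le order_trans)
  qed
  obtain t where t: "t \<ge> 0" "exp (-b) = (\<Sum>m<2. D m a / fact m * (b - a)^m) + D 2 t / fact 2 * (b - a)^2"
    using tay[of 2] by auto
  have eq: "exp (-b) - exp (-a) * (1 - (b - a) + (b - a)\<^sup>2 / 2) = (exp (-t) - exp (-a)) * ((b - a)\<^sup>2 / 2)"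
    unfolding t(2) by (simp add: D_def numeral_2_eq_2 field_simps)
  have "exp (-t) \<le> 1" "exp (-a) \<le> 1" "0 < exp (-t)" "0 < exp (-a)" using t(1) assms by auto
  then have "\<bar>exp (-t) - exp (-a)\<bar> \<le> 1" by linarith
  then have "\<bar>exp (-t) - exp (-a)\<bar> * ((b - a)\<^sup>2 / 2) \<le> 1 * ((b - a)\<^sup>2 / 2)" by (rule mult_right_mono) simp
  then have 1: "\<bar>exp (-b) - exp (-a) * (1 - (b - a) + (b - a)\<^sup>2 / 2)\<bar> \<le> (b - a)\<^sup>2 / 2"
    unfolding eq by (simp add: abs_mult)
  obtain s where s: "s \<ge> 0" "exp (-b) = (\<Sum>m<3. D m a / fact m * (b - a)^m) + D 3 s / fact 3 * (b - a)^3"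
    using tay[of 3] by auto
  have "exp (-b) - exp (-a) * (1 - (b - a) + (b - a)\<^sup>2 / 2) = - exp (-s) * ((b - a)^3 / 6)"
    unfolding s(2) by (simp add: D_def numeral_3_eq_3 power2_eq_square fact_numeral algebra_simps)
  then have "\<bar>exp (-b) - exp (-a) * (1 - (b - a) + (b - a)\<^sup>2 / 2)\<bar> = exp (-s) * (\<bar>b - a\<bar>^3 / 6)"
    by (simp add: abs_mult power_abs)
  also have "\<dots> \<le> 1 * (\<bar>b - a\<bar>^3 / 6)" using s(1) by (intro mult_right_mono) auto
  also have "\<dots> \<le> (b - a)\<^sup>2 * \<bar>b - a\<bar>" 
  proof -
    have "\<bar>b - a\<bar>^3 = (b - a)\<^sup>2 * \<bar>b - a\<bar>" by (simp add: power3_eq_cube power2_eq_square flip: abs_mult)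
    moreover have "0 \<le> (b - a)\<^sup>2 * \<bar>b - a\<bar>" by simp
    ultimately show ?thesis by linarith
  qed
  finally have "\<bar>exp (-b) - exp (-a) * (1 - (b - a) + (b - a)\<^sup>2 / 2)\<bar> \<le> (b - a)\<^sup>2 * \<bar>b - a\<bar>" .
  moreover have "\<bar>exp (-b) - exp (-a) * (1 - (b - a) + (b - a)\<^sup>2 / 2)\<bar> \<le> (b - a)\<^sup>2 * 1"
    using 1 zero_le_power2[of "b - a"] by linarith
  ultimately show ?thesis by (cases "1 \<le> \<bar>b - a\<bar>") (simp_all only: min.absorb1 min.absorb2 not_le less_imp_le)
qed simp

lemma exp_neg_lipschitz:
  fixes a b :: real
  assumes "0 \<le> a" "0 \<le> b"
  shows "\<bar>exp (-a) - exp (-b)\<bar> \<le> \<bar>a - b\<bar>"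
proof -
  have D: "1 - exp (-d) \<le> d" for d :: real using exp_ge_add_one_self[of "-d"] by linarith
  have *: "exp (-x) - exp (-y) \<le> y - x" if "0 \<le> x" "x \<le> y" for x y :: real
  proof -
    have "exp (-x) - exp (-y) = exp (-x) * (1 - exp (-(y - x)))" by (simp add: right_diff_distrib flip: exp_add)
    also have "\<dots> \<le> 1 * (1 - exp (-(y - x)))" using that by (intro mult_right_mono) auto
    also have "\<dots> \<le> y - x" using D[of "y - x"] by simp
    finally show ?thesis .
  qed
  show ?thesis
    using *[of a b] *[of b a] assms exp_le_cancel_iff[of "-a" "-b"] exp_le_cancel_iff[of "-b" "-a"] by linarith
qed

text \<open>The heart of the argument, pathwise. Let \<open>a\<close> and \<open>b\<close> be the exponents of the transform formed with the restarted suprema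
  and with the original ones. Their difference is \<open>\<zeta> + P\<close>: the free displacement \<open>\<zeta>\<close> of the net inputs in one unit of time, of order
  \<open>\<epsilon>\<close>, and the contribution \<open>P\<close> of the reflections \<open>R1\<close> and \<open>R2\<close>. Expanding the exponential to second order produces the terms
  that are kept. Products of two small factors are errors, and so is the replacement of the exponential in front of a
  reflection: \<open>R1\<close> acts only when the upstream supremum is at most \<open>U\<close>, so that \<open>b\<close> is close to \<open>s2 * \<epsilon> * S2\<close>, and \<open>R2\<close> only
  when the total supremum is at most \<open>U\<close>, so that \<open>b\<close> is close to 0.\<close>

lemma one_step_expansion:
  fixes s1 s2 \<gamma> \<epsilon> \<xi> S1 S2 T1 T2 R1 R2 U :: real
  assumes s: "0 \<le> s1" "0 \<le> s2" and g: "1 < \<gamma>" and e: "0 < \<epsilon>" "\<epsilon> \<le> 1"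
    and S: "0 \<le> S1" "S1 \<le> S2" and T: "0 \<le> T1" "T1 \<le> T2"
    and R1: "S1 = \<xi> - \<gamma> * \<epsilon> + T1 + R1" "0 \<le> R1" "0 < R1 \<Longrightarrow> S1 \<le> U" "R1 \<le> 2 * U + \<gamma>"
    and R2: "S2 = \<xi> - \<epsilon> + T2 + R2" "0 \<le> R2" "0 < R2 \<Longrightarrow> S2 \<le> U" "R2 \<le> 2 * U + \<gamma>"
    and U: "\<bar>\<xi>\<bar> \<le> U"
  defines "V \<equiv> 2 * U + \<gamma>" and "D \<equiv> \<gamma> * (s1 + s2 + 1)"
  defines "a \<equiv> s1 * \<epsilon> * T1 + s2 * \<epsilon> * (T2 - T1)" and "b \<equiv> s1 * \<epsilon> * S1 + s2 * \<epsilon> * (S2 - S1)"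
    and "\<zeta> \<equiv> s1 * \<epsilon> * \<xi> - \<epsilon>\<^sup>2 * (\<gamma> * s1 - (\<gamma> - 1) * s2)"
  shows "\<bar>exp (-b) - exp (-a) + exp (-a) * \<zeta> - exp (-a) * \<zeta>\<^sup>2 / 2
      + (s1 - s2) * \<epsilon> * (R1 * exp (- (s2 * \<epsilon> * S2))) + s2 * \<epsilon> * R2\<bar>
     \<le> \<epsilon>\<^sup>2 * D\<^sup>2 * (9 * (V\<^sup>2 * min 1 (3 * \<epsilon> * D * V)) + 7 * (R1 * V + R2 * V))"
proof -
  define P where "P = (s1 - s2) * \<epsilon> * R1 + s2 * \<epsilon> * R2"
  define \<delta> where "\<delta> = \<epsilon> * D"
  have U0: "0 \<le> U" using U by linarith
  have V: "0 \<le> V" "U \<le> V" "1 \<le> V" using U0 g by (auto simp: V_def)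
  have "1 * (s1 + s2 + 1) \<le> D" unfolding D_def using s g by (intro mult_right_mono) auto
  then have D: "0 \<le> D" "s1 + s2 \<le> D" using s by auto
  have d0: "0 \<le> \<delta>" using e D by (simp add: \<delta>_def)
  have dd: "(s1 + s2) * \<epsilon> \<le> \<delta>" using D e by (simp add: \<delta>_def mult.commute mult_left_mono)
  have a0: "0 \<le> a" using s e T by (simp add: a_def)
  have b0: "0 \<le> b" using s e S by (simp add: b_def)
  have ba: "b - a = \<zeta> + P"
    unfolding a_def b_def \<zeta>_def P_def R1(1) R2(1) by (simp add: algebra_simps power2_eq_square)
  have zb: "\<bar>\<zeta>\<bar> \<le> \<delta> * V"
  proof -
    have "\<bar>\<gamma> * s1 - (\<gamma> - 1) * s2\<bar> \<le> \<gamma> * (s1 + s2)"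
    proof -
      have "0 \<le> \<gamma> * s1" "0 \<le> (\<gamma> - 1) * s2" "(\<gamma> - 1) * s2 \<le> \<gamma> * s2" using s g by (auto intro: mult_right_mono)
      then show ?thesis by (simp add: distrib_left abs_le_iff)
    qed
    then have "\<epsilon> * \<bar>\<gamma> * s1 - (\<gamma> - 1) * s2\<bar> \<le> 1 * (\<gamma> * (s1 + s2))"
      using e s g by (intro mult_mono) auto
    moreover have "s1 * \<bar>\<xi>\<bar> \<le> \<gamma> * (s1 + s2) * U"
      using U s g U0 by (intro mult_mono) (auto intro: order_trans[OF _ mult_right_mono[of 1 \<gamma>]])
    ultimately have "s1 * \<bar>\<xi>\<bar> + \<epsilon> * \<bar>\<gamma> * s1 - (\<gamma> - 1) * s2\<bar> \<le> \<gamma> * (s1 + s2) * (U + 1)"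
      by (simp add: distrib_left)
    also have "\<dots> \<le> D * V" unfolding D_def
      using s g U0 by (intro mult_mono) (auto simp: V_def)
    finally have *: "s1 * \<bar>\<xi>\<bar> + \<epsilon> * \<bar>\<gamma> * s1 - (\<gamma> - 1) * s2\<bar> \<le> D * V" .
    have "\<bar>\<zeta>\<bar> \<le> \<bar>s1 * \<epsilon> * \<xi>\<bar> + \<bar>\<epsilon>\<^sup>2 * (\<gamma> * s1 - (\<gamma> - 1) * s2)\<bar>"
      unfolding \<zeta>_def by (rule abs_triangle_ineq4)
    also have "\<dots> = \<epsilon> * (s1 * \<bar>\<xi>\<bar> + \<epsilon> * \<bar>\<gamma> * s1 - (\<gamma> - 1) * s2\<bar>)"
      using e s by (simp add: abs_mult power2_eq_square distrib_left mult_ac)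
    also have "\<dots> \<le> \<epsilon> * (D * V)" using * e by (intro mult_left_mono) auto
    finally show ?thesis by (simp add: \<delta>_def mult.assoc)
  qed
  have Pb: "\<bar>P\<bar> \<le> \<delta> * (R1 + R2)"
  proof -
    have "\<bar>P\<bar> \<le> \<bar>(s1 - s2) * \<epsilon> * R1\<bar> + \<bar>s2 * \<epsilon> * R2\<bar>" unfolding P_def by (rule abs_triangle_ineq)
    also have "\<dots> = (\<bar>s1 - s2\<bar> * \<epsilon>) * R1 + (s2 * \<epsilon>) * R2" using s e R1(2) R2(2) by (simp add: abs_mult)
    also have "\<dots> \<le> ((s1 + s2) * \<epsilon>) * R1 + ((s1 + s2) * \<epsilon>) * R2"
      using s e R1(2) R2(2) by (intro add_mono mult_right_mono) auto
    also have "\<dots> \<le> \<delta> * R1 + \<delta> * R2" using dd R1(2) R2(2) by (intro add_mono mult_right_mono)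
    finally show ?thesis by (simp add: distrib_left)
  qed
  have Pb2: "\<bar>P\<bar> \<le> 2 * (\<delta> * V)"
  proof -
    have "\<delta> * (R1 + R2) \<le> \<delta> * (V + V)" using R1(4) R2(4) d0 by (intro mult_left_mono add_mono) (auto simp: V_def)
    then show ?thesis using Pb by simp
  qed
  have hb: "\<bar>b - a\<bar> \<le> 3 * (\<delta> * V)" using zb Pb2 unfolding ba by linarith
  have RV: "0 \<le> R1 * V" "0 \<le> R2 * V" using R1(2) R2(2) V by auto
  have dV: "\<delta> * (R1 + R2) * (\<delta> * V) = \<delta>\<^sup>2 * (R1 * V + R2 * V)" by (simp add: power2_eq_square algebra_simps)
  \<comment> \<open>remainder of the Taylor expansion\<close>
  define E1 where "E1 = exp (-b) - exp (-a) * (1 - (b - a) + (b - a)\<^sup>2 / 2)"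
  have E1: "\<bar>E1\<bar> \<le> \<delta>\<^sup>2 * (9 * (V\<^sup>2 * min 1 (3 * \<delta> * V)))"
  proof -
    have "\<bar>E1\<bar> \<le> (b - a)\<^sup>2 * min 1 \<bar>b - a\<bar>" unfolding E1_def by (rule exp_neg_taylor2[OF a0 b0])
    also have "\<dots> \<le> (3 * (\<delta> * V))\<^sup>2 * min 1 (3 * \<delta> * V)"
    proof (rule mult_mono)
      show "(b - a)\<^sup>2 \<le> (3 * (\<delta> * V))\<^sup>2" using hb by (rule power2_le_iff_abs_le[THEN iffD2, rotated]) (use d0 V in auto)
    qed (use hb in auto)
    finally show ?thesis by (simp add: power_mult_distrib mult_ac)
  qed
  \<comment> \<open>second-order terms that involve a reflection\<close>
  define E2 where "E2 = exp (-a) * (P * (2 * \<zeta> + P)) / 2"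
  have E2: "\<bar>E2\<bar> \<le> 2 * (\<delta>\<^sup>2 * (R1 * V + R2 * V))"
  proof -
    have "\<bar>2 * \<zeta> + P\<bar> \<le> 4 * (\<delta> * V)" using zb Pb2 by linarith
    then have "\<bar>P\<bar> * \<bar>2 * \<zeta> + P\<bar> \<le> (\<delta> * (R1 + R2)) * (4 * (\<delta> * V))"
      using Pb R1(2) R2(2) d0 by (intro mult_mono) auto
    then have "exp (-a) * (\<bar>P\<bar> * \<bar>2 * \<zeta> + P\<bar>) \<le> 1 * ((\<delta> * (R1 + R2)) * (4 * (\<delta> * V)))"
      by (rule mult_mono[rotated]) (use a0 in auto)
    then show ?thesis using dV by (simp add: E2_def abs_mult)
  qed
  \<comment> \<open>the exponential before the step against the one after it, in front of a reflection\<close>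
  define E3 where "E3 = (exp (-b) - exp (-a)) * P"
  have E3: "\<bar>E3\<bar> \<le> 3 * (\<delta>\<^sup>2 * (R1 * V + R2 * V))"
  proof -
    have "\<bar>exp (-b) - exp (-a)\<bar> \<le> 3 * (\<delta> * V)"
      using exp_neg_lipschitz[OF b0 a0] hb by linarith
    then have "\<bar>E3\<bar> \<le> (3 * (\<delta> * V)) * (\<delta> * (R1 + R2))"
      unfolding E3_def abs_mult using Pb d0 V by (intro mult_mono) auto
    also have "\<dots> = 3 * (\<delta> * (R1 + R2) * (\<delta> * V))" by (simp only: mult_ac)
    finally show ?thesis by (simp only: dV)
  qed
  \<comment> \<open>the upstream reflection, where the upstream supremum is at most \<open>U\<close>\<close>
  define E4 where "E4 = (s1 - s2) * \<epsilon> * (R1 * (exp (- (s2 * \<epsilon> * S2)) - exp (-b)))"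
  have E4: "\<bar>E4\<bar> \<le> \<delta>\<^sup>2 * (R1 * V)"
  proof (cases "0 < R1")
    case True
    then have S1: "S1 \<le> V" using R1(3) V by linarith
    have se: "\<bar>s1 - s2\<bar> * \<epsilon> \<le> \<delta>" using s e order_trans[OF mult_right_mono[of "\<bar>s1 - s2\<bar>" "s1 + s2" \<epsilon>] dd] by linarith
    have "b - s2 * \<epsilon> * S2 = (s1 - s2) * \<epsilon> * S1" by (simp add: b_def algebra_simps)
    then have "\<bar>exp (- (s2 * \<epsilon> * S2)) - exp (-b)\<bar> \<le> \<bar>(s1 - s2) * \<epsilon> * S1\<bar>"
      using exp_neg_lipschitz[of "s2 * \<epsilon> * S2" b] b0 s e S by (simp add: abs_minus_commute)
    also have "\<dots> = (\<bar>s1 - s2\<bar> * \<epsilon>) * S1" using e S by (simp add: abs_mult)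
    also have "\<dots> \<le> \<delta> * V" using se S S1 d0 by (intro mult_mono) auto
    finally have "(\<bar>s1 - s2\<bar> * \<epsilon>) * (R1 * \<bar>exp (- (s2 * \<epsilon> * S2)) - exp (-b)\<bar>) \<le> \<delta> * (R1 * (\<delta> * V))"
      using se R1(2) d0 e by (intro mult_mono) auto
    then show ?thesis using e R1(2) by (simp add: E4_def abs_mult power2_eq_square mult_ac)
  next
    case False
    then have "R1 = 0" using R1(2) by linarith
    then show ?thesis by (simp add: E4_def)
  qed
  \<comment> \<open>the reflection of the total content, where both suprema are at most \<open>U\<close>\<close>
  define E5 where "E5 = s2 * \<epsilon> * (R2 * (1 - exp (-b)))"
  have E5: "\<bar>E5\<bar> \<le> \<delta>\<^sup>2 * (R2 * V)"
  proof (cases "0 < R2")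
    case True
    then have S2: "S2 \<le> V" using R2(3) V by linarith
    have "b \<le> s1 * \<epsilon> * S2 + s2 * \<epsilon> * S2"
      unfolding b_def using s e S by (intro add_mono mult_left_mono) auto
    also have "\<dots> = ((s1 + s2) * \<epsilon>) * S2" by (simp add: algebra_simps)
    also have "\<dots> \<le> \<delta> * V" using dd S S2 d0 by (intro mult_mono) auto
    finally have "1 - exp (-b) \<le> \<delta> * V" using exp_ge_add_one_self[of "-b"] by linarith
    moreover have "s2 * \<epsilon> \<le> \<delta>" using s e order_trans[OF mult_right_mono[of s2 "s1 + s2" \<epsilon>] dd] by linarith
    ultimately have "(s2 * \<epsilon>) * (R2 * (1 - exp (-b))) \<le> \<delta> * (R2 * (\<delta> * V))"
      using R2(2) d0 s e b0 by (intro mult_mono) auto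
    moreover have "0 \<le> E5" using s e R2(2) b0 by (simp add: E5_def)
    ultimately show ?thesis by (simp add: E5_def power2_eq_square mult_ac)
  next
    case False
    then have "R2 = 0" using R2(2) by linarith
    then show ?thesis by (simp add: E5_def)
  qed
  have "exp (-b) - exp (-a) + exp (-a) * \<zeta> - exp (-a) * \<zeta>\<^sup>2 / 2
      + (s1 - s2) * \<epsilon> * (R1 * exp (- (s2 * \<epsilon> * S2))) + s2 * \<epsilon> * R2 = E1 + E2 + E3 + E4 + E5"
    unfolding E1_def E2_def E3_def E4_def E5_def ba unfolding P_def
    by (simp add: field_simps power2_eq_square)
  also have "\<bar>\<dots>\<bar> \<le> \<bar>E1\<bar> + \<bar>E2\<bar> + \<bar>E3\<bar> + \<bar>E4\<bar> + \<bar>E5\<bar>" by linarith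
  also have "\<dots> \<le> \<delta>\<^sup>2 * (9 * (V\<^sup>2 * min 1 (3 * \<delta> * V)) + 7 * (R1 * V + R2 * V))"
  proof -
    have "0 \<le> \<delta>\<^sup>2 * (R1 * V)" "0 \<le> \<delta>\<^sup>2 * (R2 * V)" using RV by simp_all
    then show ?thesis using E1 E2 E3 E4 E5 by (simp only: distrib_left)
  qed
  finally show ?thesis by (simp add: \<delta>_def power_mult_distrib mult.assoc)
qed

section \<open>Heavy traffic\<close>

locale tandem_heavy_traffic = square_integrable_levy +
  fixes \<gamma> \<sigma> :: real
  assumes gamma: "1 < \<gamma>" and sigma: "0 < \<sigma>"
    and variance_J: "variance (J 1) = \<sigma>\<^sup>2"
begin

lemma second_moment: "second_moment = \<sigma>\<^sup>2"
  using variance_J by (simp add: mean_def)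

text \<open>The summand \<open>\<gamma>\<close> dominates the drift for all scaling parameters that are at most 1.\<close>

definition envelope :: "'a \<Rightarrow> real" where
  "envelope \<omega> = 2 * unit_fluctuation \<omega> + \<gamma>"

text \<open>The amount by which the reflection at 0 lifts the free displacement in one step; the discrete analogue of idle time.\<close>

definition slack :: "real \<Rightarrow> 'a \<Rightarrow> real" where
  "slack c \<omega> = workload_sup (mean + c) \<omega> - (J 1 \<omega> - mean - c + shifted_sup (mean + c) \<omega>)"

lemma envelope_meas [measurable]: "envelope \<in> borel_measurable M"
  unfolding envelope_def[abs_def] by measurable

lemma slack_meas [measurable]: "slack c \<in> borel_measurable M"
  unfolding slack_def[abs_def] by measurable

lemma unit_fluctuation_nonneg: "\<omega> \<in> space M \<Longrightarrow> 0 \<le> unit_fluctuation \<omega>"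
  using unit_fluctuation_ge[of \<omega> 0] by simp

lemma envelope_ge: "\<omega> \<in> space M \<Longrightarrow> 1 \<le> envelope \<omega>"
  using unit_fluctuation_nonneg[of \<omega>] gamma by (simp add: envelope_def)

lemma envelope_square_integrable: "integrable M (\<lambda>\<omega>. (envelope \<omega>)\<^sup>2)"
proof -
  have "integrable M (\<lambda>\<omega>. (2 * unit_fluctuation \<omega>)\<^sup>2)"
    using unit_fluctuation_square_integrable by (simp add: power_mult_distrib)
  then show ?thesis unfolding envelope_def by (intro integrable_square_add) auto
qed

lemma abs_J_le: "\<omega> \<in> space M \<Longrightarrow> \<bar>J 1 \<omega> - mean\<bar> \<le> unit_fluctuation \<omega>"
  using unit_fluctuation_ge[of \<omega> 1] by (simp add: net_input_def)

lemma slack_AE: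
  assumes c: "0 < c" "c \<le> \<gamma>"
  shows "AE \<omega> in M. 0 \<le> slack c \<omega> \<and> (0 < slack c \<omega> \<longrightarrow> workload_sup (mean + c) \<omega> \<le> unit_fluctuation \<omega>)
      \<and> slack c \<omega> \<le> envelope \<omega>"
  using lindley[OF c(1)] AE_space
proof eventually_elim
  case (elim \<omega>)
  have 1: "0 \<le> slack c \<omega>" using elim by (simp add: slack_def)
  have 2: "workload_sup (mean + c) \<omega> \<le> unit_fluctuation \<omega>" if "0 < slack c \<omega>"
    using elim that by (simp add: slack_def max_def split: if_splits)
  have "slack c \<omega> \<le> envelope \<omega>"
  proof (cases "0 < slack c \<omega>")
    case True
    then show ?thesis
      using 2 abs_J_le[OF elim(2)] workload_sup_nonneg(2)[of "mean + c" \<omega>] c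
      unfolding envelope_def slack_def by linarith
  qed (use envelope_ge[OF elim(2)] in linarith)
  with 1 2 show ?case by blast
qed

lemma slack_integrable: "0 < c \<Longrightarrow> integrable M (slack c)"
  unfolding slack_def[abs_def] using workload_sup_integrable(1,2)[of c] J_integrable by simp

text \<open>In the stationary regime reflection exactly compensates the drift, as the original and the restarted supremum have the same
  finite expectation.\<close>

lemma slack_expectation:
  assumes "0 < c" shows "expectation (slack c) = c"
  unfolding slack_def[abs_def]
  using workload_sup_integrable[OF assms] J_integrable
  by (simp add: prob_space flip: mean_def)

lemma slack_envelope_integrable:
  assumes c: "0 < c" "c \<le> \<gamma>"
  shows "integrable M (\<lambda>\<omega>. slack c \<omega> * envelope \<omega>)"
proof (rule Bochner_Integration.integrable_bound[OF envelope_square_integrable])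
  show "AE \<omega> in M. norm (slack c \<omega> * envelope \<omega>) \<le> norm ((envelope \<omega>)\<^sup>2)"
    using slack_AE[OF c] AE_space
  proof eventually_elim
    case (elim \<omega>)
    then show ?case using envelope_ge[OF elim(2)]
      by (auto simp: abs_mult power2_eq_square intro!: mult_mono)
  qed
qed measurable

text \<open>The slack has vanishing expectation and is dominated by the square integrable envelope. Cutting the envelope at a level
  \<open>K\<close> bounds the product by \<open>K\<close> times the slack plus the tail of the squared envelope; with \<open>K = 1 / sqrt c\<close> both parts
  tend to zero.\<close>

lemma slack_envelope_tendsto:
  "((\<lambda>c. expectation (\<lambda>\<omega>. slack c \<omega> * envelope \<omega>)) \<longlongrightarrow> 0) (at_right 0)"
proof (rule tendsto_sandwich[OF _ _ tendsto_const])
  define tail where "tail K = expectation (\<lambda>\<omega>. (envelope \<omega>)\<^sup>2 * indicator {\<omega>. K < envelope \<omega>} \<omega>)" for K :: real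
  have tail: "(tail \<longlongrightarrow> 0) at_top"
  proof -
    have "((\<lambda>K. expectation (\<lambda>\<omega>. (envelope \<omega>)\<^sup>2 * indicator {\<omega>. K < envelope \<omega>} \<omega>)) \<longlongrightarrow> expectation (\<lambda>\<omega>. 0)) at_top"
    proof (rule integral_dominated_convergence_at_top[OF _ _ envelope_square_integrable])
      show "\<forall>\<^sub>F K in at_top. AE \<omega> in M. norm ((envelope \<omega>)\<^sup>2 * indicator {\<omega>. K < envelope \<omega>} \<omega>) \<le> (envelope \<omega>)\<^sup>2"
        by (auto simp: indicator_def)
      show "AE \<omega> in M. ((\<lambda>K. (envelope \<omega>)\<^sup>2 * indicator {\<omega>. K < envelope \<omega>} \<omega>) \<longlongrightarrow> 0) at_top"
      proof (rule AE_I2)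
        fix \<omega>
        have "\<forall>\<^sub>F K in at_top. (envelope \<omega>)\<^sup>2 * indicator {\<omega>. K < envelope \<omega>} \<omega> = 0"
          using eventually_ge_at_top[of "envelope \<omega>"] by eventually_elim (auto simp: indicator_def)
        then show "((\<lambda>K. (envelope \<omega>)\<^sup>2 * indicator {\<omega>. K < envelope \<omega>} \<omega>) \<longlongrightarrow> 0) at_top"
          by (rule tendsto_eventually)
      qed
    qed measurable
    then show ?thesis by (simp add: tail_def[abs_def])
  qed
  have sq: "filterlim (\<lambda>c::real. 1 / sqrt c) at_top (at_right 0)" by real_asymp
  show "((\<lambda>c. sqrt c + tail (1 / sqrt c)) \<longlongrightarrow> 0) (at_right 0)"
  proof -
    have "((\<lambda>c::real. sqrt c) \<longlongrightarrow> 0) (at_right 0)" by real_asymp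
    from tendsto_add[OF this filterlim_compose[OF tail sq]] show ?thesis by simp
  qed
  have ev: "\<forall>\<^sub>F c in at_right (0::real). 0 < c \<and> c < \<gamma>"
    using gamma by (auto simp: eventually_at_right_field intro!: exI[of _ \<gamma>])
  show "\<forall>\<^sub>F c in at_right 0. 0 \<le> expectation (\<lambda>\<omega>. slack c \<omega> * envelope \<omega>)"
    using ev
  proof eventually_elim
    case (elim c)
    then have c: "0 < c" "c \<le> \<gamma>" by auto
    show ?case
    proof (rule integral_nonneg_AE)
      show "AE \<omega> in M. 0 \<le> slack c \<omega> * envelope \<omega>"
        using slack_AE[OF c] AE_space
        by eventually_elim (use envelope_ge in \<open>fastforce intro!: mult_nonneg_nonneg\<close>)
    qed
  qed
  show "\<forall>\<^sub>F c in at_right 0. expectation (\<lambda>\<omega>. slack c \<omega> * envelope \<omega>) \<le> sqrt c + tail (1 / sqrt c)"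
    using ev
  proof eventually_elim
    case (elim c)
    then have c: "0 < c" "c \<le> \<gamma>" by auto
    have it: "integrable M (\<lambda>\<omega>. (envelope \<omega>)\<^sup>2 * indicator {\<omega>. K < envelope \<omega>} \<omega>)" for K :: real
    proof (rule Bochner_Integration.integrable_bound[OF envelope_square_integrable])
      show "AE \<omega> in M. norm ((envelope \<omega>)\<^sup>2 * indicator {\<omega>. K < envelope \<omega>} \<omega>) \<le> norm ((envelope \<omega>)\<^sup>2)"
        by (auto simp: indicator_def)
    qed measurable
    have "expectation (\<lambda>\<omega>. slack c \<omega> * envelope \<omega>)
        \<le> expectation (\<lambda>\<omega>. slack c \<omega> * (1 / sqrt c) + (envelope \<omega>)\<^sup>2 * indicator {\<omega>. 1 / sqrt c < envelope \<omega>} \<omega>)"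
    proof (rule integral_mono_AE)
      show "integrable M (\<lambda>\<omega>. slack c \<omega> * envelope \<omega>)" by (rule slack_envelope_integrable[OF c])
      show "integrable M (\<lambda>\<omega>. slack c \<omega> * (1 / sqrt c) + (envelope \<omega>)\<^sup>2 * indicator {\<omega>. 1 / sqrt c < envelope \<omega>} \<omega>)"
        by (intro Bochner_Integration.integrable_add it integrable_mult_left slack_integrable c)
      show "AE \<omega> in M. slack c \<omega> * envelope \<omega>
          \<le> slack c \<omega> * (1 / sqrt c) + (envelope \<omega>)\<^sup>2 * indicator {\<omega>. 1 / sqrt c < envelope \<omega>} \<omega>"
        using slack_AE[OF c] AE_space
      proof eventually_elim
        case (elim \<omega>)
        have V: "1 \<le> envelope \<omega>" by (rule envelope_ge[OF elim(2)])
        show ?case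
        proof (cases "1 / sqrt c < envelope \<omega>")
          case True
          have "slack c \<omega> * envelope \<omega> \<le> (envelope \<omega>)\<^sup>2"
            using elim V unfolding power2_eq_square by (intro mult_right_mono) auto
          moreover have "0 \<le> slack c \<omega> * (1 / sqrt c)" using elim c by simp
          ultimately show ?thesis using True by (simp add: indicator_def)
        next
          case False
          then have "slack c \<omega> * envelope \<omega> \<le> slack c \<omega> * (1 / sqrt c)"
            using elim by (intro mult_left_mono) auto
          then show ?thesis using False by (simp add: indicator_def)
        qed
      qed
    qed
    also have "\<dots> = expectation (slack c) * (1 / sqrt c) + tail (1 / sqrt c)"
      unfolding tail_def using it slack_integrable[OF c(1)] by (subst Bochner_Integration.integral_add) auto
    also have "expectation (slack c) * (1 / sqrt c) = sqrt c"
      using c by (simp add: slack_expectation real_div_sqrt)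
    finally show ?case .
  qed
qed

lemma envelope_min_tendsto:
  assumes K: "0 < K"
  shows "((\<lambda>\<epsilon>. expectation (\<lambda>\<omega>. (envelope \<omega>)\<^sup>2 * min 1 (K * \<epsilon> * envelope \<omega>))) \<longlongrightarrow> 0) (at_right 0)"
proof -
  have "((\<lambda>x. expectation (\<lambda>\<omega>. (envelope \<omega>)\<^sup>2 * min 1 (K * inverse x * envelope \<omega>))) \<longlongrightarrow> expectation (\<lambda>\<omega>. 0)) at_top"
  proof (rule integral_dominated_convergence_at_top[OF _ _ envelope_square_integrable])
    show "\<forall>\<^sub>F x in at_top. AE \<omega> in M. norm ((envelope \<omega>)\<^sup>2 * min 1 (K * inverse x * envelope \<omega>)) \<le> (envelope \<omega>)\<^sup>2"
      using eventually_gt_at_top[of "0::real"]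
    proof eventually_elim
      case (elim x)
      show ?case
      proof (rule AE_I2)
        fix \<omega> assume "\<omega> \<in> space M"
        from envelope_ge[OF this] have "0 \<le> K * inverse x * envelope \<omega>" using K elim by simp
        then have "\<bar>min 1 (K * inverse x * envelope \<omega>)\<bar> \<le> 1" by (simp add: min_def)
        then have "(envelope \<omega>)\<^sup>2 * \<bar>min 1 (K * inverse x * envelope \<omega>)\<bar> \<le> (envelope \<omega>)\<^sup>2 * 1"
          by (rule mult_left_mono) simp
        then show "norm ((envelope \<omega>)\<^sup>2 * min 1 (K * inverse x * envelope \<omega>)) \<le> (envelope \<omega>)\<^sup>2"
          by (simp add: abs_mult)
      qed
    qed
    show "AE \<omega> in M. ((\<lambda>x. (envelope \<omega>)\<^sup>2 * min 1 (K * inverse x * envelope \<omega>)) \<longlongrightarrow> 0) at_top"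
    proof (rule AE_I2)
      fix \<omega>
      have "((\<lambda>x. (envelope \<omega>)\<^sup>2 * min 1 (K * inverse x * envelope \<omega>)) \<longlongrightarrow> (envelope \<omega>)\<^sup>2 * min 1 (K * 0 * envelope \<omega>)) at_top"
        by (intro tendsto_intros tendsto_min tendsto_inverse_0_at_top filterlim_ident)
      then show "((\<lambda>x. (envelope \<omega>)\<^sup>2 * min 1 (K * inverse x * envelope \<omega>)) \<longlongrightarrow> 0) at_top" by simp
    qed
  qed measurable
  then show ?thesis unfolding filterlim_at_right_to_top by simp
qed

abbreviation exponent :: "(real \<Rightarrow> 'a \<Rightarrow> real) \<Rightarrow> real \<Rightarrow> real \<Rightarrow> real \<Rightarrow> 'a \<Rightarrow> real" where
  "exponent X s1 s2 \<epsilon> \<omega> \<equiv> s1 * \<epsilon> * X (mean + \<gamma> * \<epsilon>) \<omega>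
     + s2 * \<epsilon> * (X (mean + \<epsilon>) \<omega> - X (mean + \<gamma> * \<epsilon>) \<omega>)"

text \<open>The joint Laplace transform of the upstream and downstream contents, both scaled by \<open>\<epsilon>\<close>.\<close>

definition scaled_transform :: "real \<Rightarrow> real \<Rightarrow> real \<Rightarrow> real" where
  "scaled_transform s1 s2 \<epsilon> = expectation (\<lambda>\<omega>. exp (- (exponent workload_sup s1 s2 \<epsilon> \<omega>)))"

text \<open>The transform of the total content weighted by the idling of the upstream server: the one unknown function in the balance
  equation, which depends on the second argument of the transform alone.\<close>

definition idle_transform :: "real \<Rightarrow> real \<Rightarrow> real" where
  "idle_transform s2 \<epsilon> = expectation (\<lambda>\<omega>. slack (\<gamma> * \<epsilon>) \<omega> * exp (- (s2 * \<epsilon> * workload_sup (mean + \<epsilon>) \<omega>))) / \<epsilon>"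

text \<open>The coefficient of \<open>\<epsilon>\<^sup>2\<close> in the formal expansion of \<open>E (exp (- \<zeta>))\<close>, where \<open>\<zeta>\<close> is the free displacement of the exponent in one unit of
  time.\<close>

definition kernel :: "real \<Rightarrow> real \<Rightarrow> real" where
  "kernel s1 s2 = \<gamma> * s1 + s1\<^sup>2 * \<sigma>\<^sup>2 / 2 - (\<gamma> - 1) * s2"

text \<open>The exponent is nonnegative almost everywhere, so cutting it off at 0 yields a bounded continuous function of the pair of
  suprema without changing the expectations.\<close>

lemma shifted_transform_product:
  assumes s: "0 \<le> s1" "0 \<le> s2" and e: "0 < \<epsilon>"
    and g: "g \<in> borel_measurable borel" and ig: "integrable M (\<lambda>\<omega>. g (J 1 \<omega>))"
  shows "integrable M (\<lambda>\<omega>. g (J 1 \<omega>) * exp (- (exponent shifted_sup s1 s2 \<epsilon> \<omega>)))" (is "integrable M ?f")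
    and "expectation (\<lambda>\<omega>. g (J 1 \<omega>) * exp (- (exponent shifted_sup s1 s2 \<epsilon> \<omega>)))
     = expectation (\<lambda>\<omega>. g (J 1 \<omega>)) * scaled_transform s1 s2 \<epsilon>"
proof -
  define h where "h = (\<lambda>(x, y). exp (- max 0 (s1 * \<epsilon> * x + s2 * \<epsilon> * (y - x))))"
  have c: "0 < \<gamma> * \<epsilon>" "\<epsilon> \<le> \<gamma> * \<epsilon>" using e gamma by auto
  have h: "continuous_on UNIV h" "bounded (range h)"
  proof -
    show "continuous_on UNIV h" unfolding h_def case_prod_unfold by (intro continuous_intros)
    show "bounded (range h)" unfolding bounded_iff h_def by (auto intro!: exI[of _ 1])
  qed
  have [measurable]: "h \<in> borel_measurable borel" by (rule borel_measurable_continuous_onI[OF h(1)])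
  note [measurable] = g
  have eqT: "AE \<omega> in M. h (shifted_sup (mean + \<gamma> * \<epsilon>) \<omega>, shifted_sup (mean + \<epsilon>) \<omega>)
      = exp (- (exponent shifted_sup s1 s2 \<epsilon> \<omega>))"
    using AE_antimono(2)[OF e c(2)]
    by eventually_elim (use s e workload_sup_nonneg(2) in \<open>auto simp: h_def intro!: max_absorb2 add_nonneg_nonneg mult_nonneg_nonneg\<close>)
  have eqS: "AE \<omega> in M. h (workload_sup (mean + \<gamma> * \<epsilon>) \<omega>, workload_sup (mean + \<epsilon>) \<omega>)
      = exp (- (exponent workload_sup s1 s2 \<epsilon> \<omega>))"
    using AE_antimono(1)[OF e c(2)]
    by eventually_elim (use s e workload_sup_nonneg(1) in \<open>auto simp: h_def intro!: max_absorb2 add_nonneg_nonneg mult_nonneg_nonneg\<close>)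
  have A: "AE \<omega> in M. g (J 1 \<omega>) * h (shifted_sup (mean + \<gamma> * \<epsilon>) \<omega>, shifted_sup (mean + \<epsilon>) \<omega>) = ?f \<omega>"
    using eqT by eventually_elim simp
  have "integrable M (\<lambda>\<omega>. g (J 1 \<omega>) * h (shifted_sup (mean + \<gamma> * \<epsilon>) \<omega>, shifted_sup (mean + \<epsilon>) \<omega>))"
  proof (rule Bochner_Integration.integrable_bound[OF ig])
    have "\<bar>h p\<bar> \<le> 1" for p by (auto simp: h_def split: prod.split)
    then show "AE \<omega> in M. norm (g (J 1 \<omega>) * h (shifted_sup (mean + \<gamma> * \<epsilon>) \<omega>, shifted_sup (mean + \<epsilon>) \<omega>)) \<le> norm (g (J 1 \<omega>))"
      by (auto simp: abs_mult mult_left_le)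
  qed measurable
  then show "integrable M ?f" using A by (subst (asm) integrable_cong_AE) auto
  have "expectation ?f = expectation (\<lambda>\<omega>. g (J 1 \<omega>) * h (shifted_sup (mean + \<gamma> * \<epsilon>) \<omega>, shifted_sup (mean + \<epsilon>) \<omega>))"
    using A by (intro integral_cong_AE) auto
  also have "\<dots> = expectation (\<lambda>\<omega>. g (J 1 \<omega>)) * expectation (\<lambda>\<omega>. h (workload_sup (mean + \<gamma> * \<epsilon>) \<omega>, workload_sup (mean + \<epsilon>) \<omega>))"
    by (rule shifted_sup_product[OF c(1) e g ig h])
  also have "expectation (\<lambda>\<omega>. h (workload_sup (mean + \<gamma> * \<epsilon>) \<omega>, workload_sup (mean + \<epsilon>) \<omega>)) = scaled_transform s1 s2 \<epsilon>"
    unfolding scaled_transform_def using eqS by (intro integral_cong_AE) auto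
  finally show "expectation ?f = expectation (\<lambda>\<omega>. g (J 1 \<omega>)) * scaled_transform s1 s2 \<epsilon>" .
qed

lemma AE_exponent_nonneg:
  assumes "0 \<le> s1" "0 \<le> s2" "0 < \<epsilon>"
  shows "AE \<omega> in M. 0 \<le> exponent workload_sup s1 s2 \<epsilon> \<omega>"
proof -
  have c: "\<epsilon> \<le> \<gamma> * \<epsilon>" using assms gamma by auto
  show ?thesis
    using AE_antimono(1)[OF assms(3) c]
    by eventually_elim (use assms workload_sup_nonneg(1) in \<open>auto intro!: add_nonneg_nonneg mult_nonneg_nonneg\<close>)
qed

lemma transform_integrable:
  assumes "0 \<le> s1" "0 \<le> s2" "0 < \<epsilon>"
  shows "integrable M (\<lambda>\<omega>. exp (- (exponent workload_sup s1 s2 \<epsilon> \<omega>)))"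
proof (rule integrable_const_bound[of _ 1])
  show "AE \<omega> in M. norm (exp (- (exponent workload_sup s1 s2 \<epsilon> \<omega>))) \<le> 1"
    using AE_exponent_nonneg[OF assms] by eventually_elim simp
qed measurable

lemma scaled_transform_bounds:
  assumes "0 \<le> s1" "0 \<le> s2" "0 < \<epsilon>"
  shows "0 \<le> scaled_transform s1 s2 \<epsilon>" "scaled_transform s1 s2 \<epsilon> \<le> 1"
proof -
  show "0 \<le> scaled_transform s1 s2 \<epsilon>" unfolding scaled_transform_def by (rule integral_nonneg_AE) simp
  have "scaled_transform s1 s2 \<epsilon> \<le> expectation (\<lambda>\<omega>. 1)"
    unfolding scaled_transform_def
  proof (rule integral_mono_AE[OF transform_integrable[OF assms]])
    show "AE \<omega> in M. exp (- (exponent workload_sup s1 s2 \<epsilon> \<omega>)) \<le> 1"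
      using AE_exponent_nonneg[OF assms] by eventually_elim simp
  qed simp
  then show "scaled_transform s1 s2 \<epsilon> \<le> 1" by (simp add: prob_space)
qed

lemma scaled_transform_antimono:
  assumes "0 \<le> s1" "s1 \<le> s1'" "0 \<le> s2" "0 < \<epsilon>"
  shows "scaled_transform s1' s2 \<epsilon> \<le> scaled_transform s1 s2 \<epsilon>"
  unfolding scaled_transform_def
  using assms by (intro integral_mono_AE transform_integrable AE_I2)
    (auto intro!: mult_right_mono workload_sup_nonneg)

text \<open>Taking expectations in the one-step expansion. The transforms before and after the step agree by stationarity and cancel.
  What remains is of order \<open>\<epsilon>\<^sup>2\<close>: the first two moments of the displacement give the kernel, and the two reflections give the
  weighted idle transform and, since \<open>slack \<epsilon>\<close> has expectation \<open>\<epsilon>\<close>, the constant \<open>s2\<close>.\<close>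

lemma balance_error:
  assumes s: "0 \<le> s1" "0 \<le> s2" and e: "0 < \<epsilon>" "\<epsilon> \<le> 1"
  defines "D \<equiv> \<gamma> * (s1 + s2 + 1)" and "\<kappa> \<equiv> \<gamma> * s1 - (\<gamma> - 1) * s2"
  shows "\<bar>scaled_transform s1 s2 \<epsilon> * kernel s1 s2 - (s1 - s2) * idle_transform s2 \<epsilon> - s2\<bar>
    \<le> D\<^sup>2 * (9 * expectation (\<lambda>\<omega>. (envelope \<omega>)\<^sup>2 * min 1 (3 * D * \<epsilon> * envelope \<omega>))
        + 7 * (expectation (\<lambda>\<omega>. slack (\<gamma> * \<epsilon>) \<omega> * envelope \<omega>) + expectation (\<lambda>\<omega>. slack \<epsilon> \<omega> * envelope \<omega>)))
      + \<epsilon>\<^sup>2 * \<kappa>\<^sup>2 / 2"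
proof -
  have c1: "0 < \<gamma> * \<epsilon>" "\<gamma> * \<epsilon> \<le> \<gamma>" and c2: "0 < \<epsilon>" "\<epsilon> \<le> \<gamma>" and c12: "\<epsilon> \<le> \<gamma> * \<epsilon>"
    using e gamma by auto
  have D0: "0 < D" using s gamma by (simp add: D_def)
  define S1 S2 T1 T2 where "S1 = workload_sup (mean + \<gamma> * \<epsilon>)" and "S2 = workload_sup (mean + \<epsilon>)"
    and "T1 = shifted_sup (mean + \<gamma> * \<epsilon>)" and "T2 = shifted_sup (mean + \<epsilon>)"
  define R1 R2 where "R1 = slack (\<gamma> * \<epsilon>)" and "R2 = slack \<epsilon>"
  have meas [measurable]: "S1 \<in> borel_measurable M" "S2 \<in> borel_measurable M" "T1 \<in> borel_measurable M"
    "T2 \<in> borel_measurable M" "R1 \<in> borel_measurable M" "R2 \<in> borel_measurable M"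
    unfolding S1_def S2_def T1_def T2_def R1_def R2_def by measurable
  define ea eb where "ea \<omega> = exp (- (s1 * \<epsilon> * T1 \<omega> + s2 * \<epsilon> * (T2 \<omega> - T1 \<omega>)))"
    and "eb \<omega> = exp (- (s1 * \<epsilon> * S1 \<omega> + s2 * \<epsilon> * (S2 \<omega> - S1 \<omega>)))" for \<omega>
  define \<zeta> where "\<zeta> \<omega> = s1 * \<epsilon> * (J 1 \<omega> - mean) - \<epsilon>\<^sup>2 * \<kappa>" for \<omega>
  define I where "I \<omega> = R1 \<omega> * exp (- (s2 * \<epsilon> * S2 \<omega>))" for \<omega>
  define err where "err \<omega> = eb \<omega> - ea \<omega> + ea \<omega> * \<zeta> \<omega> - ea \<omega> * (\<zeta> \<omega>)\<^sup>2 / 2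
      + (s1 - s2) * \<epsilon> * I \<omega> + s2 * \<epsilon> * R2 \<omega>" for \<omega>
  define A where "A = scaled_transform s1 s2 \<epsilon>"
  have zeta1: "integrable M \<zeta>" "expectation \<zeta> = - (\<epsilon>\<^sup>2 * \<kappa>)"
    unfolding \<zeta>_def[abs_def] using J_integrable by (simp_all add: prob_space flip: mean_def)
  have zsq: "(\<zeta> \<omega>)\<^sup>2 = (s1 * \<epsilon>)\<^sup>2 * (J 1 \<omega> - mean)\<^sup>2 - 2 * s1 * \<epsilon> * (\<epsilon>\<^sup>2 * \<kappa>) * (J 1 \<omega> - mean) + (\<epsilon>\<^sup>2 * \<kappa>)\<^sup>2" for \<omega>
    unfolding \<zeta>_def by (simp add: power2_eq_square algebra_simps)
  have zeta2: "integrable M (\<lambda>\<omega>. (\<zeta> \<omega>)\<^sup>2)" "expectation (\<lambda>\<omega>. (\<zeta> \<omega>)\<^sup>2) = (s1 * \<epsilon>)\<^sup>2 * \<sigma>\<^sup>2 + (\<epsilon>\<^sup>2 * \<kappa>)\<^sup>2"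
  proof -
    have i: "integrable M (\<lambda>\<omega>. (s1 * \<epsilon>)\<^sup>2 * (J 1 \<omega> - mean)\<^sup>2)"
       "integrable M (\<lambda>\<omega>. 2 * s1 * \<epsilon> * (\<epsilon>\<^sup>2 * \<kappa>) * (J 1 \<omega> - mean))"
      by (intro integrable_mult_right expectation_centered)+
    show "integrable M (\<lambda>\<omega>. (\<zeta> \<omega>)\<^sup>2)"
      unfolding zsq by (intro Bochner_Integration.integrable_add Bochner_Integration.integrable_diff i integrable_const)
    have "expectation (\<lambda>\<omega>. (\<zeta> \<omega>)\<^sup>2) = expectation (\<lambda>\<omega>. (s1 * \<epsilon>)\<^sup>2 * (J 1 \<omega> - mean)\<^sup>2)
        - expectation (\<lambda>\<omega>. 2 * s1 * \<epsilon> * (\<epsilon>\<^sup>2 * \<kappa>) * (J 1 \<omega> - mean)) + (\<epsilon>\<^sup>2 * \<kappa>)\<^sup>2"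
      unfolding zsq
      by (subst Bochner_Integration.integral_add[OF Bochner_Integration.integrable_diff[OF i] integrable_const],
          subst Bochner_Integration.integral_diff[OF i]) (simp add: prob_space)
    also have "\<dots> = (s1 * \<epsilon>)\<^sup>2 * \<sigma>\<^sup>2 + (\<epsilon>\<^sup>2 * \<kappa>)\<^sup>2"
      by (simp only: integral_mult_right_zero second_moment expectation_centered(2))
    finally show "expectation (\<lambda>\<omega>. (\<zeta> \<omega>)\<^sup>2) = (s1 * \<epsilon>)\<^sup>2 * \<sigma>\<^sup>2 + (\<epsilon>\<^sup>2 * \<kappa>)\<^sup>2" .
  qed
  have post: "integrable M (\<lambda>\<omega>. g (J 1 \<omega>) * ea \<omega>)"
      "expectation (\<lambda>\<omega>. g (J 1 \<omega>) * ea \<omega>) = expectation (\<lambda>\<omega>. g (J 1 \<omega>)) * A"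
    if "g \<in> borel_measurable borel" "integrable M (\<lambda>\<omega>. g (J 1 \<omega>))" for g
    unfolding ea_def T1_def T2_def A_def by (rule shifted_transform_product[OF s e(1) that])+
  have one: "expectation (\<lambda>_. 1 :: real) = 1" by (simp add: prob_space)
  have iea: "integrable M ea" "expectation ea = A"
    using post[OF borel_measurable_const[of "1::real"] integrable_const]
    by (simp_all only: mult_1 one)
  have ieb: "integrable M eb" "expectation eb = A"
    using transform_integrable[OF s e(1)] by (simp_all add: eb_def[abs_def] S1_def S2_def A_def scaled_transform_def)
  have iz: "integrable M (\<lambda>\<omega>. ea \<omega> * \<zeta> \<omega>)" "expectation (\<lambda>\<omega>. ea \<omega> * \<zeta> \<omega>) = - (\<epsilon>\<^sup>2 * \<kappa>) * A"
  proof -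
    have "(\<lambda>x. s1 * \<epsilon> * (x - mean) - \<epsilon>\<^sup>2 * \<kappa>) \<in> borel_measurable borel" by measurable
    note * = post[OF this zeta1(1)[unfolded \<zeta>_def[abs_def]], folded \<zeta>_def]
    show "integrable M (\<lambda>\<omega>. ea \<omega> * \<zeta> \<omega>)" using *(1) by (simp only: mult.commute)
    show "expectation (\<lambda>\<omega>. ea \<omega> * \<zeta> \<omega>) = - (\<epsilon>\<^sup>2 * \<kappa>) * A"
      using *(2) zeta1(2) by (simp only: mult.commute)
  qed
  have iz2: "integrable M (\<lambda>\<omega>. ea \<omega> * (\<zeta> \<omega>)\<^sup>2)"
      "expectation (\<lambda>\<omega>. ea \<omega> * (\<zeta> \<omega>)\<^sup>2) = ((s1 * \<epsilon>)\<^sup>2 * \<sigma>\<^sup>2 + (\<epsilon>\<^sup>2 * \<kappa>)\<^sup>2) * A"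
  proof -
    have "(\<lambda>x. (s1 * \<epsilon> * (x - mean) - \<epsilon>\<^sup>2 * \<kappa>)\<^sup>2) \<in> borel_measurable borel" by measurable
    note * = post[OF this zeta2(1)[unfolded \<zeta>_def], folded \<zeta>_def]
    show "integrable M (\<lambda>\<omega>. ea \<omega> * (\<zeta> \<omega>)\<^sup>2)" using *(1) by (simp only: mult.commute)
    show "expectation (\<lambda>\<omega>. ea \<omega> * (\<zeta> \<omega>)\<^sup>2) = ((s1 * \<epsilon>)\<^sup>2 * \<sigma>\<^sup>2 + (\<epsilon>\<^sup>2 * \<kappa>)\<^sup>2) * A"
      using *(2) by (simp only: zeta2(2) mult.commute[of "ea _"])
  qed
  have iR: "integrable M R1" "integrable M R2" "expectation R2 = \<epsilon>"
    unfolding R1_def R2_def using slack_integrable[OF c1(1)] slack_integrable[OF c2(1)] slack_expectation[OF c2(1)] by auto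
  have iI: "integrable M I"
  proof (rule Bochner_Integration.integrable_bound[OF iR(1)])
    have "exp (- (s2 * \<epsilon> * S2 \<omega>)) \<le> 1" for \<omega>
      using s e workload_sup_nonneg(1)[of "mean + \<epsilon>" \<omega>] by (simp add: S2_def)
    then show "AE \<omega> in M. norm (I \<omega>) \<le> norm (R1 \<omega>)" by (auto simp: I_def abs_mult mult_left_le)
  qed (unfold I_def[abs_def], measurable)
  have eI: "expectation I = \<epsilon> * idle_transform s2 \<epsilon>"
    using e by (simp add: idle_transform_def I_def[abs_def] R1_def S2_def)
  have ierr: "integrable M err"
    unfolding err_def[abs_def]
    by (intro Bochner_Integration.integrable_add Bochner_Integration.integrable_diff integrable_mult_right integrable_divide iea ieb iz iz2 iI iR)
  have eerr: "expectation err = - (\<epsilon>\<^sup>2 * (A * (kernel s1 s2 + \<epsilon>\<^sup>2 * \<kappa>\<^sup>2 / 2) - (s1 - s2) * idle_transform s2 \<epsilon> - s2))"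
  proof -
    have "expectation err = A - A + - (\<epsilon>\<^sup>2 * \<kappa>) * A - ((s1 * \<epsilon>)\<^sup>2 * \<sigma>\<^sup>2 + (\<epsilon>\<^sup>2 * \<kappa>)\<^sup>2) * A / 2
        + (s1 - s2) * \<epsilon> * (\<epsilon> * idle_transform s2 \<epsilon>) + s2 * \<epsilon> * \<epsilon>"
      unfolding err_def[abs_def] using iea ieb iz iz2 iI iR eI
      by simp
    then show ?thesis
      by (simp add: kernel_def \<kappa>_def[symmetric] power2_eq_square field_simps) (simp add: \<kappa>_def algebra_simps)
  qed
  define bound where "bound \<omega> = \<epsilon>\<^sup>2 * D\<^sup>2 * (9 * ((envelope \<omega>)\<^sup>2 * min 1 (3 * D * \<epsilon> * envelope \<omega>))
      + 7 * (R1 \<omega> * envelope \<omega> + R2 \<omega> * envelope \<omega>))" for \<omega>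
  have iV: "integrable M (\<lambda>\<omega>. (envelope \<omega>)\<^sup>2 * min 1 (3 * D * \<epsilon> * envelope \<omega>))"
  proof (rule Bochner_Integration.integrable_bound[OF envelope_square_integrable])
    show "AE \<omega> in M. norm ((envelope \<omega>)\<^sup>2 * min 1 (3 * D * \<epsilon> * envelope \<omega>)) \<le> norm ((envelope \<omega>)\<^sup>2)"
    proof (rule AE_I2)
      fix \<omega> assume "\<omega> \<in> space M"
      from envelope_ge[OF this] have "0 \<le> 3 * D * \<epsilon> * envelope \<omega>" using D0 e by simp
      then have "\<bar>min 1 (3 * D * \<epsilon> * envelope \<omega>)\<bar> \<le> 1" by (simp add: min_def)
      then have "(envelope \<omega>)\<^sup>2 * \<bar>min 1 (3 * D * \<epsilon> * envelope \<omega>)\<bar> \<le> (envelope \<omega>)\<^sup>2 * 1"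
        by (rule mult_left_mono) simp
      then show "norm ((envelope \<omega>)\<^sup>2 * min 1 (3 * D * \<epsilon> * envelope \<omega>)) \<le> norm ((envelope \<omega>)\<^sup>2)"
        by (simp add: abs_mult)
    qed
  qed measurable
  have iRV: "integrable M (\<lambda>\<omega>. R1 \<omega> * envelope \<omega>)" "integrable M (\<lambda>\<omega>. R2 \<omega> * envelope \<omega>)"
    unfolding R1_def R2_def by (rule slack_envelope_integrable[OF c1] slack_envelope_integrable[OF c2])+
  have ibound: "integrable M bound"
    unfolding bound_def[abs_def] using iV iRV by simp
  have le: "AE \<omega> in M. \<bar>err \<omega>\<bar> \<le> bound \<omega>"
    using slack_AE[OF c1] slack_AE[OF c2] AE_antimono(1)[OF c2(1) c12] AE_antimono(2)[OF c2(1) c12] AE_space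
  proof eventually_elim
    case (elim \<omega>)
    have "\<bar>err \<omega>\<bar> \<le> \<epsilon>\<^sup>2 * (\<gamma> * (s1 + s2 + 1))\<^sup>2 * (9 * ((2 * unit_fluctuation \<omega> + \<gamma>)\<^sup>2
         * min 1 (3 * \<epsilon> * (\<gamma> * (s1 + s2 + 1)) * (2 * unit_fluctuation \<omega> + \<gamma>)))
      + 7 * (R1 \<omega> * (2 * unit_fluctuation \<omega> + \<gamma>) + R2 \<omega> * (2 * unit_fluctuation \<omega> + \<gamma>)))"
      unfolding err_def ea_def eb_def \<zeta>_def \<kappa>_def I_def
    proof (rule one_step_expansion[OF s gamma e])
      show "0 \<le> S1 \<omega>" "0 \<le> T1 \<omega>" unfolding S1_def T1_def by (rule workload_sup_nonneg)+
      show "S1 \<omega> \<le> S2 \<omega>" "T1 \<omega> \<le> T2 \<omega>" unfolding S1_def T1_def S2_def T2_def using elim by blast+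
      show "S1 \<omega> = J 1 \<omega> - mean - \<gamma> * \<epsilon> + T1 \<omega> + R1 \<omega>" by (simp add: S1_def T1_def R1_def slack_def)
      show "S2 \<omega> = J 1 \<omega> - mean - \<epsilon> + T2 \<omega> + R2 \<omega>" by (simp add: S2_def T2_def R2_def slack_def)
      show "0 \<le> R1 \<omega>" "0 \<le> R2 \<omega>" unfolding R1_def R2_def using elim by blast+
      show "S1 \<omega> \<le> unit_fluctuation \<omega>" if "0 < R1 \<omega>" using that elim unfolding R1_def S1_def by blast
      show "S2 \<omega> \<le> unit_fluctuation \<omega>" if "0 < R2 \<omega>" using that elim unfolding R2_def S2_def by blast
      show "R1 \<omega> \<le> 2 * unit_fluctuation \<omega> + \<gamma>" "R2 \<omega> \<le> 2 * unit_fluctuation \<omega> + \<gamma>"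
        unfolding R1_def R2_def using elim unfolding envelope_def by blast+
      show "\<bar>J 1 \<omega> - mean\<bar> \<le> unit_fluctuation \<omega>" by (rule abs_J_le[OF elim(5)])
    qed
    also have "\<dots> = bound \<omega>" by (simp add: bound_def envelope_def D_def mult_ac)
    finally show ?case .
  qed
  have "\<bar>expectation err\<bar> \<le> expectation (\<lambda>\<omega>. \<bar>err \<omega>\<bar>)" by (rule integral_abs_bound)
  also have "\<dots> \<le> expectation bound" using ierr ibound le by (intro integral_mono_AE) auto
  also have "\<dots> = \<epsilon>\<^sup>2 * (D\<^sup>2 * (9 * expectation (\<lambda>\<omega>. (envelope \<omega>)\<^sup>2 * min 1 (3 * D * \<epsilon> * envelope \<omega>))
        + 7 * (expectation (\<lambda>\<omega>. R1 \<omega> * envelope \<omega>) + expectation (\<lambda>\<omega>. R2 \<omega> * envelope \<omega>))))"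
    unfolding bound_def[abs_def] using iV iRV by simp
  finally have main: "\<bar>A * (kernel s1 s2 + \<epsilon>\<^sup>2 * \<kappa>\<^sup>2 / 2) - (s1 - s2) * idle_transform s2 \<epsilon> - s2\<bar>
      \<le> D\<^sup>2 * (9 * expectation (\<lambda>\<omega>. (envelope \<omega>)\<^sup>2 * min 1 (3 * D * \<epsilon> * envelope \<omega>))
        + 7 * (expectation (\<lambda>\<omega>. R1 \<omega> * envelope \<omega>) + expectation (\<lambda>\<omega>. R2 \<omega> * envelope \<omega>)))"
    using e unfolding eerr abs_minus_cancel abs_mult by simp
  have "\<bar>A * (\<epsilon>\<^sup>2 * \<kappa>\<^sup>2 / 2)\<bar> \<le> 1 * (\<epsilon>\<^sup>2 * \<kappa>\<^sup>2 / 2)"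
    unfolding abs_mult using scaled_transform_bounds[OF s e(1)] by (intro mult_mono) (auto simp: A_def)
  with main show ?thesis unfolding A_def R1_def R2_def distrib_left[of _ "kernel s1 s2"] by linarith
qed

text \<open>The asymptotic functional equation of the tandem queue.\<close>

lemma balance:
  assumes s: "0 \<le> s1" "0 \<le> s2"
  shows "((\<lambda>\<epsilon>. scaled_transform s1 s2 \<epsilon> * kernel s1 s2 - (s1 - s2) * idle_transform s2 \<epsilon> - s2) \<longlongrightarrow> 0) (at_right 0)"
proof (rule Lim_null_comparison)
  define D where "D = \<gamma> * (s1 + s2 + 1)"
  define \<kappa> where "\<kappa> = \<gamma> * s1 - (\<gamma> - 1) * s2"
  define g where "g \<epsilon> = D\<^sup>2 * (9 * expectation (\<lambda>\<omega>. (envelope \<omega>)\<^sup>2 * min 1 (3 * D * \<epsilon> * envelope \<omega>))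
        + 7 * (expectation (\<lambda>\<omega>. slack (\<gamma> * \<epsilon>) \<omega> * envelope \<omega>) + expectation (\<lambda>\<omega>. slack \<epsilon> \<omega> * envelope \<omega>)))
      + \<epsilon>\<^sup>2 * \<kappa>\<^sup>2 / 2" for \<epsilon>
  have "\<forall>\<^sub>F \<epsilon> in at_right (0::real). 0 < \<epsilon> \<and> \<epsilon> < 1"
    by (auto simp: eventually_at_right_field intro!: exI[of _ 1])
  then show "\<forall>\<^sub>F \<epsilon> in at_right 0. norm (scaled_transform s1 s2 \<epsilon> * kernel s1 s2 - (s1 - s2) * idle_transform s2 \<epsilon> - s2) \<le> g \<epsilon>"
  proof eventually_elim
    case (elim \<epsilon>)
    then show ?case using balance_error[OF s, of \<epsilon>] unfolding g_def D_def \<kappa>_def real_norm_def by simp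
  qed
  have "0 < D" using s gamma by (simp add: D_def)
  have "filterlim (\<lambda>\<epsilon>. \<gamma> * \<epsilon>) (at_right 0) (at_right 0)"
    using gamma by real_asymp
  note sl = filterlim_compose[OF slack_envelope_tendsto this]
  have "0 < 3 * D" using \<open>0 < D\<close> by simp
  note env = envelope_min_tendsto[OF this]
  have "((\<lambda>\<epsilon>::real. \<epsilon>\<^sup>2 * \<kappa>\<^sup>2 / 2) \<longlongrightarrow> 0\<^sup>2 * \<kappa>\<^sup>2 / 2) (at_right 0)"
    by (intro tendsto_intros) simp
  then have "(g \<longlongrightarrow> D\<^sup>2 * (9 * 0 + 7 * (0 + 0)) + 0\<^sup>2 * \<kappa>\<^sup>2 / 2) (at_right 0)"
    unfolding g_def by (intro tendsto_add tendsto_mult_left env sl slack_envelope_tendsto)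
  then show "(g \<longlongrightarrow> 0) (at_right 0)" by simp
qed

section \<open>The limit of the transform\<close>

text \<open>This is \<open>\<sigma> * sqrt (\<gamma>\<^sup>2 / \<sigma>\<^sup>2 + 2 * (\<gamma> - 1) * v)\<close> in a form whose square is polynomial.\<close>

definition root_disc :: "real \<Rightarrow> real" where
  "root_disc v = sqrt (\<gamma>\<^sup>2 + 2 * \<sigma>\<^sup>2 * (\<gamma> - 1) * v)"

text \<open>The nonnegative zero of the kernel in its first argument.\<close>

definition kernel_root :: "real \<Rightarrow> real" where
  "kernel_root v = (root_disc v - \<gamma>) / \<sigma>\<^sup>2"

definition idle_limit :: "real \<Rightarrow> real" where
  "idle_limit v = (root_disc v + \<gamma>) / (root_disc v + 2 - \<gamma>)"

text \<open>The limit with the common factor \<open>u - kernel_root v\<close> of numerator and denominator cancelled; this form is continuous on the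
  whole quadrant.\<close>

definition limit_transform :: "real \<Rightarrow> real \<Rightarrow> real" where
  "limit_transform u v = 2 * idle_limit v / (\<sigma>\<^sup>2 * u + root_disc v + \<gamma>)"

lemma root_disc_square: "0 \<le> v \<Longrightarrow> (root_disc v)\<^sup>2 = \<gamma>\<^sup>2 + 2 * \<sigma>\<^sup>2 * (\<gamma> - 1) * v"
  unfolding root_disc_def using gamma by (intro real_sqrt_pow2) simp

lemma root_disc_ge: "0 \<le> v \<Longrightarrow> \<gamma> \<le> root_disc v"
  unfolding root_disc_def using gamma by (intro real_le_rsqrt) simp

lemma root_disc_0: "root_disc 0 = \<gamma>"
  using gamma by (simp add: root_disc_def)

lemma kernel_root_nonneg: "0 \<le> v \<Longrightarrow> 0 \<le> kernel_root v"
  using root_disc_ge[of v] by (simp add: kernel_root_def)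

lemma kernel_factor:
  assumes "0 \<le> v"
  shows "kernel u v = (u - kernel_root v) * (\<sigma>\<^sup>2 * u + root_disc v + \<gamma>) / 2"
proof -
  have sq: "\<sigma>\<^sup>2 * kernel_root v = root_disc v - \<gamma>" using sigma by (simp add: kernel_root_def)
  have "kernel_root v * (root_disc v + \<gamma>) * \<sigma>\<^sup>2 = (root_disc v - \<gamma>) * (root_disc v + \<gamma>)" by (simp add: sq[symmetric] mult_ac)
  also have "\<dots> = 2 * (\<gamma> - 1) * v * \<sigma>\<^sup>2"
    using root_disc_square[OF assms] by (simp add: power2_eq_square algebra_simps)
  finally have "kernel_root v * (root_disc v + \<gamma>) = 2 * (\<gamma> - 1) * v" using sigma by simp
  moreover have "kernel_root v * (\<sigma>\<^sup>2 * u) = (root_disc v - \<gamma>) * u" by (simp add: sq[symmetric] mult_ac)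
  ultimately show ?thesis unfolding kernel_def by (simp add: power2_eq_square algebra_simps)
qed

lemma kernel_eq_0_iff:
  assumes "0 \<le> u" "0 \<le> v"
  shows "kernel u v = 0 \<longleftrightarrow> u = kernel_root v"
proof -
  have "0 < \<sigma>\<^sup>2 * u + root_disc v + \<gamma>" using assms root_disc_ge[of v] gamma by (intro add_nonneg_pos) auto
  then show ?thesis unfolding kernel_factor[OF assms(2)] by simp
qed

text \<open>For \<open>v > 0\<close> the limit is \<open>v / (v - kernel_root v)\<close>, the value for which the balance equation is consistent at the zero of the
  kernel; the definition extends it to \<open>v = 0\<close>.\<close>

lemma idle_limit_root:
  assumes "0 \<le> v"
  shows "idle_limit v * (v - kernel_root v) = v"
proof -
  have p: "0 < root_disc v + 2 - \<gamma>" using root_disc_ge[OF assms] by simp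
  have "(root_disc v + \<gamma>) * (root_disc v - \<gamma>) = 2 * (\<gamma> - 1) * v * \<sigma>\<^sup>2"
    using root_disc_square[OF assms] by (simp add: power2_eq_square algebra_simps)
  then have "(root_disc v + \<gamma>) * kernel_root v = 2 * (\<gamma> - 1) * v" using sigma by (simp add: kernel_root_def)
  then have "(root_disc v + \<gamma>) * (v - kernel_root v) = v * (root_disc v + 2 - \<gamma>)" by (simp add: algebra_simps)
  then show ?thesis using p by (simp add: idle_limit_def field_simps)
qed

lemma limit_transform_kernel:
  assumes "0 \<le> u" "0 \<le> v"
  shows "limit_transform u v * kernel u v = (u - v) * idle_limit v + v"
proof -
  have "0 < \<sigma>\<^sup>2 * u + root_disc v + \<gamma>" using assms root_disc_ge[of v] gamma by (intro add_nonneg_pos) auto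
  then have "limit_transform u v * kernel u v = idle_limit v * (u - kernel_root v)"
    unfolding kernel_factor[OF assms(2)] limit_transform_def by (simp add: field_simps)
  then show ?thesis using idle_limit_root[OF assms(2)] by (simp add: algebra_simps)
qed

lemma limit_transform_continuous:
  assumes "0 \<le> u" "0 \<le> v"
  shows "isCont (\<lambda>(u, v). limit_transform u v) (u, v)"
proof -
  have n: "\<sigma>\<^sup>2 * u + root_disc v + \<gamma> \<noteq> 0" "root_disc v + 2 - \<gamma> \<noteq> 0"
  proof -
    have "0 < \<sigma>\<^sup>2 * u + root_disc v + \<gamma>" using assms root_disc_ge[of v] gamma by (intro add_nonneg_pos) auto
    then show "\<sigma>\<^sup>2 * u + root_disc v + \<gamma> \<noteq> 0" by simp
    show "root_disc v + 2 - \<gamma> \<noteq> 0" using root_disc_ge[OF assms(2)] by simp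
  qed
  have d: "isCont (\<lambda>p. root_disc (snd p)) (u, v)" unfolding root_disc_def by (intro continuous_intros)
  show ?thesis
    unfolding limit_transform_def idle_limit_def case_prod_unfold
    by (intro continuous_intros d) (use n in auto)
qed

text \<open>The kernel method: at \<open>u = kernel_root v\<close> the bounded transform is multiplied by 0, and the balance equation determines the
  idle transform. For \<open>v = 0\<close> the root is 0 and the equation is void, but then the idle transform is the normalised
  expectation of the slack.\<close>

lemma idle_transform_tendsto:
  assumes v: "0 \<le> v"
  shows "((\<lambda>\<epsilon>. idle_transform v \<epsilon>) \<longlongrightarrow> idle_limit v) (at_right 0)"
proof (cases "v = 0")
  case True
  have "\<forall>\<^sub>F \<epsilon> in at_right 0. idle_transform v \<epsilon> = idle_limit v"
    using eventually_at_right_less[of "0::real"]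
  proof eventually_elim
    case (elim \<epsilon>)
    then show ?case using slack_expectation[of "\<gamma> * \<epsilon>"] gamma True
      by (simp add: idle_transform_def idle_limit_def root_disc_0)
  qed
  then show ?thesis by (rule tendsto_eventually)
next
  case False
  define x where "x = kernel_root v"
  have x0: "0 \<le> x" unfolding x_def by (rule kernel_root_nonneg[OF v])
  \<comment> \<open>at this argument the transform drops out of the balance equation\<close>
  have k: "kernel x v = 0" using kernel_eq_0_iff[OF x0 v] by (simp add: x_def)
  have vx: "v - x \<noteq> 0" using idle_limit_root[OF v] False by (auto simp: x_def)
  have "((\<lambda>\<epsilon>. ((scaled_transform x v \<epsilon> * kernel x v - (x - v) * idle_transform v \<epsilon> - v) + v) / (v - x)) \<longlongrightarrow> (0 + v) / (v - x)) (at_right 0)"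
    by (intro tendsto_intros balance x0 v vx)
  moreover have "((scaled_transform x v \<epsilon> * kernel x v - (x - v) * idle_transform v \<epsilon> - v) + v) / (v - x) = idle_transform v \<epsilon>" for \<epsilon>
    using vx by (simp add: k field_simps)
  moreover have "(0 + v) / (v - x) = idle_limit v"
    using idle_limit_root[OF v] vx by (simp add: x_def field_simps)
  ultimately show ?thesis by simp
qed

lemma scaled_transform_tendsto_regular:
  assumes "0 \<le> u" "0 \<le> v" and k: "kernel u v \<noteq> 0"
  shows "((\<lambda>\<epsilon>. scaled_transform u v \<epsilon>) \<longlongrightarrow> limit_transform u v) (at_right 0)"
proof -
  have "((\<lambda>\<epsilon>. ((scaled_transform u v \<epsilon> * kernel u v - (u - v) * idle_transform v \<epsilon> - v)
      + ((u - v) * idle_transform v \<epsilon> + v)) / kernel u v) \<longlongrightarrow> (0 + ((u - v) * idle_limit v + v)) / kernel u v) (at_right 0)"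
    by (intro tendsto_intros balance idle_transform_tendsto assms)
  moreover have "(0 + ((u - v) * idle_limit v + v)) / kernel u v = limit_transform u v"
    using limit_transform_kernel[OF assms(1,2)] k by (simp add: field_simps)
  ultimately show ?thesis using k by simp
qed

text \<open>At a zero of the kernel the balance equation gives no information. Since the transform is decreasing in its first argument,
  it is squeezed between its values at neighbouring arguments, whose limits are continuous in the argument. At the origin it
  equals 1.\<close>

lemma scaled_transform_tendsto:
  assumes u: "0 \<le> u" and v: "0 \<le> v"
  shows "((\<lambda>\<epsilon>. scaled_transform u v \<epsilon>) \<longlongrightarrow> limit_transform u v) (at_right 0)"
proof (cases "kernel u v = 0")
  case False
  then show ?thesis by (rule scaled_transform_tendsto_regular[OF u v])
next
  case True
  then have ux: "u = kernel_root v" using kernel_eq_0_iff[OF u v] by simp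
  have regular: "((\<lambda>\<epsilon>. scaled_transform w v \<epsilon>) \<longlongrightarrow> limit_transform w v) (at_right 0)" if "0 \<le> w" "w \<noteq> u" for w
    using that kernel_eq_0_iff[OF _ v] ux by (intro scaled_transform_tendsto_regular v) auto
  have cont: "isCont (\<lambda>w. limit_transform w v) u"
  proof -
    have "isCont (\<lambda>w. (w, v)) u" by (intro continuous_intros)
    from isCont_o2[of u "\<lambda>w. (w, v)" "\<lambda>(u, v). limit_transform u v", OF this limit_transform_continuous[OF u v]]
    show ?thesis by simp
  qed
  then have contR: "((\<lambda>w. limit_transform w v) \<longlongrightarrow> limit_transform u v) (at_right u)"
    and contL: "((\<lambda>w. limit_transform w v) \<longlongrightarrow> limit_transform u v) (at_left u)"
    unfolding isCont_def by (auto intro: filterlim_mono at_le)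
  have pos: "\<forall>\<^sub>F \<epsilon> in at_right (0::real). 0 < \<epsilon>" by (rule eventually_at_right_less)
  show ?thesis
  proof (cases "u = 0")
    case u0: True
    have "root_disc v = \<gamma>" using ux u0 sigma by (simp add: kernel_root_def)
    then have "v = 0" using root_disc_square[OF v] sigma gamma by simp
    then have "scaled_transform u v \<epsilon> = 1" for \<epsilon> using u0 by (simp add: scaled_transform_def prob_space)
    moreover have "limit_transform u v = 1" using \<open>v = 0\<close> u0 gamma by (simp add: limit_transform_def idle_limit_def root_disc_0)
    ultimately show ?thesis by simp
  next
    case False
    then have upos: "0 < u" using u by simp
    show ?thesis
    proof (rule order_tendstoI)
      fix a assume "a < limit_transform u v"
      then have "\<forall>\<^sub>F w in at_right u. a < limit_transform w v" by (rule order_tendstoD(1)[OF contR])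
      then obtain w where w: "u < w" "a < limit_transform w v"
        using eventually_happens'[OF trivial_limit_at_right_real] eventually_conj[OF _ eventually_at_right_less] by blast
      have "\<forall>\<^sub>F \<epsilon> in at_right 0. a < scaled_transform w v \<epsilon>"
        using regular[of w] w u by (intro order_tendstoD(1)) auto
      then show "\<forall>\<^sub>F \<epsilon> in at_right 0. a < scaled_transform u v \<epsilon>"
        using pos by eventually_elim (use scaled_transform_antimono[OF u less_imp_le[OF w(1)] v] in fastforce)
    next
      fix a assume "limit_transform u v < a"
      then have "\<forall>\<^sub>F w in at_left u. limit_transform w v < a" by (rule order_tendstoD(2)[OF contL])
      moreover have "\<forall>\<^sub>F w in at_left u. 0 < w \<and> w < u"
        using upos by (auto simp: eventually_at_left_field)
      ultimately obtain w where w: "0 < w" "w < u" "limit_transform w v < a"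
        using eventually_happens'[OF trivial_limit_at_left_real] eventually_conj by blast
      have "\<forall>\<^sub>F \<epsilon> in at_right 0. scaled_transform w v \<epsilon> < a"
        using regular[of w] w by (intro order_tendstoD(2)) auto
      then show "\<forall>\<^sub>F \<epsilon> in at_right 0. scaled_transform u v \<epsilon> < a"
        using pos by eventually_elim (use scaled_transform_antimono[OF less_imp_le[OF w(1)] less_imp_le[OF w(2)] v] in fastforce)
    qed
  qed
qed

definition limit_numerator :: "real \<times> real \<Rightarrow> real" where
  "limit_numerator = (\<lambda>(u, v). v * (\<gamma> - 2 - u * \<sigma>\<^sup>2) - u * \<gamma> + (v - u) * \<sigma> * sqrt (\<gamma>\<^sup>2 / \<sigma>\<^sup>2 + 2 * (\<gamma> - 1) * v))"

definition limit_denominator :: "real \<times> real \<Rightarrow> real" where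
  "limit_denominator = (\<lambda>(u, v). (v * \<sigma>\<^sup>2 + 2) * ((\<gamma> - 1) * v - \<gamma> * u - 1 / 2 * u\<^sup>2 * \<sigma>\<^sup>2))"

lemma limit_denominator_kernel: "limit_denominator (u, v) = - ((v * \<sigma>\<^sup>2 + 2) * kernel u v)"
  by (simp add: limit_denominator_def kernel_def algebra_simps)

lemma limit_denominator_eq_0_iff: "0 \<le> v \<Longrightarrow> limit_denominator (u, v) = 0 \<longleftrightarrow> kernel u v = 0"
  using add_nonneg_pos[of "v * \<sigma>\<^sup>2" 2] by (simp add: limit_denominator_kernel)

text \<open>With \<open>S = root_disc v\<close> the identity behind the cancellation is
  \<open>(v * \<sigma>\<^sup>2 + 2) * (S + \<gamma>) = (S + 2 - \<gamma>) * (S + \<gamma> + v * \<sigma>\<^sup>2)\<close>, a consequence of the formula for \<open>S\<^sup>2\<close>.\<close>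

lemma limit_numerator_eq:
  assumes "0 \<le> u" "0 \<le> v"
  shows "limit_numerator (u, v) = limit_transform u v * limit_denominator (u, v)"
proof -
  have "\<sigma> * sqrt (\<gamma>\<^sup>2 / \<sigma>\<^sup>2 + 2 * (\<gamma> - 1) * v) = sqrt (\<sigma>\<^sup>2 * (\<gamma>\<^sup>2 / \<sigma>\<^sup>2 + 2 * (\<gamma> - 1) * v))"
    using sigma by (simp add: real_sqrt_mult)
  also have "\<sigma>\<^sup>2 * (\<gamma>\<^sup>2 / \<sigma>\<^sup>2 + 2 * (\<gamma> - 1) * v) = \<gamma>\<^sup>2 + 2 * \<sigma>\<^sup>2 * (\<gamma> - 1) * v"
    using sigma by (simp add: field_simps)
  finally have S: "\<sigma> * sqrt (\<gamma>\<^sup>2 / \<sigma>\<^sup>2 + 2 * (\<gamma> - 1) * v) = root_disc v" by (simp add: root_disc_def)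
  have p: "0 < root_disc v + 2 - \<gamma>" using root_disc_ge[OF assms(2)] by simp
  have sq: "root_disc v * root_disc v = \<gamma>\<^sup>2 + 2 * \<sigma>\<^sup>2 * (\<gamma> - 1) * v"
    using root_disc_square[OF assms(2)] by (simp add: power2_eq_square)
  have "(v * \<sigma>\<^sup>2 + 2) * (root_disc v + \<gamma>) = (root_disc v + 2 - \<gamma>) * (root_disc v + \<gamma> + v * \<sigma>\<^sup>2)"
    using sq by (simp add: power2_eq_square algebra_simps)
  then have H: "(v * \<sigma>\<^sup>2 + 2) * idle_limit v = root_disc v + \<gamma> + v * \<sigma>\<^sup>2"
    using p by (simp add: idle_limit_def field_simps)
  have "limit_transform u v * limit_denominator (u, v) = - ((v * \<sigma>\<^sup>2 + 2) * (limit_transform u v * kernel u v))"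
    by (simp add: limit_denominator_kernel)
  also have "\<dots> = - ((u - v) * ((v * \<sigma>\<^sup>2 + 2) * idle_limit v) + v * (v * \<sigma>\<^sup>2 + 2))"
    unfolding limit_transform_kernel[OF assms] by (simp add: algebra_simps)
  also have "\<dots> = limit_numerator (u, v)"
  proof -
    have "(v - u) * \<sigma> * sqrt (\<gamma>\<^sup>2 / \<sigma>\<^sup>2 + 2 * (\<gamma> - 1) * v) = (v - u) * root_disc v"
      by (simp only: mult.assoc[of "v - u"] S)
    then show ?thesis unfolding H limit_numerator_def prod.case by (simp add: algebra_simps)
  qed
  finally show ?thesis by simp
qed

text \<open>Every zero of the denominator in the quadrant is a limit of points \<open>(u + e / 2, v)\<close> at which it does not vanish, so the limit
  that defines the extension is unique.\<close>

lemma quotient_ext_eq: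
  assumes u: "0 \<le> u" and v: "0 \<le> v"
  shows "quotient_ext ({0..} \<times> {0..}) limit_numerator limit_denominator (u, v) = limit_transform u v"
proof (cases "limit_denominator (u, v) = 0")
  case False
  then show ?thesis by (simp add: quotient_ext_def limit_numerator_eq[OF u v])
next
  case True
  let ?S = "{q \<in> {0..} \<times> {0..}. limit_denominator q \<noteq> 0}"
  have ux: "u = kernel_root v" using True limit_denominator_eq_0_iff[OF v] kernel_eq_0_iff[OF u v] by simp
  have "(u, v) islimpt ?S"
    unfolding islimpt_approachable
  proof (intro allI impI)
    fix e :: real assume e: "0 < e"
    \<comment> \<open>the kernel has a single nonnegative zero in its first argument, so moving to the right leaves it\<close>
    have "kernel (u + e/2) v \<noteq> 0" using kernel_eq_0_iff[OF _ v, of "u + e/2"] u e ux by simp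
    then have "(u + e/2, v) \<in> ?S" using u v e limit_denominator_eq_0_iff[OF v] by simp
    then show "\<exists>q\<in>?S. q \<noteq> (u, v) \<and> dist q (u, v) < e"
      using e by (intro bexI[of _ "(u + e/2, v)"]) (auto simp: dist_Pair_Pair dist_real_def)
  qed
  then have nt: "\<not> trivial_limit (at (u, v) within ?S)" by (simp add: trivial_limit_within)
  have "((\<lambda>(u, v). limit_transform u v) \<longlongrightarrow> limit_transform u v) (at (u, v) within ?S)"
    using limit_transform_continuous[OF u v] unfolding isCont_def
    by (auto intro: tendsto_within_subset)
  then have "((\<lambda>q. limit_numerator q / limit_denominator q) \<longlongrightarrow> limit_transform u v) (at (u, v) within ?S)"
  proof (rule Lim_transform_eventually)
    show "\<forall>\<^sub>F q in at (u, v) within ?S. (\<lambda>(u, v). limit_transform u v) q = limit_numerator q / limit_denominator q"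
      unfolding eventually_at_filter by (intro always_eventually) (auto simp: limit_numerator_eq)
  qed
  then have "Lim (at (u, v) within ?S) (\<lambda>q. limit_numerator q / limit_denominator q) = limit_transform u v"
    by (rule tendsto_Lim[OF nt])
  then show ?thesis using True by (simp add: quotient_ext_def)
qed

end

section \<open>The stationary law\<close>

text \<open>The indicator of a closed set is the pointwise limit of bounded continuous functions of the distance to the set, and closed sets
  generate the Borel sets.\<close>

lemma limit_law_unique:
  fixes \<mu> :: "real \<Rightarrow> 'b :: metric_space measure"
  assumes "limit_law \<mu> \<nu>" "limit_law \<mu> \<nu>'"
  shows "\<nu> = \<nu>'"
proof -
  interpret N: prob_space \<nu> using assms(1) by (simp add: limit_law_def)
  interpret N': prob_space \<nu>' using assms(2) by (simp add: limit_law_def)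
  have sets: "sets \<nu> = sets borel" "sets \<nu>' = sets borel" using assms by (auto simp: limit_law_def)
  have meas: "f \<in> borel_measurable \<nu>" "f \<in> borel_measurable \<nu>'" if "continuous_on UNIV f" for f :: "'b \<Rightarrow> real"
    using borel_measurable_continuous_onI[OF that] measurable_cong_sets[OF sets(1) refl] measurable_cong_sets[OF sets(2) refl] by auto
  have int: "(\<integral>x. f x \<partial>\<nu>) = (\<integral>x. f x \<partial>\<nu>')" if "continuous_on UNIV f" "bounded (range f)" for f :: "'b \<Rightarrow> real"
    using assms that unfolding limit_law_def by (blast intro: tendsto_unique[OF trivial_limit_at_top_linorder])
  have closed: "emeasure \<nu> C = emeasure \<nu>' C" if C: "closed C" for C
  proof (cases "C = {}")
    case False
    define f where "f k x = max 0 (1 - real k * infdist x C)" for k x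
    have f: "continuous_on UNIV (f k)" "bounded (range (f k))" "\<bar>f k x\<bar> \<le> 1" for k x
    proof -
      show "continuous_on UNIV (f k)" unfolding f_def by (intro continuous_intros)
      show b: "\<bar>f k x\<bar> \<le> 1" for x using infdist_nonneg[of x C] by (auto simp: f_def)
      show "bounded (range (f k))" unfolding bounded_iff using b by (auto intro!: exI[of _ 1])
    qed
    have lim: "(\<lambda>k. f k x) \<longlonglongrightarrow> indicator C x" for x
    proof (cases "x \<in> C")
      case True
      then have "infdist x C = 0" by simp
      then show ?thesis using True by (simp add: f_def)
    next
      case F: False
      then have p: "0 < infdist x C" using C False by (simp add: infdist_pos_not_in_closed)
      obtain n :: nat where n: "1 / infdist x C < real n" using reals_Archimedean2 by blast
      have "\<forall>\<^sub>F k in sequentially. f k x = 0"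
        using eventually_ge_at_top[of n]
      proof eventually_elim
        case (elim k)
        have "1 < real n * infdist x C" using n p by (simp add: field_simps)
        also have "\<dots> \<le> real k * infdist x C" using elim p by (intro mult_right_mono) auto
        finally show ?case by (simp add: f_def)
      qed
      then show ?thesis using F by (simp add: tendsto_eventually)
    qed
    have Cm: "C \<in> sets \<nu>" "C \<in> sets \<nu>'" using C sets by auto
    have "(\<lambda>k. \<integral>x. f k x \<partial>\<nu>) \<longlonglongrightarrow> (\<integral>x. indicator C x \<partial>\<nu>)"
      by (rule integral_dominated_convergence[where w="\<lambda>_. 1"]) (use f lim meas Cm in auto)
    moreover have "(\<lambda>k. \<integral>x. f k x \<partial>\<nu>') \<longlonglongrightarrow> (\<integral>x. indicator C x \<partial>\<nu>')"
      by (rule integral_dominated_convergence[where w="\<lambda>_. 1"]) (use f lim meas Cm in auto)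
    moreover have "(\<lambda>k. \<integral>x. f k x \<partial>\<nu>) = (\<lambda>k. \<integral>x. f k x \<partial>\<nu>')" using int[OF f(1,2)] by auto
    ultimately have "(\<integral>x. indicator C x \<partial>\<nu>) = (\<integral>x. (indicator C x :: real) \<partial>\<nu>')"
      using LIMSEQ_unique by metis
    then show ?thesis using Cm by (simp add: N.emeasure_eq_measure N'.emeasure_eq_measure)
  qed simp
  show ?thesis
  proof (rule measure_eqI_generator_eq[where \<Omega>=UNIV and E="{C. closed C}" and A="\<lambda>_. UNIV"])
    show "Int_stable {C::'b set. closed C}" by (auto simp: Int_stable_def)
    show "sets \<nu> = sigma_sets UNIV {C. closed C}" "sets \<nu>' = sigma_sets UNIV {C. closed C}"
      unfolding sets borel_eq_closed by simp_all
    show "emeasure \<nu> UNIV \<noteq> \<infinity>" by simp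
  qed (use closed in auto)
qed

context square_integrable_levy
begin

definition limit_pair :: "real \<Rightarrow> real \<Rightarrow> 'a \<Rightarrow> real \<times> real" where
  "limit_pair r1 r2 \<omega> = (workload_sup r1 \<omega>, workload_sup r2 \<omega> - workload_sup r1 \<omega>)"

lemma limit_pair_meas [measurable]: "limit_pair r1 r2 \<in> borel_measurable M"
  unfolding limit_pair_def[abs_def] by measurable

lemma AE_SUP_tendsto:
  assumes c: "0 < c"
  shows "AE \<omega> in M. ((\<lambda>t. SUP s\<in>{0..t}. net_input J (mean + c) s \<omega>) \<longlongrightarrow> workload_sup (mean + c) \<omega>) at_top"
  using AE_bdd(1)[OF c] AE_space
proof eventually_elim
  case (elim \<omega>)
  show ?case unfolding workload_sup_def
    by (rule SUP_tendsto_all_time_sup[OF net_input_0[OF elim(2)] elim(1) cadlag_net_input(1)[OF levy elim(2)]])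
qed

text \<open>After time reversal the expectation is that of running suprema, which converge almost surely.\<close>

lemma limit_law_workload:
  assumes c: "0 < c1" "0 < c2"
  shows "limit_law (workload_law M J (mean + c1) (mean + c2)) (distr M borel (limit_pair (mean + c1) (mean + c2)))"
  unfolding limit_law_def
proof (intro conjI allI impI)
  show "prob_space (distr M borel (limit_pair (mean + c1) (mean + c2)))" by (rule prob_space_distr) measurable
  show "sets (distr M borel (limit_pair (mean + c1) (mean + c2))) = sets borel" by simp
  fix f :: "real \<times> real \<Rightarrow> real" assume "continuous_on UNIV f \<and> bounded (range f)"
  then have f: "continuous_on UNIV f" "bounded (range f)" by auto
  have fm [measurable]: "f \<in> borel_measurable borel" by (rule borel_measurable_continuous_onI[OF f(1)])
  obtain B where B: "\<And>x. \<bar>f x\<bar> \<le> B" using f(2) by (auto simp: bounded_iff)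
  \<comment> \<open>the interval is kept nonempty for all real \<open>t\<close>; only large \<open>t\<close> matter\<close>
  define A where "A t \<omega> = (SUP s\<in>{0..max 1 t}. net_input J (mean + c1) s \<omega>,
      (SUP s\<in>{0..max 1 t}. net_input J (mean + c2) s \<omega>) - (SUP s\<in>{0..max 1 t}. net_input J (mean + c1) s \<omega>))" for t \<omega>
  have Am [measurable]: "A t \<in> borel_measurable M" for t
  proof -
    have [measurable]: "(\<lambda>\<omega>. SUP s\<in>{0..max 1 t}. net_input J r s \<omega>) \<in> borel_measurable M" for r
      by (rule SUP_net_input_meas[OF levy]) simp
    show ?thesis unfolding A_def[abs_def] by measurable
  qed
  have "((\<lambda>t. expectation (\<lambda>\<omega>. f (A t \<omega>))) \<longlongrightarrow> expectation (\<lambda>\<omega>. f (limit_pair (mean + c1) (mean + c2) \<omega>))) at_top"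
  proof (rule integral_dominated_convergence_at_top[where w="\<lambda>_. B"])
    show "AE \<omega> in M. ((\<lambda>t. f (A t \<omega>)) \<longlongrightarrow> f (limit_pair (mean + c1) (mean + c2) \<omega>)) at_top"
      using AE_SUP_tendsto[OF c(1)] AE_SUP_tendsto[OF c(2)]
    proof eventually_elim
      case (elim \<omega>)
      have m: "filterlim (\<lambda>t::real. max 1 t) at_top at_top"
        by (rule filterlim_at_top_mono[OF filterlim_ident]) (auto intro: always_eventually)
      show ?case unfolding A_def limit_pair_def
        by (intro continuous_on_tendsto_compose[OF f(1)] tendsto_Pair tendsto_diff
            filterlim_compose[OF elim(1) m] filterlim_compose[OF elim(2) m]) auto
    qed
  qed (use B in auto)
  moreover have "\<forall>\<^sub>F t in at_top. expectation (\<lambda>\<omega>. f (A t \<omega>)) = (\<integral>x. f x \<partial>workload_law M J (mean + c1) (mean + c2) t)"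
    using eventually_ge_at_top[of "1::real"]
  proof eventually_elim
    case (elim t)
    then have t: "0 < t" by simp
    have "(\<integral>x. f x \<partial>workload_law M J (mean + c1) (mean + c2) t)
        = expectation (\<lambda>\<omega>. f (upstream J (mean + c1) t \<omega>, downstream J (mean + c1) (mean + c2) t \<omega>))"
      unfolding workload_law_def by (rule integral_distr[OF upstream_downstream_meas[OF levy t] fm])
    also have "\<dots> = expectation (\<lambda>\<omega>. f (A t \<omega>))"
      unfolding workload_reversal[OF levy t f] A_def using elim by (simp add: max_absorb2)
    finally show ?case by simp
  qed
  ultimately have "((\<lambda>t. \<integral>x. f x \<partial>workload_law M J (mean + c1) (mean + c2) t)
      \<longlongrightarrow> expectation (\<lambda>\<omega>. f (limit_pair (mean + c1) (mean + c2) \<omega>))) at_top"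
    by (rule Lim_transform_eventually)
  then show "((\<lambda>t. \<integral>x. f x \<partial>workload_law M J (mean + c1) (mean + c2) t)
      \<longlongrightarrow> (\<integral>x. f x \<partial>distr M borel (limit_pair (mean + c1) (mean + c2)))) at_top"
    by (simp add: integral_distr)
qed

lemma steady_state_law_eq:
  assumes "0 < c1" "0 < c2"
  shows "steady_state_law M J (mean + c1) (mean + c2) = distr M borel (limit_pair (mean + c1) (mean + c2))"
  unfolding steady_state_law_def
  using limit_law_workload[OF assms] limit_law_unique by (intro the_equality) blast+

end

lemma (in tandem_heavy_traffic) steady_state_transform:
  assumes "0 < \<epsilon>"
  shows "(\<integral>q. exp (- s1 * \<epsilon> * fst q - s2 * \<epsilon> * snd q) \<partial>steady_state_law M J (mean + \<gamma> * \<epsilon>) (mean + \<epsilon>))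
     = scaled_transform s1 s2 \<epsilon>"
proof -
  have m: "(\<lambda>q. exp (- s1 * \<epsilon> * fst q - s2 * \<epsilon> * snd q)) \<in> borel_measurable borel"
    by (intro borel_measurable_continuous_onI continuous_intros)
  have "0 < \<gamma> * \<epsilon>" using assms gamma by simp
  then show ?thesis
    unfolding steady_state_law_eq[OF \<open>0 < \<gamma> * \<epsilon>\<close> assms] integral_distr[OF limit_pair_meas m]
    by (simp add: scaled_transform_def limit_pair_def)
qed

theorem proposition3p5:
  fixes M :: "'a measure" and J :: "real \<Rightarrow> 'a \<Rightarrow> real" and \<sigma> \<gamma> s1 s2 :: real
  assumes "spectrally_positive_levy M J"
    and "integrable M (\<lambda>\<omega>. (J 1 \<omega>)\<^sup>2)"
    and "prob_space.variance M (J 1) = \<sigma>\<^sup>2"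
    and "0 < \<sigma>"
    and "1 < \<gamma>"
    and "0 \<le> s1" and "0 \<le> s2"
  shows "((\<lambda>\<epsilon>. \<integral>q. exp (- s1 * \<epsilon> * fst q - s2 * \<epsilon> * snd q)
             \<partial>steady_state_law M J (prob_space.expectation M (J 1) + \<gamma> * \<epsilon>)
                                  (prob_space.expectation M (J 1) + \<epsilon>))
          \<longlongrightarrow> quotient_ext ({0..} \<times> {0..})
                (\<lambda>(u, v). v * (\<gamma> - 2 - u * \<sigma>\<^sup>2) - u * \<gamma>
                   + (v - u) * \<sigma> * sqrt (\<gamma>\<^sup>2 / \<sigma>\<^sup>2 + 2 * (\<gamma> - 1) * v))
                (\<lambda>(u, v). (v * \<sigma>\<^sup>2 + 2) * ((\<gamma> - 1) * v - \<gamma> * u - 1 / 2 * u\<^sup>2 * \<sigma>\<^sup>2))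
                (s1, s2)) (at_right 0)"
proof -
  have levy: "levy_process M J" using assms(1) by (simp add: spectrally_positive_levy_def)
  interpret prob_space M by (rule levy_prob[OF levy])
  interpret tandem_heavy_traffic M J \<gamma> \<sigma>
    by unfold_locales (use levy assms in auto)
  have "((\<lambda>\<epsilon>. \<integral>q. exp (- s1 * \<epsilon> * fst q - s2 * \<epsilon> * snd q) \<partial>steady_state_law M J (mean + \<gamma> * \<epsilon>) (mean + \<epsilon>))
     \<longlongrightarrow> limit_transform s1 s2) (at_right 0)"
  proof (rule Lim_transform_eventually[OF scaled_transform_tendsto[OF assms(6,7)]])
    show "\<forall>\<^sub>F \<epsilon> in at_right 0. scaled_transform s1 s2 \<epsilon>
        = (\<integral>q. exp (- s1 * \<epsilon> * fst q - s2 * \<epsilon> * snd q) \<partial>steady_state_law M J (mean + \<gamma> * \<epsilon>) (mean + \<epsilon>))"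
      using eventually_at_right_less[of "0::real"] by eventually_elim (rule steady_state_transform[symmetric])
  qed
  then show ?thesis
    using quotient_ext_eq[OF assms(6,7)] by (simp add: limit_numerator_def limit_denominator_def mean_def)
qed

end
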